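(* Let the predictors $\mathbf X_1,\dots,\mathbf X_n$ be i.i.d. from a distribution $G$ on $[0,1]^d$ with bounded density, let the regression errors have mean zero and variance $\sigma_0^2$, and let the prior hyperparameters be bounded as described in the context. Let $\rho(f_1,f_2)=\int|f_1-f_2|\,dG$ be the $\mathbb L_1(G)$-distance. Let $\gamma\in(0,1)$ and $M_n\to\infty$ be predetermined, and let $J=J_n$ be deterministic with $J\asymp n^{1/(2+d)}$. Consider the test $$\phi_n=\mathbf 1\big\{\Pi\big(\rho(f,\mathcal M_J)\le M_nn^{-1/(d+2)}\,\big|\,\mathbb D_n\big)<\gamma\big\}.$$ Then: (i) $\mathrm E_0\phi_n\to0$ for any fixed $f_0\in\mathcal M$; (ii) $\mathrm E_0(1-\phi_n)\to0$ for any fixed integrable $f_0\notin\overline{\mathcal M}$, where $\overline{\mathcal M}$ is the $\mathbb L_1(G)$-closure of $\mathcal M$; (iii) $$\sup\{\mathrm E_0(1-\phi_n): f_0\in\mathcal H(\alpha,L),\ \rho(f_0,\mathcal M)>\tau_n(\alpha)\}\to0,$$ where $\tau_n(\alpha)=Cn^{-\alpha/(2+d)}$ for some $C>0$ if $\alpha<1$, and $\tau_n(\alpha)=CM_nn^{-1/(2+d)}$ for any $C>1$ if $\alpha=1$.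
   Context: Fix $d\ge1$. For $\mathbf x,\mathbf y\in\mathbb R^d$ write $\mathbf x\preceq\mathbf y$ if $x_k\le y_k$ for all $k$. $\mathcal M$ is the set of functions $f:[0,1]^d\to\mathbb R$ with $f(\mathbf x)\le f(\mathbf y)$ whenever $\mathbf x\preceq\mathbf y$. For a set $\mathcal A$ of functions, $\rho(f,\mathcal A)=\inf\{\rho(f,h):h\in\mathcal A\}$. Partition. For a positive integer $J$ and $\mathbf j\in\{1,\dots,J\}^d$, $I_{\mathbf j}$ is the product over $k=1,\dots,d$ of the intervals $((j_k-1)/J,\,j_k/J]$, where the interval is taken closed at $0$ when $j_k=1$. $\mathcal F_J=\{\sum_{\mathbf j}\theta_{\mathbf j}\mathbf 1_{I_{\mathbf j}}:\theta_{\mathbf j}\in\mathbb R\}$ and $\mathcal M_J=\mathcal F_J\cap\mathcal M$. Data. $\mathbb D_n=\{(\mathbf X_i,Y_i)\}_{i=1}^n$ with $Y_i=f_0(\mathbf X_i)+\varepsilon_i$, where $\varepsilon_i$ are i.i.d. with mean $0$ and finite variance $\sigma_0^2$ (not necessarily normal), independent of the predictors. $\mathrm E_0$ is expectation under this true distribution with regression function $f_0$. $N_{\mathbf j}=\#\{i\le n:\mathbf X_i\in I_{\mathbf j}\}$, $\bar Y|_{I_{\mathbf j}}=N_{\mathbf j}^{-1}\sum_{i:\mathbf X_i\in I_{\mathbf j}}Y_i$ (with $N_{\mathbf j}\bar Y|_{I_{\mathbf j}}=0$ if $N_{\mathbf j}=0$). Prior and posterior. Under the working model $\varepsilon_i\sim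 N(0,\sigma^2)$, $f=\sum_{\mathbf j}\theta_{\mathbf j}\mathbf 1_{I_{\mathbf j}}$ is given the prior $\theta_{\mathbf j}\sim N(\zeta_{\mathbf j},\sigma^2\lambda_{\mathbf j}^2)$ independently, where $\max_{\mathbf j}|\zeta_{\mathbf j}|<\infty$ and $0<\min_{\mathbf j}\lambda_{\mathbf j}^2\le\max_{\mathbf j}\lambda_{\mathbf j}^2<\infty$, these bounds being understood uniformly in $n$. Given $\sigma$, the (unrestricted) posterior is: $\theta_{\mathbf j}$ independent, $$\theta_{\mathbf j}\mid\mathbb D_n,\sigma\sim N\Big(\frac{N_{\mathbf j}\bar Y|_{I_{\mathbf j}}+\zeta_{\mathbf j}\lambda_{\mathbf j}^{-2}}{N_{\mathbf j}+\lambda_{\mathbf j}^{-2}},\ \frac{\sigma^2}{N_{\mathbf j}+\lambda_{\mathbf j}^{-2}}\Big).$$ The parameter $\sigma$ is treated in one of the following ways: (a) $\sigma=\sigma_0$ is known; (b) $\sigma^2$ is replaced by the marginal maximum likelihood estimator $$\hat\sigma_n^2=\frac1n\Big[\sum_{i=1}^n(Y_i-\zeta_{\mathbf j(i)})^2-\sum_{\mathbf j}\frac{N_{\mathbf j}^2(\bar Y|_{I_{\mathbf j}}-\zeta_{\mathbf j})^2}{N_{\mathbf j}+\lambda_{\mathbf j}^{-2}}\Big],$$ where $\mathbf j(i)$ is the index with $\mathbf X_i\in I_{\mathbf j(i)}$; (c) $\sigma^2$ has an inverse-gamma prior $\mathrm{IG}(\beta_1,\beta_2)$, $\beta_1,\beta_2>0$,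 with posterior $\sigma^2\mid\mathbb D_n\sim\mathrm{IG}(\beta_1+n/2,\beta_2+n\hat\sigma_n^2/2)$, and the posterior of $f$ is the corresponding mixture. $\Pi(\cdot\mid\mathbb D_n)$ denotes the resulting posterior of $f$ on $\mathcal F_J$. Hölder class. For $0<\alpha\le1$ and $L>0$, $\mathcal H(\alpha,L)$ is the set of $f:[0,1]^d\to\mathbb R$ with $\sup_{\mathbf x}|f(\mathbf x)|+\sup_{\mathbf x\ne\mathbf y}|f(\mathbf x)-f(\mathbf y)|/\|\mathbf x-\mathbf y\|^\alpha\le L$. $a_n\asymp b_n$ means the ratio is bounded away from $0$ and $\infty$.
   Formalization: Part (ii) additionally assumes M_n n^{-1/(d+2)} → 0, and part (iii) for α<1 additionally assumes M_n n^{-1/(d+2)} = O(n^{-α/(2+d)}); without these growth limits on M_n (e.g. M_n = n) both claims are false. *)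

theory Defs
  imports "HOL-Probability.Probability" "HOL-Library.Landau_Symbols"
begin

text \<open>
  Functions on the unit cube are represented by total functions on \<open>real ^ 'd\<close>, whose values outside
  the cube \<open>{0..1}\<close> never matter: the order on \<open>real ^ 'd\<close> is the componentwise one, so
  \<open>{0..1}\<close> is the cube, and \<open>G\<close> is concentrated on it.
\<close>

definition monotone_fns :: "(real ^ 'd \<Rightarrow> real) set" where
  "monotone_fns = {f. mono_on {0..1} f}"

text \<open>
  Integrals with respect to \<open>G\<close> and to the sampling distribution are taken over the completed measure.
  This leaves the integral of a Borel function unchanged, but for \<open>d \<ge> 2\<close> a coordinatewise monotone
  function need only be Lebesgue measurable, not Borel.
\<close>

definition L1_dist :: "(real ^ 'd) measure \<Rightarrow> (real ^ 'd \<Rightarrow> real) \<Rightarrow> (real ^ 'd \<Rightarrow> real) \<Rightarrow> real" where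
  "L1_dist G f h = (\<integral>x. \<bar>f x - h x\<bar> \<partial>completion G)"

definition L1_setdist :: "(real ^ 'd) measure \<Rightarrow> (real ^ 'd \<Rightarrow> real) \<Rightarrow> (real ^ 'd \<Rightarrow> real) set \<Rightarrow> real" where
  "L1_setdist G f A = (INF h\<in>A. L1_dist G f h)"

definition L1_closure :: "(real ^ 'd) measure \<Rightarrow> (real ^ 'd \<Rightarrow> real) set \<Rightarrow> (real ^ 'd \<Rightarrow> real) set" where
  "L1_closure G A = {f. integrable (completion G) f \<and> (\<forall>e>0. \<exists>h\<in>A. L1_dist G f h < e)}"

text \<open>Suprema are taken in \<^typ>\<open>ennreal\<close>, so that an unbounded family has supremum \<open>\<infinity>\<close>.\<close>

definition holder_class :: "real \<Rightarrow> real \<Rightarrow> (real ^ 'd \<Rightarrow> real) set" where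
  "holder_class \<alpha> L = {f.
     (SUP x\<in>{0..1}. ennreal \<bar>f x\<bar>)
     + (SUP (x, y)\<in>{(x, y). x \<in> {0..1} \<and> y \<in> {0..1} \<and> x \<noteq> y}.
          ennreal (\<bar>f x - f y\<bar> / norm (x - y) powr \<alpha>)) \<le> ennreal L}"


definition indices :: "nat \<Rightarrow> ('d::finite \<Rightarrow> nat) set" where
  "indices J = UNIV \<rightarrow>\<^sub>E {1..J}"

definition cell :: "nat \<Rightarrow> ('d \<Rightarrow> nat) \<Rightarrow> (real ^ 'd) set" where
  "cell J j = {x. \<forall>k. (if j k = 1 then 0 \<le> x $ k else (real (j k) - 1) / real J < x $ k)
                       \<and> x $ k \<le> real (j k) / real J}"

definition cell_index :: "nat \<Rightarrow> real ^ 'd \<Rightarrow> ('d \<Rightarrow> nat)" where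
  "cell_index J x = (THE j. j \<in> indices J \<and> x \<in> cell J j)"

definition step_fn :: "nat \<Rightarrow> (('d \<Rightarrow> nat) \<Rightarrow> real) \<Rightarrow> real ^ 'd \<Rightarrow> real" where
  "step_fn J \<theta> = (\<lambda>x. \<Sum>j\<in>indices J. \<theta> j * indicator (cell J j) x)"

definition step_fns :: "nat \<Rightarrow> (real ^ 'd \<Rightarrow> real) set" where
  "step_fns J = range (step_fn J)"

definition monotone_step_fns :: "nat \<Rightarrow> (real ^ 'd \<Rightarrow> real) set" where
  "monotone_step_fns J = step_fns J \<inter> monotone_fns"


text \<open>
  A sample of size \<open>n\<close> consists of the first \<open>n\<close> terms of \<open>xs\<close> and \<open>ys\<close>. For an empty cell
  \<open>cell_mean\<close> is \<open>0\<close> by division by zero; it only occurs multiplied by \<open>cell_count\<close>.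
\<close>

definition cell_count :: "nat \<Rightarrow> nat \<Rightarrow> (nat \<Rightarrow> real ^ 'd) \<Rightarrow> ('d \<Rightarrow> nat) \<Rightarrow> real" where
  "cell_count J n xs j = real (card {i. i < n \<and> xs i \<in> cell J j})"

definition cell_mean ::
  "nat \<Rightarrow> nat \<Rightarrow> (nat \<Rightarrow> real ^ 'd) \<Rightarrow> (nat \<Rightarrow> real) \<Rightarrow> ('d \<Rightarrow> nat) \<Rightarrow> real" where
  "cell_mean J n xs ys j = (\<Sum>i | i < n \<and> xs i \<in> cell J j. ys i) / cell_count J n xs j"

text \<open>
  The normal distribution with mean \<open>m\<close> and variance \<open>v\<close>, degenerate for \<open>v = 0\<close> (which is possible
  when the variance is estimated from the data).
\<close>

definition normal_law :: "real \<Rightarrow> real \<Rightarrow> real measure" where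
  "normal_law m v = (if v \<le> 0 then return borel m else density lborel (normal_density m (sqrt v)))"

definition inverse_gamma_density :: "real \<Rightarrow> real \<Rightarrow> real \<Rightarrow> real" where
  "inverse_gamma_density a b x =
     (if 0 < x then b powr a / Gamma a * x powr (- a - 1) * exp (- b / x) else 0)"

definition inverse_gamma_law :: "real \<Rightarrow> real \<Rightarrow> real measure" where
  "inverse_gamma_law a b = density lborel (inverse_gamma_density a b)"

definition coef_posterior ::
  "nat \<Rightarrow> (('d \<Rightarrow> nat) \<Rightarrow> real) \<Rightarrow> (('d \<Rightarrow> nat) \<Rightarrow> real) \<Rightarrow> nat \<Rightarrow> (nat \<Rightarrow> real ^ 'd) \<Rightarrow> (nat \<Rightarrow> real) \<Rightarrow>
   real \<Rightarrow> (('d::finite \<Rightarrow> nat) \<Rightarrow> real) measure" where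
  "coef_posterior J \<zeta> lam n xs ys v =
     (\<Pi>\<^sub>M j\<in>indices J.
        normal_law
          ((cell_count J n xs j * cell_mean J n xs ys j + \<zeta> j * inverse ((lam j)\<^sup>2))
             / (cell_count J n xs j + inverse ((lam j)\<^sup>2)))
          (v / (cell_count J n xs j + inverse ((lam j)\<^sup>2))))"

text \<open>Posterior probability, given \<open>\<sigma>\<^sup>2 = v\<close>, that the regression function lies in \<open>A\<close>.\<close>

definition posterior_given ::
  "nat \<Rightarrow> (('d \<Rightarrow> nat) \<Rightarrow> real) \<Rightarrow> (('d \<Rightarrow> nat) \<Rightarrow> real) \<Rightarrow> nat \<Rightarrow> (nat \<Rightarrow> real ^ 'd) \<Rightarrow> (nat \<Rightarrow> real) \<Rightarrow>
   real \<Rightarrow> (real ^ 'd::finite \<Rightarrow> real) set \<Rightarrow> real" where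
  "posterior_given J \<zeta> lam n xs ys v A =
     measure (coef_posterior J \<zeta> lam n xs ys v)
       {\<theta> \<in> space (coef_posterior J \<zeta> lam n xs ys v). step_fn J \<theta> \<in> A}"

definition sigma2_hat ::
  "nat \<Rightarrow> (('d::finite \<Rightarrow> nat) \<Rightarrow> real) \<Rightarrow> (('d \<Rightarrow> nat) \<Rightarrow> real) \<Rightarrow> nat \<Rightarrow> (nat \<Rightarrow> real ^ 'd) \<Rightarrow>
   (nat \<Rightarrow> real) \<Rightarrow> real" where
  "sigma2_hat J \<zeta> lam n xs ys =
     ((\<Sum>i<n. (ys i - \<zeta> (cell_index J (xs i)))\<^sup>2)
      - (\<Sum>j\<in>indices J. (cell_count J n xs j)\<^sup>2 * (cell_mean J n xs ys j - \<zeta> j)\<^sup>2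
                        / (cell_count J n xs j + inverse ((lam j)\<^sup>2)))) / real n"

text \<open>The argument of \<open>Known\<close> is the standard deviation \<open>\<sigma>\<close>, not the variance.\<close>

datatype sigma_treatment =
    Known real
  | Marginal_MLE
  | Inverse_Gamma real real

primrec posterior ::
  "sigma_treatment \<Rightarrow> nat \<Rightarrow> (('d \<Rightarrow> nat) \<Rightarrow> real) \<Rightarrow> (('d \<Rightarrow> nat) \<Rightarrow> real) \<Rightarrow> nat \<Rightarrow>
   (nat \<Rightarrow> real ^ 'd) \<Rightarrow> (nat \<Rightarrow> real) \<Rightarrow> (real ^ 'd::finite \<Rightarrow> real) set \<Rightarrow> real" where
  "posterior (Known \<sigma>) J \<zeta> lam n xs ys A = posterior_given J \<zeta> lam n xs ys (\<sigma>\<^sup>2) A"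
| "posterior Marginal_MLE J \<zeta> lam n xs ys A =
     posterior_given J \<zeta> lam n xs ys (sigma2_hat J \<zeta> lam n xs ys) A"
| "posterior (Inverse_Gamma \<beta>1 \<beta>2) J \<zeta> lam n xs ys A =
     (\<integral>v. posterior_given J \<zeta> lam n xs ys v A
        \<partial>inverse_gamma_law (\<beta>1 + real n / 2) (\<beta>2 + real n * sigma2_hat J \<zeta> lam n xs ys / 2))"

text \<open>The test rejecting when the posterior gives the \<open>r\<close>-neighbourhood of \<open>monotone_step_fns J\<close> mass below \<open>\<gamma>\<close>.\<close>

definition monotonicity_test ::
  "(real ^ 'd) measure \<Rightarrow> sigma_treatment \<Rightarrow> real \<Rightarrow> real \<Rightarrow> nat \<Rightarrow> (('d \<Rightarrow> nat) \<Rightarrow> real) \<Rightarrow>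
   (('d \<Rightarrow> nat) \<Rightarrow> real) \<Rightarrow> nat \<Rightarrow> (nat \<Rightarrow> real ^ 'd) \<Rightarrow> (nat \<Rightarrow> real) \<Rightarrow> real" where
  "monotonicity_test G S \<gamma> r J \<zeta> lam n xs ys =
     of_bool (posterior S J \<zeta> lam n xs ys {f. L1_setdist G f (monotone_step_fns J) \<le> r} < \<gamma>)"


text \<open>
  Expectation of a statistic of the data when the true regression function is \<open>f0\<close>, i.e. when
  \<open>Y\<^sub>i = f0 (X\<^sub>i) + eps\<^sub>i\<close>.
\<close>

definition true_expectation ::
  "'w measure \<Rightarrow> (nat \<Rightarrow> 'w \<Rightarrow> real ^ 'd) \<Rightarrow> (nat \<Rightarrow> 'w \<Rightarrow> real) \<Rightarrow> (real ^ 'd \<Rightarrow> real) \<Rightarrow>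
   ((nat \<Rightarrow> real ^ 'd) \<Rightarrow> (nat \<Rightarrow> real) \<Rightarrow> real) \<Rightarrow> real" where
  "true_expectation P X eps f0 T =
     (\<integral>\<omega>. T (\<lambda>i. X i \<omega>) (\<lambda>i. f0 (X i \<omega>) + eps i \<omega>) \<partial>completion P)"

end

theory Submission
  imports Defs
begin

text \<open>
  Given \<open>\<sigma>\<^sup>2\<close>, the coefficients are independent Gaussians around \<open>\<theta>\<^sub>j = (N\<^sub>j Y\<^sub>j + \<zeta>\<^sub>j / \<lambda>\<^sub>j\<^sup>2) / (N\<^sub>j + 1 / \<lambda>\<^sub>j\<^sup>2)\<close>.
  Since \<open>G(I\<^sub>j) E[1 / (1 + N\<^sub>j)] \<le> 1 / n\<close>, both the stochastic part of \<open>\<theta>\<close> and the posterior spread are of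
  squared \<open>L\<^sub>1\<close> size \<open>J\<^sup>d / n\<close>, that is, of size \<open>n powr (- 1 / (d + 2))\<close>. The bias is of order \<open>1 / J\<close> for a
  monotone function, because its oscillations over the cells telescope along diagonals, and of order
  \<open>J powr - \<alpha>\<close> on a Hoelder class. Chebyshev's inequality then gives the level and the Hoelder power.

  For a merely integrable \<open>f\<close> outside the closure, the estimated variance may be unbounded and the posterior
  need not contract in \<open>L\<^sub>1\<close>. Instead, the step approximation of \<open>f\<close> is separated from the monotone cone by
  a linear functional with weights bounded by \<open>1\<close>. Its posterior variance is of order \<open>\<sigma>\<^sup>2 / n\<close>, and
  \<open>n\<^sup>-\<^sup>2 \<Sum>\<^sub>i f(X\<^sub>i)\<^sup>2 \<longlonglongrightarrow> 0\<close> in probability suffices for it to vanish.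
\<close>

section \<open>Cells of the partition\<close>

text \<open>The errors have only a finite variance, so every tail bound is a Chebyshev or Markov
  bound, and the mean squared error enters only through its expectation, which factorises against
  functionals of the design because design and errors are independent. Random cell counts are
  handled by leaving one observation out: the count of the other points is independent of
  \<open>X i\<close> and is the full count minus one whenever \<open>X i\<close> lies in the cell.
  The same device controls cell averages of a merely integrable function in mean, so the centre of
  the posterior is no obstacle to consistency. The obstacle is the spread. For unbounded f the
  estimated variance is only bounded by something that is o(n) in probability, while the squared L1
  spread is that variance times a quantity of order n powr (-2/(d+2)). A linear functional with
  bounded weights has posterior variance of order 1/n times it, which is just what o(n)
  tolerates.\<close>

lemma cell_interval_iff:
  assumes "1 \<le> m" "0 < J"
  shows "((if m = 1 then 0 \<le> t else (real m - 1) / real J < t) \<and> t \<le> real m / real J)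
    \<longleftrightarrow> 0 \<le> t \<and> m = max 1 (nat \<lceil>real J * t\<rceil>)"
proof -
  have a: "(real m - 1) / real J < t \<longleftrightarrow> real m - 1 < real J * t"
    and b: "t \<le> real m / real J \<longleftrightarrow> real J * t \<le> real m"
    and c: "0 \<le> t \<longleftrightarrow> 0 \<le> real J * t"
    using assms by (auto simp: field_simps zero_le_mult_iff)
  show ?thesis
    unfolding a b c using assms(1)
    apply (cases "m = 1")
     apply (simp; linarith)
    apply simp
    apply linarith
    done
qed

text \<open>Half-open cells closed at 0 are the level sets of the coordinatewise map sending t to
  \<open>max 1 (nat \<lceil>real J * t\<rceil>)\<close>; the maximum puts t = 0 into the first cell.
  Uniqueness, existence and monotonicity of the cell of a point are read off this formula.\<close>

lemma mem_cell_iff: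
  assumes "j \<in> indices J" "0 < J"
  shows "x \<in> cell J j \<longleftrightarrow> 0 \<le> x \<and> (\<forall>k. j k = max 1 (nat \<lceil>real J * x $ k\<rceil>))"
proof -
  have "1 \<le> j k" for k using assms(1) by (auto simp: indices_def PiE_def Pi_def)
  then show ?thesis
    using cell_interval_iff[OF _ assms(2)]
    by (simp add: cell_def less_eq_vec_def) blast
qed

lemma finite_indices [simp, intro]: "finite (indices J :: ('d::finite \<Rightarrow> nat) set)"
  by (simp add: indices_def finite_PiE)

lemma indicesD: "j \<in> indices J \<Longrightarrow> 1 \<le> j k \<and> j k \<le> J"
  by (auto simp: indices_def PiE_def Pi_def)

lemma card_indices: "card (indices J :: ('d::finite \<Rightarrow> nat) set) = J ^ CARD('d)"
  by (simp add: indices_def card_PiE)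

lemma cell_subset_cube:
  assumes "j \<in> indices J"
  shows "cell J j \<subseteq> {0..1}"
proof
  fix x assume x: "x \<in> cell J j"
  have "0 \<le> x $ k \<and> x $ k \<le> 1" for k
  proof -
    have j: "1 \<le> j k" "j k \<le> J" using assms by (auto dest: indicesD)
    have "x $ k \<le> real (j k) / real J" using x by (simp add: cell_def)
    also have "\<dots> \<le> 1" using j by simp
    finally have "x $ k \<le> 1" .
    moreover have "0 \<le> x $ k"
    proof (cases "j k = 1")
      case True then show ?thesis using x by (simp add: cell_def split: if_splits)
    next
      case False
      then have "(real (j k) - 1) / real J < x $ k" using x by (simp add: cell_def split: if_splits)
      moreover have "0 \<le> (real (j k) - 1) / real J" using j by simp
      ultimately show ?thesis by linarith
    qed
    ultimately show ?thesis by simp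
  qed
  then show "x \<in> {0..1}" by (simp add: less_eq_vec_def)
qed

lemma cell_unique:
  assumes "j \<in> indices J" "j' \<in> indices J" "0 < J" "x \<in> cell J j" "x \<in> cell J j'"
  shows "j = j'"
  using assms by (intro ext) (simp add: mem_cell_iff)

lemma ex_cell:
  fixes x :: "real ^ 'd"
  assumes "x \<in> {0..1}" "0 < J"
  obtains j where "j \<in> indices J" "x \<in> cell J j"
proof -
  define j where "j = (\<lambda>k::'d. max 1 (nat \<lceil>real J * x $ k\<rceil>))"
  have "real J * x $ k \<le> real J" for k
    using assms by (simp add: less_eq_vec_def mult_left_le)
  then have "nat \<lceil>real J * x $ k\<rceil> \<le> J" for k by (metis ceiling_le_iff nat_le_iff of_int_of_nat_eq)
  then have "j \<in> indices J" using assms(2) by (auto simp: j_def indices_def PiE_def)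
  moreover from this have "x \<in> cell J j" using assms by (simp add: mem_cell_iff j_def)
  ultimately show ?thesis by (rule that)
qed

lemma cell_index_eq:
  assumes "j \<in> indices J" "0 < J" "x \<in> cell J j"
  shows "cell_index J x = j"
  unfolding cell_index_def using assms by (intro the_equality) (auto intro: cell_unique)

lemma step_fn_eq:
  assumes "j \<in> indices J" "0 < J" "x \<in> cell J j"
  shows "step_fn J \<theta> x = \<theta> j"
proof -
  have "step_fn J \<theta> x = (\<Sum>i\<in>indices J. if i = j then \<theta> j else 0)"
    unfolding step_fn_def using assms by (intro sum.cong) (auto simp: indicator_def dest: cell_unique)
  then show ?thesis using assms(1) by simp
qed

text \<open>The upper corner belongs to the half-open cell and serves as its sample point. The lower
  corner in general does not; it only bounds the cell from below.\<close>

definition upper :: "nat \<Rightarrow> ('d \<Rightarrow> nat) \<Rightarrow> real ^ 'd" where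
  "upper J j = (\<chi> k. real (j k) / real J)"

definition lower :: "nat \<Rightarrow> ('d \<Rightarrow> nat) \<Rightarrow> real ^ 'd" where
  "lower J j = (\<chi> k. (real (j k) - 1) / real J)"

lemma upper_in_cell:
  assumes "j \<in> indices J" "0 < J"
  shows "upper J j \<in> cell J j"
  using assms by (auto simp: cell_def upper_def divide_strict_right_mono)

lemma cell_bounds:
  assumes "x \<in> cell J j"
  shows "lower J j \<le> x" "x \<le> upper J j"
proof -
  have "(real (j k) - 1) / real J \<le> x $ k" for k
    using assms by (auto simp: cell_def split: if_splits dest!: spec[of _ k])
  then show "lower J j \<le> x" by (simp add: lower_def less_eq_vec_def)
  show "x \<le> upper J j" using assms by (simp add: upper_def less_eq_vec_def cell_def)
qed

lemma cell_le:
  assumes "j \<in> indices J" "j' \<in> indices J" "0 < J" "x \<in> cell J j" "y \<in> cell J j'" "x \<le> y"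
  shows "j \<le> j'"
proof (rule le_funI)
  fix k
  have "real J * x $ k \<le> real J * y $ k"
    using assms(3,6) by (simp add: less_eq_vec_def)
  then have "nat \<lceil>real J * x $ k\<rceil> \<le> nat \<lceil>real J * y $ k\<rceil>" by (intro nat_mono ceiling_mono)
  then show "j k \<le> j' k" using assms(1-5) by (auto simp: mem_cell_iff)
qed

section \<open>Monotone step functions as a polyhedral cone of coefficients\<close>

definition monotone_coefs :: "nat \<Rightarrow> (('d::finite \<Rightarrow> nat) \<Rightarrow> real) set" where
  "monotone_coefs J = {\<theta>. \<forall>i\<in>indices J. \<forall>j\<in>indices J. i \<le> j \<longrightarrow> \<theta> i \<le> \<theta> j}"

text \<open>Evaluation at upper corners gives one direction. The other holds because comparable
  points of the cube lie in comparable cells.\<close>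

lemma step_fn_monotone_iff:
  assumes "0 < J"
  shows "step_fn J \<theta> \<in> monotone_fns \<longleftrightarrow> \<theta> \<in> monotone_coefs J"
proof
  assume l: "step_fn J \<theta> \<in> monotone_fns"
  show "\<theta> \<in> monotone_coefs J"
    unfolding monotone_coefs_def
  proof safe
    fix i j :: "'a \<Rightarrow> nat" assume ij: "i \<in> indices J" "j \<in> indices J" "i \<le> j"
    have "upper J i \<le> upper J j" using ij(3) by (simp add: upper_def less_eq_vec_def le_fun_def divide_right_mono)
    moreover have "upper J i \<in> {0..1}" "upper J j \<in> {0..1}"
      using ij upper_in_cell assms cell_subset_cube by blast+
    ultimately have "step_fn J \<theta> (upper J i) \<le> step_fn J \<theta> (upper J j)"
      using l by (auto simp: monotone_fns_def mono_on_def)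
    then show "\<theta> i \<le> \<theta> j" using ij assms by (simp add: step_fn_eq[OF _ _ upper_in_cell])
  qed
next
  assume r: "\<theta> \<in> monotone_coefs J"
  show "step_fn J \<theta> \<in> monotone_fns"
    unfolding monotone_fns_def mem_Collect_eq
  proof (rule mono_onI)
    fix x y :: "real ^ 'a" assume xy: "x \<in> {0..1}" "y \<in> {0..1}" "x \<le> y"
    obtain i where i: "i \<in> indices J" "x \<in> cell J i" using ex_cell[OF xy(1) assms] .
    obtain j where j: "j \<in> indices J" "y \<in> cell J j" using ex_cell[OF xy(2) assms] .
    have "i \<le> j" using cell_le i j assms xy(3) by blast
    then show "step_fn J \<theta> x \<le> step_fn J \<theta> y"
      using r i j by (simp add: step_fn_eq[OF _ assms] monotone_coefs_def)
  qed
qed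

lemma monotone_step_fns_eq:
  assumes "0 < J"
  shows "monotone_step_fns J = step_fn J ` monotone_coefs J"
  using step_fn_monotone_iff[OF assms] by (auto simp: monotone_step_fns_def step_fns_def)

section \<open>Measurability, volume and diameter of cells\<close>

lemma cell_measurable [measurable]: "cell J j \<in> sets borel"
  unfolding cell_def by measurable

lemma step_fn_measurable [measurable]: "step_fn J \<theta> \<in> borel_measurable borel"
  unfolding step_fn_def by measurable

lemma emeasure_cell_le:
  fixes j :: "'d::finite \<Rightarrow> nat"
  assumes "0 < J"
  shows "emeasure lborel (cell J j) \<le> ennreal ((1 / real J) ^ CARD('d))"
proof -
  have "cell J j \<subseteq> cbox (lower J j) (upper J j)"
    using cell_bounds by (auto simp: cbox_interval)
  then have "emeasure lborel (cell J j) \<le> emeasure lborel (cbox (lower J j) (upper J j))"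
    by (intro emeasure_mono) auto
  also have "\<dots> = ennreal (\<Prod>b\<in>Basis. (upper J j - lower J j) \<bullet> b)"
    by (rule emeasure_lborel_cbox) (auto simp: Basis_vec_def inner_axis lower_def upper_def divide_right_mono)
  also have "(\<Prod>b\<in>Basis. (upper J j - lower J j) \<bullet> b) = (\<Prod>b\<in>(Basis :: (real ^ 'd) set). 1 / real J)"
    by (intro prod.cong) (auto simp: Basis_vec_def inner_axis lower_def upper_def diff_divide_distrib)
  also have "\<dots> = (1 / real J) ^ CARD('d)" by simp
  finally show ?thesis .
qed

text \<open>The l1 norm bounds the Euclidean norm. This gives d/J in place of the sharp sqrt d / J,
  but only the order 1/J matters for the rates.\<close>

lemma cell_diameter:
  fixes x :: "real ^ 'd"
  assumes "x \<in> cell J j" "y \<in> cell J j"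
  shows "norm (x - y) \<le> real CARD('d) / real J"
proof -
  have "\<bar>(x - y) $ k\<bar> \<le> 1 / real J" for k
  proof -
    have "lower J j $ k \<le> x $ k" "lower J j $ k \<le> y $ k" "x $ k \<le> upper J j $ k" "y $ k \<le> upper J j $ k"
      using cell_bounds[OF assms(1)] cell_bounds[OF assms(2)] by (auto simp: less_eq_vec_def)
    then show ?thesis by (simp add: lower_def upper_def diff_divide_distrib)
  qed
  then have "(\<Sum>k\<in>UNIV. \<bar>(x - y) $ k\<bar>) \<le> (\<Sum>k\<in>(UNIV::'d set). 1 / real J)" by (rule sum_mono)
  with norm_le_l1_cart[of "x - y"] show ?thesis by simp
qed

section \<open>Separation from the monotone cone\<close>

text \<open>The quotient is the derivative of the smooth function sqrt (\<delta> squared + x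
  squared). It replaces the sign of x: it stays bounded by 1 and loses at most \<delta> when paired
  with x.\<close>

lemma smoothed_abs_deriv_bound:
  fixes x \<delta> :: real
  assumes "0 < \<delta>"
  shows "\<bar>x / sqrt (\<delta>\<^sup>2 + x\<^sup>2)\<bar> \<le> 1" "\<bar>x\<bar> - \<delta> \<le> x / sqrt (\<delta>\<^sup>2 + x\<^sup>2) * x"
proof -
  have pos: "0 < \<delta>\<^sup>2 + x\<^sup>2" using assms by (simp add: add_pos_nonneg)
  let ?s = "sqrt (\<delta>\<^sup>2 + x\<^sup>2)"
  have s: "0 < ?s" "\<bar>x\<bar> \<le> ?s" "\<delta> \<le> ?s"
    using pos assms by (auto intro!: real_le_rsqrt)
  show "\<bar>x / ?s\<bar> \<le> 1" using s by (simp add: abs_divide)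
  have "?s * ?s = \<delta>\<^sup>2 + x\<^sup>2" using pos by simp
  then have "?s - \<delta>\<^sup>2 / ?s = x\<^sup>2 / ?s" using s(1)
    by (metis add_diff_cancel_left' diff_divide_distrib less_numeral_extra(3) nonzero_mult_div_cancel_right)
  then have "x / ?s * x = ?s - \<delta>\<^sup>2 / ?s" by (simp add: power2_eq_square)
  moreover have "\<delta>\<^sup>2 / ?s \<le> \<delta>" using s assms by (simp add: field_simps power2_eq_square)
  ultimately show "\<bar>x\<bar> - \<delta> \<le> x / ?s * x" using s by linarith
qed

text \<open>Tychonoff's theorem on an arbitrary index type. Coordinates with
  \<open>l i = u i\<close> are frozen, which is how a finite set of free coordinates is
  embedded.\<close>

lemma compact_box_fun:
  fixes l u :: "'a \<Rightarrow> real"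
  shows "compact {a. \<forall>i. l i \<le> a i \<and> a i \<le> u i}"
proof -
  have "compactin (product_topology (\<lambda>_. euclidean) UNIV) (PiE UNIV (\<lambda>i. {l i..u i}))"
    unfolding compactin_PiE by simp
  moreover have "PiE UNIV (\<lambda>i. {l i..u i}) = {a. \<forall>i. l i \<le> a i \<and> a i \<le> u i}"
    by (auto simp: PiE_def Pi_def)
  ultimately show ?thesis by (simp add: euclidean_product_topology)
qed

text \<open>
  The weights are the derivative of a smoothed \<open>L\<^sub>1\<close> distance at its minimiser over the cone; unlike
  the weights given by an \<open>L\<^sub>2\<close> projection they are bounded by \<open>1\<close>.
\<close>

lemma separating_weights:
  fixes p \<theta> :: "'a \<Rightarrow> real" and R :: "'a \<Rightarrow> 'a \<Rightarrow> bool" and I :: "'a set"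
  defines "K \<equiv> {a :: 'a \<Rightarrow> real. \<forall>i\<in>I. \<forall>j\<in>I. R i j \<longrightarrow> a i \<le> a j}"
  assumes I: "finite I" and p: "\<And>i. i \<in> I \<Longrightarrow> 0 \<le> p i" "sum p I \<le> 1" and "0 < \<delta>"
    and dist: "\<And>a. a \<in> K \<Longrightarrow> e \<le> (\<Sum>i\<in>I. p i * \<bar>\<theta> i - a i\<bar>)"
  obtains w where "\<And>i. \<bar>w i\<bar> \<le> 1" "\<And>a. a \<in> K \<Longrightarrow> (\<Sum>i\<in>I. p i * w i * a i) \<le> 0"
    "e - \<delta> \<le> (\<Sum>i\<in>I. p i * w i * \<theta> i)"
proof -
  define F where "F = (\<lambda>a. \<Sum>i\<in>I. p i * sqrt (\<delta>\<^sup>2 + (\<theta> i - a i)\<^sup>2))"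
  define b where "b = (\<Sum>i\<in>I. \<bar>\<theta> i\<bar>)"
  have b: "\<bar>\<theta> i\<bar> \<le> b" if "i \<in> I" for i
    unfolding b_def using I that by (intro member_le_sum) auto
  have b0: "0 \<le> b" unfolding b_def by (intro sum_nonneg) auto
  define l where "l = (\<lambda>i. if i \<in> I then - b else 0)"
  define u where "u = (\<lambda>i. if i \<in> I then b else 0)"
  define C where "C = {a. \<forall>i. l i \<le> a i \<and> a i \<le> u i} \<inter> K"
  have "K = (\<Inter>i\<in>I. \<Inter>j\<in>I. if R i j then {a. a i \<le> a j} else UNIV)"
    unfolding K_def by (auto split: if_splits)
  moreover have "closed {a :: 'a \<Rightarrow> real. a i \<le> a j}" for i j
    by (intro closed_Collect_le continuous_on_product_coordinates)
  ultimately have "closed K" by auto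
  then have "compact C" unfolding C_def by (intro compact_Int_closed compact_box_fun)
  moreover have "(\<lambda>_. 0) \<in> C" using b0 by (auto simp: C_def K_def l_def u_def)
  moreover have "continuous_on C F"
    unfolding F_def by (intro continuous_intros continuous_on_subset[OF continuous_on_product_coordinates]) auto
  ultimately obtain a where a: "a \<in> C" "\<And>c. c \<in> C \<Longrightarrow> F a \<le> F c"
    using continuous_attains_inf[of C F] by blast
  have min: "F a \<le> F c" if c: "c \<in> K" for c
  proof -
    \<comment> \<open>Clipping to the interval from -b to b preserves the order relations and, since
      every \<open>\<theta> i\<close> lies in that interval, moves no coordinate away from
      \<open>\<theta> i\<close>. Hence the minimum over the compact set \<open>C\<close> is a
      minimum over all of \<open>K\<close>.\<close>
    define c' where "c' = (\<lambda>i. if i \<in> I then max (- b) (min b (c i)) else 0)"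
    have "c' \<in> C" using c b0 by (fastforce simp: C_def K_def c'_def l_def u_def)
    then have "F a \<le> F c'" by (rule a)
    also have "\<dots> \<le> F c" unfolding F_def
    proof (intro sum_mono mult_left_mono p real_sqrt_le_mono add_left_mono)
      fix i assume i: "i \<in> I"
      have "\<bar>\<theta> i - c' i\<bar> \<le> \<bar>\<theta> i - c i\<bar>" using b[OF i] i by (auto simp: c'_def)
      then show "(\<theta> i - c' i)\<^sup>2 \<le> (\<theta> i - c i)\<^sup>2" by (simp only: abs_le_square_iff)
    qed
    finally show ?thesis .
  qed
  have aK: "a \<in> K" using a(1) by (simp add: C_def)
  define w where "w = (\<lambda>i. (\<theta> i - a i) / sqrt (\<delta>\<^sup>2 + (\<theta> i - a i)\<^sup>2))"
  \<comment> \<open>First-order condition at the minimiser: \<open>F\<close> cannot decrease along a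
    feasible direction c, and its derivative there is minus this sum.\<close>
  have dir: "(\<Sum>i\<in>I. p i * w i * c i) \<le> 0"
    if c: "\<And>t. 0 < t \<Longrightarrow> t < 1 \<Longrightarrow> (\<lambda>i. a i + t * c i) \<in> K" for c
  proof (rule ccontr)
    assume neg: "\<not> ?thesis"
    define h where "h = (\<lambda>t. F (\<lambda>i. a i + t * c i))"
    have "(h has_real_derivative (\<Sum>i\<in>I. p i * (- w i * c i))) (at 0)"
      unfolding h_def F_def
    proof (rule DERIV_sum, rule DERIV_cmult)
      fix i
      have "0 < \<delta>\<^sup>2 + (\<theta> i - (a i + 0 * c i))\<^sup>2" using \<open>0 < \<delta>\<close> by (simp add: add_pos_nonneg)
      then show "((\<lambda>t. sqrt (\<delta>\<^sup>2 + (\<theta> i - (a i + t * c i))\<^sup>2)) has_real_derivative - w i * c i) (at 0)"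
        by (auto intro!: derivative_eq_intros simp: w_def divide_simps algebra_simps)
    qed
    moreover have "(\<Sum>i\<in>I. p i * (- w i * c i)) < 0"
      using neg by (simp add: sum_negf mult.assoc)
    ultimately obtain d where d: "0 < d" "\<And>t. 0 < t \<Longrightarrow> t < d \<Longrightarrow> h (0 + t) < h 0"
      using DERIV_neg_dec_right by meson
    define t where "t = min (d / 2) (1 / 2)"
    have t: "0 < t" "t < d" "t < 1" using d(1) by (auto simp: t_def)
    have "h t < h 0" using d(2)[OF t(1,2)] by simp
    moreover have "F a \<le> h t" unfolding h_def using t c by (intro min) auto
    ultimately show False by (simp add: h_def)
  qed
  show ?thesis
  proof (rule that[of w])
    show "\<bar>w i\<bar> \<le> 1" for i unfolding w_def using smoothed_abs_deriv_bound(1)[OF \<open>0 < \<delta>\<close>] .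
    show "(\<Sum>i\<in>I. p i * w i * c i) \<le> 0" if "c \<in> K" for c
      using that aK by (intro dir) (auto simp: K_def intro!: add_mono mult_left_mono)
    \<comment> \<open>Shrinking \<open>a\<close> towards 0 stays in the cone, so -a is feasible as
      well. The functional is therefore nonnegative at \<open>a\<close>, and its value at
      \<open>\<theta>\<close> is at least its value at \<theta> - a.\<close>
    have "(\<Sum>i\<in>I. p i * w i * - a i) \<le> 0"
    proof (rule dir)
      fix t :: real assume "0 < t" "t < 1"
      then have "(1 - t) * a i \<le> (1 - t) * a j" if "i \<in> I" "j \<in> I" "R i j" for i j
        using that aK by (intro mult_left_mono) (auto simp: K_def)
      then show "(\<lambda>i. a i + t * - a i) \<in> K" by (simp add: K_def algebra_simps)
    qed
    then have 1: "0 \<le> (\<Sum>i\<in>I. p i * w i * a i)" by (simp add: sum_negf)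
    have "e - \<delta> \<le> (\<Sum>i\<in>I. p i * \<bar>\<theta> i - a i\<bar>) - \<delta> * sum p I"
      using dist[OF aK] mult_left_mono[OF p(2) less_imp_le[OF \<open>0 < \<delta>\<close>]] by linarith
    also have "\<dots> = (\<Sum>i\<in>I. p i * (\<bar>\<theta> i - a i\<bar> - \<delta>))"
      by (simp add: sum_distrib_left sum_subtractf algebra_simps)
    also have "\<dots> \<le> (\<Sum>i\<in>I. p i * (w i * (\<theta> i - a i)))"
      using smoothed_abs_deriv_bound(2)[OF \<open>0 < \<delta>\<close>] p by (intro sum_mono mult_left_mono) (auto simp: w_def)
    also have "\<dots> = (\<Sum>i\<in>I. p i * w i * \<theta> i) - (\<Sum>i\<in>I. p i * w i * a i)"
      by (simp add: sum_subtractf algebra_simps)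
    finally show "e - \<delta> \<le> (\<Sum>i\<in>I. p i * w i * \<theta> i)" using 1 by linarith
  qed
qed

section \<open>The inverse gamma law\<close>

text \<open>Substitution t = b / x in Euler's integral for \<open>Gamma\<close>. The point 0 is
  removed beforehand because the substitution is a bijection of the open half line.\<close>

lemma inverse_gamma_kernel_integral:
  fixes a b :: real
  assumes a: "0 < a" and b: "0 < b"
  shows "((\<lambda>x. x powr (- a - 1) * exp (- b / x)) has_integral Gamma a / b powr a) {0<..}"
    "(\<lambda>x. x powr (- a - 1) * exp (- b / x)) absolutely_integrable_on {0<..}"
proof -
  define f where "f = (\<lambda>t::real. t powr (a - 1) / exp t)"
  define g where "g = (\<lambda>x::real. b / x)"
  have "(f has_integral Gamma a) {0..}" unfolding f_def by (rule Gamma_integral_real[OF a])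
  then have "((\<lambda>t. if t \<in> {0<..} then f t else 0) has_integral Gamma a) {0..}"
    by (rule has_integral_spike[of "{0}", rotated 2]) auto
  then have f: "(f has_integral Gamma a) {0<..}"
    by (subst (asm) has_integral_restrict) auto
  then have f': "f absolutely_integrable_on {0<..}" "integral {0<..} f = Gamma a"
    by (auto intro!: nonnegative_absolutely_integrable_1 simp: integrable_on_def f_def)
  have img: "g ` {0<..} = {0<..}"
  proof safe
    fix y :: real assume "0 < y"
    then show "y \<in> g ` {0<..}" using b by (intro image_eqI[of _ _ "b / y"]) (auto simp: g_def)
  qed (use b in \<open>auto simp: g_def\<close>)
  have inj: "inj_on g {0<..}" using b by (auto simp: g_def inj_on_def field_simps)
  have der: "(g has_field_derivative - b / x\<^sup>2) (at x within {0<..})" if "x \<in> {0<..}" for x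
    using that unfolding g_def by (auto intro!: derivative_eq_intros simp: power2_eq_square)
  have "(\<lambda>x. \<bar>- b / x\<^sup>2\<bar> * f (g x)) absolutely_integrable_on {0<..} \<and>
      integral {0<..} (\<lambda>x. \<bar>- b / x\<^sup>2\<bar> * f (g x)) = Gamma a"
    by (subst has_absolute_integral_change_of_variables_1'[OF _ der inj]) (auto simp: img f')
  then have h: "(\<lambda>x. \<bar>- b / x\<^sup>2\<bar> * f (g x)) absolutely_integrable_on {0<..}"
      "((\<lambda>x. \<bar>- b / x\<^sup>2\<bar> * f (g x)) has_integral Gamma a) {0<..}"
    using set_lebesgue_integral_eq_integral(1) by (auto simp: has_integral_iff)
  have eq: "\<bar>- b / x\<^sup>2\<bar> * f (g x) / b powr a = x powr (- a - 1) * exp (- b / x)" if "x \<in> {0<..}" for x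
  proof -
    have x: "0 < x" using that by simp
    have 1: "\<bar>- b / x\<^sup>2\<bar> = b powr 1 * x powr (- 2)"
      using x b by (simp add: powr_minus divide_inverse flip: powr_numeral)
    have 2: "f (g x) = b powr (a - 1) * x powr (1 - a) * exp (- b / x)"
    proof -
      have "x powr (1 - a) = 1 / x powr (a - 1)" using powr_minus_divide[of x "a - 1"] by simp
      then show ?thesis using x b by (simp add: f_def g_def powr_divide exp_minus field_simps)
    qed
    have 3: "x powr (- 2) * x powr (1 - a) = x powr (- a - 1)"
      unfolding powr_add[symmetric] by (rule arg_cong[where f = "\<lambda>y. x powr y"]) simp
    have 4: "b powr 1 * b powr (a - 1) = b powr a" using b by (simp only: powr_add[symmetric]) simp
    have "\<bar>- b / x\<^sup>2\<bar> * f (g x) = (b powr 1 * b powr (a - 1)) * (x powr (- 2) * x powr (1 - a)) * exp (- b / x)"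
      unfolding 1 2 by (simp only: ac_simps)
    then show ?thesis unfolding 3 4 using b by simp
  qed
  show "((\<lambda>x. x powr (- a - 1) * exp (- b / x)) has_integral Gamma a / b powr a) {0<..}"
    using has_integral_divide[OF h(2), of "b powr a"] by (rule has_integral_eq[rotated]) (rule eq)
  show "(\<lambda>x. x powr (- a - 1) * exp (- b / x)) absolutely_integrable_on {0<..}"
    using \<open>((\<lambda>x. x powr (- a - 1) * exp (- b / x)) has_integral Gamma a / b powr a) {0<..}\<close>
    by (auto intro!: nonnegative_absolutely_integrable_1 simp: integrable_on_def)
qed

lemma inverse_gamma_density_measurable [measurable]: "inverse_gamma_density a b \<in> borel_measurable borel"
  unfolding inverse_gamma_density_def by measurable

lemma inverse_gamma_density_nonneg: "0 < a \<Longrightarrow> 0 \<le> inverse_gamma_density a b x"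
  by (simp add: inverse_gamma_density_def)

lemma has_bochner_integral_inverse_gamma_density:
  assumes a: "0 < a" and b: "0 < b"
  shows "has_bochner_integral lborel (inverse_gamma_density a b) 1"
proof -
  let ?f = "\<lambda>x. x powr (- a - 1) * exp (- b / x)"
  have "set_integrable lebesgue {0<..} ?f" using inverse_gamma_kernel_integral(2)[OF a b] .
  then have i: "set_integrable lborel {0<..} ?f"
    unfolding set_integrable_def by (subst (asm) integrable_completion) auto
  have "(LINT x:{0<..}|lborel. ?f x) = Gamma a / b powr a"
    using set_borel_integral_eq_integral(2)[OF i] inverse_gamma_kernel_integral(1)[OF a b]
    by (simp add: has_integral_iff)
  then have "has_bochner_integral lborel (\<lambda>x. indicator {0<..} x *\<^sub>R ?f x) (Gamma a / b powr a)"
    using i by (simp add: has_bochner_integral_iff set_integrable_def set_lebesgue_integral_def)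
  then have "has_bochner_integral lborel (\<lambda>x. (b powr a / Gamma a) * (indicator {0<..} x *\<^sub>R ?f x))
      ((b powr a / Gamma a) * (Gamma a / b powr a))"
    by (rule has_bochner_integral_mult_right)
  moreover have "(b powr a / Gamma a) * (Gamma a / b powr a) = 1"
    using b less_imp_neq[OF Gamma_real_pos[OF a]] by simp
  moreover have "(\<lambda>x. (b powr a / Gamma a) * (indicator {0<..} x *\<^sub>R ?f x)) = inverse_gamma_density a b"
    by (auto simp: inverse_gamma_density_def fun_eq_iff)
  ultimately show ?thesis by simp
qed

lemma prob_space_inverse_gamma_law:
  assumes "0 < a" "0 < b"
  shows "prob_space (inverse_gamma_law a b)"
proof
  have "emeasure (inverse_gamma_law a b) (space (inverse_gamma_law a b))
      = (\<integral>\<^sup>+ x. ennreal (inverse_gamma_density a b x) \<partial>lborel)"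
    by (simp add: inverse_gamma_law_def emeasure_density)
  also have "\<dots> = ennreal 1"
    using has_bochner_integral_inverse_gamma_density[OF assms] assms
    by (subst nn_integral_eq_integral) (auto simp: has_bochner_integral_iff inverse_gamma_density_nonneg)
  finally show "emeasure (inverse_gamma_law a b) (space (inverse_gamma_law a b)) = 1" by simp
qed

lemma inverse_gamma_law_sets [measurable_cong, simp]: "sets (inverse_gamma_law a b) = sets borel"
  by (simp add: inverse_gamma_law_def)

lemma AE_inverse_gamma_law_pos: "AE v in inverse_gamma_law a b. 0 < v"
  unfolding inverse_gamma_law_def by (subst AE_density) (auto simp: inverse_gamma_density_def)

lemma inverse_gamma_law_mean:
  assumes a: "1 < a" and b: "0 < b"
  shows "has_bochner_integral (inverse_gamma_law a b) (\<lambda>v. v) (b / (a - 1))"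
proof -
  \<comment> \<open>Multiplication by x lowers the shape parameter by one, so the mean reduces to
    the normalisation at shape a - 1, which must be positive.\<close>
  have "inverse_gamma_density a b x * x = b / (a - 1) * inverse_gamma_density (a - 1) b x" for x
  proof (cases "0 < x")
    case True
    have "x powr (- a - 1) * x = x powr (- a)" using True powr_mult_base[of x "- a - 1"] by (simp add: mult.commute)
    moreover have "b powr a = b * b powr (a - 1)" using b powr_mult_base[of b "a - 1"] by simp
    moreover have "Gamma a = (a - 1) * Gamma (a - 1)" using a Gamma_plus1[of "a - 1"] by (fastforce elim!: nonpos_Ints_cases)
    ultimately show ?thesis using True a
      by (simp add: inverse_gamma_density_def)
  qed (simp add: inverse_gamma_density_def)
  moreover have "has_bochner_integral lborel (\<lambda>x. b / (a - 1) * inverse_gamma_density (a - 1) b x) (b / (a - 1) * 1)"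
    using a b by (intro has_bochner_integral_mult_right has_bochner_integral_inverse_gamma_density) auto
  ultimately have "has_bochner_integral lborel (\<lambda>x. inverse_gamma_density a b x *\<^sub>R x) (b / (a - 1))"
    by simp
  then show ?thesis unfolding inverse_gamma_law_def
    using a by (intro has_bochner_integral_density) (auto simp: inverse_gamma_density_nonneg)
qed

section \<open>The Gaussian posterior\<close>

text \<open>Bienayme's identity for pairwise orthogonal functions with common second moment
  c.\<close>

lemma orthogonal_sum_square:
  fixes f :: "'i \<Rightarrow> 'a \<Rightarrow> real"
  assumes "finite I"
    and "\<And>i k. i \<in> I \<Longrightarrow> k \<in> I \<Longrightarrow> has_bochner_integral M (\<lambda>x. f i x * f k x) (if i = k then c else 0)"
  shows "has_bochner_integral M (\<lambda>x. (\<Sum>i\<in>I. a i * f i x)\<^sup>2) (c * (\<Sum>i\<in>I. (a i)\<^sup>2))"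
proof -
  have "has_bochner_integral M (\<lambda>x. \<Sum>i\<in>I. \<Sum>k\<in>I. a i * a k * (f i x * f k x))
      (\<Sum>i\<in>I. \<Sum>k\<in>I. a i * a k * (if i = k then c else 0))"
    using assms by (intro has_bochner_integral_sum has_bochner_integral_mult_right) auto
  moreover have "(\<Sum>i\<in>I. \<Sum>k\<in>I. a i * a k * (if i = k then c else 0)) = c * (\<Sum>i\<in>I. (a i)\<^sup>2)"
    unfolding sum_distrib_left using assms(1)
    by (intro sum.cong) (auto simp: if_distrib power2_eq_square cong: if_cong)
  moreover have "(\<lambda>x. \<Sum>i\<in>I. \<Sum>k\<in>I. a i * a k * (f i x * f k x)) = (\<lambda>x. (\<Sum>i\<in>I. a i * f i x)\<^sup>2)"
    by (simp add: power2_eq_square sum_product ac_simps)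
  ultimately show ?thesis by simp
qed

text \<open>Cauchy-Schwarz with each weight split into two square roots. It trades an L1 norm
  weighted by cell probabilities for a weighted sum of squares, whose expectation needs only second
  moments.\<close>

lemma weighted_sum_abs_square_le:
  fixes p x :: "'a \<Rightarrow> real"
  assumes "\<And>i. i \<in> I \<Longrightarrow> 0 \<le> p i" "sum p I \<le> 1"
  shows "(\<Sum>i\<in>I. p i * \<bar>x i\<bar>)\<^sup>2 \<le> (\<Sum>i\<in>I. p i * (x i)\<^sup>2)"
proof -
  have "(\<Sum>i\<in>I. p i * \<bar>x i\<bar>)\<^sup>2 = (\<Sum>i\<in>I. sqrt (p i) * (sqrt (p i) * \<bar>x i\<bar>))\<^sup>2"
    using assms by (intro arg_cong[where f = "\<lambda>y. y\<^sup>2"] sum.cong) (auto simp flip: mult.assoc)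
  also have "\<dots> \<le> (\<Sum>i\<in>I. (sqrt (p i))\<^sup>2) * (\<Sum>i\<in>I. (sqrt (p i) * \<bar>x i\<bar>)\<^sup>2)"
    by (rule Cauchy_Schwarz_ineq_sum)
  also have "\<dots> = sum p I * (\<Sum>i\<in>I. p i * (x i)\<^sup>2)"
    using assms by (simp add: power_mult_distrib)
  also have "\<dots> \<le> 1 * (\<Sum>i\<in>I. p i * (x i)\<^sup>2)"
    using assms by (intro mult_right_mono sum_nonneg) auto
  finally show ?thesis by simp
qed

section \<open>Products of normal laws as images of standard normals\<close>

definition std_normal :: "real measure" where
  "std_normal = density lborel std_normal_density"

lemma prob_space_std_normal [simp]: "prob_space std_normal"
  unfolding std_normal_def by (rule prob_space_normal_density) simp

lemma sets_std_normal [simp, measurable_cong]: "sets std_normal = sets borel"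
  by (simp add: std_normal_def)

lemma space_std_normal [simp]: "space std_normal = UNIV"
  by (simp add: std_normal_def)

lemma std_normal_moments:
  "has_bochner_integral std_normal (\<lambda>x. x) 0" "has_bochner_integral std_normal (\<lambda>x. x * x) 1"
  using std_normal_moment_odd[of 0] std_normal_moment_even[of 1]
  by (auto simp: std_normal_def power2_eq_square fact_numeral intro!: has_bochner_integral_density)

text \<open>The factor \<open>sqrt (max 0 v)\<close> vanishes for v \<le> 0, which yields the point
  mass at \<open>m\<close>. Degenerate and regular laws are thereby treated alike, and all
  posteriors become images of one fixed product measure.\<close>

lemma normal_law_eq: "normal_law m v = distr std_normal borel (\<lambda>z. m + sqrt (max 0 v) * z)"
proof (cases "v \<le> 0")
  case True
  then have "distr std_normal borel (\<lambda>z. m + sqrt (max 0 v) * z) = distr std_normal borel (\<lambda>_. m)"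
    by (simp add: max_def)
  also have "\<dots> = return borel m" by (simp add: prob_space.distr_const)
  finally show ?thesis using True by (simp add: normal_law_def)
next
  case False
  interpret prob_space std_normal by simp
  have "distributed std_normal lborel (\<lambda>x. x) (normal_density 0 1)"
    unfolding distributed_def by (auto simp: std_normal_def intro!: distr_id2 measure_eqI)
  from normal_density_affine[OF this, of "sqrt v" m] False
  have "distributed std_normal lborel (\<lambda>x. m + sqrt v * x) (normal_density m (sqrt v))" by simp
  then have "distr std_normal lborel (\<lambda>x. m + sqrt v * x) = density lborel (normal_density m (sqrt v))"
    by (rule distributed_distr_eq_density)
  moreover have "distr std_normal lborel (\<lambda>x. m + sqrt v * x) = distr std_normal borel (\<lambda>x. m + sqrt v * x)"
    by (rule distr_cong) auto
  ultimately show ?thesis using False by (simp add: normal_law_def max_def)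
qed

definition std_normals :: "'i set \<Rightarrow> ('i \<Rightarrow> real) measure" where
  "std_normals I = (\<Pi>\<^sub>M i\<in>I. std_normal)"

lemma sets_std_normals [simp, measurable_cong]: "sets (std_normals I) = sets (\<Pi>\<^sub>M i\<in>I. borel)"
  unfolding std_normals_def by (rule sets_PiM_cong) auto

lemma space_std_normals: "space (std_normals I) = PiE I (\<lambda>_. UNIV)"
  by (simp add: std_normals_def space_PiM)

lemma prob_space_std_normals [simp]: "prob_space (std_normals I)"
  unfolding std_normals_def by (rule prob_space_PiM) simp

lemma distr_std_normals_component: "i \<in> I \<Longrightarrow> distr (std_normals I) borel (\<lambda>z. z i) = std_normal"
  using distr_PiM_component[of I "\<lambda>_. std_normal" i] unfolding std_normals_def
  by (simp cong: distr_cong)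

lemma indep_std_normals:
  assumes "I \<noteq> {}"
  shows "prob_space.indep_vars (std_normals I) (\<lambda>_. borel) (\<lambda>i z. z i) I"
proof (subst prob_space.indep_vars_iff_distr_eq_PiM'[OF prob_space_std_normals assms])
  show "distr (std_normals I) (Pi\<^sub>M I (\<lambda>i. borel)) (\<lambda>x. \<lambda>i\<in>I. x i) =
      (\<Pi>\<^sub>M i\<in>I. distr (std_normals I) borel (\<lambda>z. z i))"
  proof -
    have "distr (std_normals I) (Pi\<^sub>M I (\<lambda>i. borel)) (\<lambda>x. \<lambda>i\<in>I. x i)
        = distr (std_normals I) (Pi\<^sub>M I (\<lambda>i. borel)) (\<lambda>x. x)"
      by (rule distr_cong) (auto simp: space_std_normals)
    also have "\<dots> = std_normals I" by (rule distr_id2) simp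
    also have "\<dots> = (\<Pi>\<^sub>M i\<in>I. distr (std_normals I) borel (\<lambda>z. z i))"
      unfolding std_normals_def[of I] by (rule PiM_cong) (simp_all add: distr_std_normals_component flip: std_normals_def)
    finally show ?thesis .
  qed
qed simp

lemma PiM_normal_law:
  assumes "I \<noteq> {}"
  shows "(\<Pi>\<^sub>M i\<in>I. normal_law (m i) (v i))
    = distr (std_normals I) (\<Pi>\<^sub>M i\<in>I. borel) (\<lambda>z. \<lambda>i\<in>I. m i + sqrt (max 0 (v i)) * z i)"
proof -
  interpret prob_space "std_normals I" by simp
  have "indep_vars (\<lambda>_. borel) (\<lambda>i z. m i + sqrt (max 0 (v i)) * z i) I"
    by (rule indep_vars_compose2[OF indep_std_normals[OF assms]]) auto
  then have "distr (std_normals I) (\<Pi>\<^sub>M i\<in>I. borel) (\<lambda>z. \<lambda>i\<in>I. m i + sqrt (max 0 (v i)) * z i)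
      = (\<Pi>\<^sub>M i\<in>I. distr (std_normals I) borel (\<lambda>z. m i + sqrt (max 0 (v i)) * z i))"
    by (subst (asm) indep_vars_iff_distr_eq_PiM'[OF assms]) auto
  also have "\<dots> = (\<Pi>\<^sub>M i\<in>I. normal_law (m i) (v i))"
  proof (rule PiM_cong)
    fix i assume i: "i \<in> I"
    have "distr (distr (std_normals I) borel (\<lambda>z. z i)) borel (\<lambda>z. m i + sqrt (max 0 (v i)) * z)
        = distr (std_normals I) borel (\<lambda>z. m i + sqrt (max 0 (v i)) * z i)"
      using i by (subst distr_distr) (auto simp: comp_def)
    then show "distr (std_normals I) borel (\<lambda>z. m i + sqrt (max 0 (v i)) * z i) = normal_law (m i) (v i)"
      using i by (simp add: distr_std_normals_component normal_law_eq)
  qed simp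
  finally show ?thesis by simp
qed

lemma std_normals_second_moments:
  assumes "i \<in> I" "k \<in> I"
  shows "has_bochner_integral (std_normals I) (\<lambda>z. z i * z k) (if i = k then 1 else 0)"
proof -
  interpret prob_space "std_normals I" by simp
  have 1: "has_bochner_integral (std_normals I) (\<lambda>z. f (z i)) x"
    if "has_bochner_integral std_normal f x" "f \<in> borel_measurable borel" "i \<in> I" for f :: "real \<Rightarrow> real" and x i
    using that unfolding has_bochner_integral_iff
    by (subst (asm) (1 2) distr_std_normals_component[OF that(3), symmetric])
      (simp add: integrable_distr_eq integral_distr)
  show ?thesis
  proof (cases "i = k")
    case True
    then show ?thesis using 1[OF std_normal_moments(2)] assms by simp
  next
    case False
    have ind: "indep_vars (\<lambda>_. borel) (\<lambda>i z. z i) {i, k}"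
      using assms by (intro indep_vars_subset[OF indep_std_normals]) auto
    have m: "has_bochner_integral (std_normals I) (\<lambda>z. z i) 0" "has_bochner_integral (std_normals I) (\<lambda>z. z k) 0"
      using 1[OF std_normal_moments(1)] assms by auto
    show ?thesis
      using indep_vars_lebesgue_integral[OF _ ind] indep_vars_integrable[OF _ ind] m False
      by (auto simp: has_bochner_integral_iff)
  qed
qed

text \<open>Chebyshev's inequality after \<open>weighted_sum_abs_square_le\<close>. Absolute values
  allow no cancellation between coordinates, so each weight enters to the first power.\<close>

lemma std_normals_weighted_abs_tail:
  assumes I: "finite I" and p: "\<And>i. i \<in> I \<Longrightarrow> 0 \<le> p i" "sum p I \<le> 1" and "0 < t"
  shows "measure (std_normals I) {z \<in> space (std_normals I). t \<le> (\<Sum>i\<in>I. p i * \<bar>s i * z i\<bar>)}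
    \<le> (\<Sum>i\<in>I. p i * (s i)\<^sup>2) / t\<^sup>2"
proof -
  interpret prob_space "std_normals I" by simp
  let ?f = "\<lambda>z. \<Sum>i\<in>I. p i * \<bar>s i * z i\<bar>"
  let ?g = "\<lambda>z. \<Sum>i\<in>I. p i * (s i)\<^sup>2 * (z i * z i)"
  have "has_bochner_integral (std_normals I) ?g (\<Sum>i\<in>I. p i * (s i)\<^sup>2 * (if i = i then 1 else 0))"
    by (intro has_bochner_integral_sum has_bochner_integral_mult_right std_normals_second_moments) auto
  then have g: "has_bochner_integral (std_normals I) ?g (\<Sum>i\<in>I. p i * (s i)\<^sup>2)" by simp
  have le: "(?f z)\<^sup>2 \<le> ?g z" for z
    using weighted_sum_abs_square_le[OF p, of "\<lambda>i. s i * z i"] by (simp add: power2_eq_square ac_simps)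
  have f: "?f \<in> borel_measurable (std_normals I)" by measurable
  have int: "integrable (std_normals I) (\<lambda>z. (?f z)\<^sup>2)"
  proof (rule Bochner_Integration.integrable_bound)
    show "integrable (std_normals I) ?g" using g by (rule integrable.intros)
    show "AE z in std_normals I. norm ((?f z)\<^sup>2) \<le> norm (?g z)"
      unfolding real_norm_def abs_power2 by (intro AE_I2 order_trans[OF le abs_ge_self])
  qed (use f in measurable)
  have "{z \<in> space (std_normals I). t \<le> ?f z} = {z \<in> space (std_normals I). t \<le> \<bar>?f z\<bar>}"
    using p by (auto simp: abs_of_nonneg sum_nonneg)
  then have "prob {z \<in> space (std_normals I). t \<le> ?f z} \<le> expectation (\<lambda>z. (?f z)\<^sup>2) / t\<^sup>2"
    using second_moment_method[OF f int \<open>0 < t\<close>] by simp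
  also have "\<dots> \<le> (\<Sum>i\<in>I. p i * (s i)\<^sup>2) / t\<^sup>2"
    using integral_mono[OF int integrable.intros[OF g] le] has_bochner_integral_integral_eq[OF g]
    by (intro divide_right_mono) auto
  finally show ?thesis .
qed

text \<open>Distinct coordinates are uncorrelated, so the variance is the sum of squared
  coefficients. For coefficients proportional to cell probabilities this gains one factor of the
  cell probability over the L1 bound.\<close>

lemma std_normals_linear_tail:
  assumes I: "finite I" and "0 < t"
  shows "measure (std_normals I) {z \<in> space (std_normals I). t \<le> \<bar>\<Sum>i\<in>I. a i * z i\<bar>} \<le> (\<Sum>i\<in>I. (a i)\<^sup>2) / t\<^sup>2"
proof -
  interpret prob_space "std_normals I" by simp
  have "has_bochner_integral (std_normals I) (\<lambda>z. (\<Sum>i\<in>I. a i * z i)\<^sup>2) (1 * (\<Sum>i\<in>I. (a i)\<^sup>2))"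
    by (intro orthogonal_sum_square std_normals_second_moments I)
  then show ?thesis
    using second_moment_method[of "\<lambda>z. \<Sum>i\<in>I. a i * z i" t] \<open>0 < t\<close>
    by (simp add: has_bochner_integral_iff)
qed

section \<open>Posterior draws on a fixed sample space\<close>

definition post_prec :: "nat \<Rightarrow> (('d \<Rightarrow> nat) \<Rightarrow> real) \<Rightarrow> nat \<Rightarrow> (nat \<Rightarrow> real ^ 'd) \<Rightarrow> ('d \<Rightarrow> nat) \<Rightarrow> real" where
  "post_prec J lam n xs j = cell_count J n xs j + inverse ((lam j)\<^sup>2)"

definition post_mean :: "nat \<Rightarrow> (('d \<Rightarrow> nat) \<Rightarrow> real) \<Rightarrow> (('d \<Rightarrow> nat) \<Rightarrow> real) \<Rightarrow> nat \<Rightarrow>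
    (nat \<Rightarrow> real ^ 'd) \<Rightarrow> (nat \<Rightarrow> real) \<Rightarrow> ('d \<Rightarrow> nat) \<Rightarrow> real" where
  "post_mean J \<zeta> lam n xs ys j =
     (cell_count J n xs j * cell_mean J n xs ys j + \<zeta> j * inverse ((lam j)\<^sup>2)) / post_prec J lam n xs j"

lemma cell_count_nonneg [simp]: "0 \<le> cell_count J n xs j"
  by (simp add: cell_count_def)

lemma post_prec_pos: "lam j \<noteq> 0 \<Longrightarrow> 0 < post_prec J lam n xs j"
  by (simp add: post_prec_def add_nonneg_pos)

lemma post_prec_nonneg [simp]: "0 \<le> post_prec J lam n xs j"
  by (simp add: post_prec_def)

lemma indices_nonempty:
  assumes "0 < J"
  shows "(indices J :: ('d::finite \<Rightarrow> nat) set) \<noteq> {}"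
  using assms by (auto simp: indices_def PiE_eq_empty_iff)

text \<open>A draw from the posterior as a function of standard normals \<open>z\<close>. The sample
  space depends neither on the data nor on \<open>v\<close>, so measurability can be stated jointly
  in \<open>v\<close> and \<open>z\<close>; the inverse gamma mixture relies on this.\<close>

definition post_draw :: "nat \<Rightarrow> (('d \<Rightarrow> nat) \<Rightarrow> real) \<Rightarrow> (('d \<Rightarrow> nat) \<Rightarrow> real) \<Rightarrow> nat \<Rightarrow>
    (nat \<Rightarrow> real ^ 'd) \<Rightarrow> (nat \<Rightarrow> real) \<Rightarrow> real \<Rightarrow> (('d::finite \<Rightarrow> nat) \<Rightarrow> real) \<Rightarrow> ('d \<Rightarrow> nat) \<Rightarrow> real" where
  "post_draw J \<zeta> lam n xs ys v z = (\<lambda>j\<in>indices J. post_mean J \<zeta> lam n xs ys j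
     + sqrt (max 0 (v / post_prec J lam n xs j)) * z j)"

lemma post_draw_measurable:
  "(\<lambda>(v, z). post_draw J \<zeta> lam n xs ys v z)
    \<in> measurable (borel \<Otimes>\<^sub>M std_normals (indices J)) (\<Pi>\<^sub>M j\<in>indices J. borel)"
  unfolding post_draw_def split_def by measurable

lemma post_draw_measurable' [measurable]:
  "post_draw J \<zeta> lam n xs ys v \<in> measurable (std_normals (indices J)) (\<Pi>\<^sub>M j\<in>indices J. borel)"
  unfolding post_draw_def by measurable

lemma coef_posterior_eq:
  fixes \<zeta> :: "('d::finite \<Rightarrow> nat) \<Rightarrow> real"
  assumes "0 < J"
  shows "coef_posterior J \<zeta> lam n xs ys v
    = distr (std_normals (indices J)) (\<Pi>\<^sub>M j\<in>indices J. borel) (post_draw J \<zeta> lam n xs ys v)"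
  unfolding coef_posterior_def post_draw_def
  by (subst PiM_normal_law[OF indices_nonempty[OF assms]]) (simp add: post_mean_def post_prec_def)

lemma
  fixes \<zeta> :: "('d::finite \<Rightarrow> nat) \<Rightarrow> real"
  assumes "0 < J"
  shows prob_space_coef_posterior: "prob_space (coef_posterior J \<zeta> lam n xs ys v)"
    and sets_coef_posterior: "sets (coef_posterior J \<zeta> lam n xs ys v) = sets (\<Pi>\<^sub>M j\<in>indices J. borel)"
    and space_coef_posterior: "space (coef_posterior J \<zeta> lam n xs ys v) = space (\<Pi>\<^sub>M j\<in>indices J. borel)"
  unfolding coef_posterior_eq[OF assms]
  by (auto intro!: prob_space.prob_space_distr)

lemma posterior_given_eq:
  fixes \<zeta> :: "('d::finite \<Rightarrow> nat) \<Rightarrow> real"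
  assumes "0 < J" and A: "{\<theta> \<in> space (\<Pi>\<^sub>M j\<in>indices J. borel). step_fn J \<theta> \<in> A} \<in> sets (\<Pi>\<^sub>M j\<in>indices J. borel)"
  shows "posterior_given J \<zeta> lam n xs ys v A = measure (std_normals (indices J))
    {z \<in> space (std_normals (indices J)). step_fn J (post_draw J \<zeta> lam n xs ys v z) \<in> A}"
proof -
  have "post_draw J \<zeta> lam n xs ys v z \<in> space (\<Pi>\<^sub>M j\<in>indices J. borel)" for z
    by (simp add: post_draw_def space_PiM)
  then show ?thesis
    unfolding posterior_given_def coef_posterior_eq[OF assms(1)] space_distr
    by (subst measure_distr[OF post_draw_measurable' A])
      (auto intro!: arg_cong[where f = "measure (std_normals (indices J))"])
qed

text \<open>\<open>A\<close> may define a non-measurable event: \<open>measure\<close> is then 0 and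
  the bound holds by default. Lower bounds come from upper bounds on the complement and do require a
  measurable event.\<close>

lemma posterior_given_le:
  fixes \<zeta> :: "('d::finite \<Rightarrow> nat) \<Rightarrow> real"
  assumes "0 < J" and B: "B \<in> sets (std_normals (indices J))"
    and AB: "\<And>z. z \<in> space (std_normals (indices J)) \<Longrightarrow> step_fn J (post_draw J \<zeta> lam n xs ys v z) \<in> A \<Longrightarrow> z \<in> B"
  shows "posterior_given J \<zeta> lam n xs ys v A \<le> measure (std_normals (indices J)) B"
proof (cases "{\<theta> \<in> space (\<Pi>\<^sub>M j\<in>indices J. borel). step_fn J \<theta> \<in> A} \<in> sets (\<Pi>\<^sub>M j\<in>indices J. borel)")
  case True
  interpret prob_space "std_normals (indices J :: ('d \<Rightarrow> nat) set)" by simp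
  show ?thesis unfolding posterior_given_eq[OF assms(1) True] using AB by (intro finite_measure_mono B) auto
next
  case False
  then show ?thesis
    by (simp add: posterior_given_def sets_coef_posterior space_coef_posterior assms(1) measure_notin_sets)
qed

lemma posterior_given_compl:
  fixes \<zeta> :: "('d::finite \<Rightarrow> nat) \<Rightarrow> real"
  assumes "0 < J" and A: "{\<theta> \<in> space (\<Pi>\<^sub>M j\<in>indices J. borel). step_fn J \<theta> \<in> A} \<in> sets (\<Pi>\<^sub>M j\<in>indices J. borel)"
  shows "posterior_given J \<zeta> lam n xs ys v A = 1 - posterior_given J \<zeta> lam n xs ys v (- A)"
proof -
  interpret prob_space "coef_posterior J \<zeta> lam n xs ys v" by (rule prob_space_coef_posterior[OF assms(1)])
  have "{\<theta> \<in> space (coef_posterior J \<zeta> lam n xs ys v). step_fn J \<theta> \<in> - A} = space (coef_posterior J \<zeta> lam n xs ys v)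
      - {\<theta> \<in> space (coef_posterior J \<zeta> lam n xs ys v). step_fn J \<theta> \<in> A}" by auto
  moreover have "{\<theta> \<in> space (coef_posterior J \<zeta> lam n xs ys v). step_fn J \<theta> \<in> A} \<in> sets (coef_posterior J \<zeta> lam n xs ys v)"
    using A by (simp add: sets_coef_posterior space_coef_posterior assms(1))
  ultimately show ?thesis unfolding posterior_given_def by (simp only: prob_compl)
qed

text \<open>The event is the section at \<open>v\<close> of a set that is measurable jointly in
  \<open>v\<close> and the normal coordinates, so its probability depends measurably on
  \<open>v\<close>.\<close>

lemma posterior_given_measurable:
  fixes \<zeta> :: "('d::finite \<Rightarrow> nat) \<Rightarrow> real"
  assumes "0 < J" and A: "{\<theta> \<in> space (\<Pi>\<^sub>M j\<in>indices J. borel). step_fn J \<theta> \<in> A} \<in> sets (\<Pi>\<^sub>M j\<in>indices J. borel)"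
  shows "(\<lambda>v. posterior_given J \<zeta> lam n xs ys v A) \<in> borel_measurable borel"
proof -
  let ?Z = "std_normals (indices J :: ('d \<Rightarrow> nat) set)"
  interpret prob_space ?Z by simp
  define Q where "Q = (\<lambda>(v, z). post_draw J \<zeta> lam n xs ys v z) -` {\<theta> \<in> space (\<Pi>\<^sub>M j\<in>indices J. borel). step_fn J \<theta> \<in> A}
    \<inter> space (borel \<Otimes>\<^sub>M ?Z)"
  have "Q \<in> sets (borel \<Otimes>\<^sub>M ?Z)" unfolding Q_def by (rule measurable_sets[OF post_draw_measurable A])
  then have "(\<lambda>v. enn2real (emeasure ?Z (Pair v -` Q))) \<in> borel_measurable borel"
    by (intro borel_measurable_enn2real measurable_emeasure_Pair) 
  moreover have "Pair v -` Q = {z \<in> space ?Z. step_fn J (post_draw J \<zeta> lam n xs ys v z) \<in> A}" for v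
    by (auto simp: Q_def space_pair_measure post_draw_def space_PiM)
  ultimately show ?thesis
    by (simp add: posterior_given_eq[OF assms] measure_def)
qed

text \<open>A draw deviates from \<open>post_mean\<close> by a centred normal vector with coordinate
  variances \<open>v / post_prec\<close>; if \<open>step_fn J \<theta>\<close> lies in
  \<open>A\<close>, this deviation has weighted L1 size at least \<open>t\<close>, so Chebyshev
  applies.\<close>

lemma posterior_given_le_L1:
  fixes \<zeta> :: "('d::finite \<Rightarrow> nat) \<Rightarrow> real"
  assumes J: "0 < J" and "0 \<le> v" "0 < t"
    and p: "\<And>j. j \<in> indices J \<Longrightarrow> 0 \<le> p j" "sum p (indices J) \<le> 1"
    and A: "\<And>\<theta>. step_fn J \<theta> \<in> A \<Longrightarrow> t \<le> (\<Sum>j\<in>indices J. p j * \<bar>\<theta> j - post_mean J \<zeta> lam n xs ys j\<bar>)"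
  shows "posterior_given J \<zeta> lam n xs ys v A \<le> v * ((\<Sum>j\<in>indices J. p j / post_prec J lam n xs j) / t\<^sup>2)"
proof -
  let ?Z = "std_normals (indices J :: ('d \<Rightarrow> nat) set)"
  define s where "s = (\<lambda>j. sqrt (max 0 (v / post_prec J lam n xs j)))"
  have s2: "(s j)\<^sup>2 = v / post_prec J lam n xs j" for j
    using \<open>0 \<le> v\<close> by (simp add: s_def)
  have "posterior_given J \<zeta> lam n xs ys v A
      \<le> measure ?Z {z \<in> space ?Z. t \<le> (\<Sum>j\<in>indices J. p j * \<bar>s j * z j\<bar>)}"
  proof (rule posterior_given_le[OF J])
    fix z assume "z \<in> space ?Z" "step_fn J (post_draw J \<zeta> lam n xs ys v z) \<in> A"
    then show "z \<in> {z \<in> space ?Z. t \<le> (\<Sum>j\<in>indices J. p j * \<bar>s j * z j\<bar>)}"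
      using A[of "post_draw J \<zeta> lam n xs ys v z"] by (simp add: post_draw_def s_def)
  qed measurable
  also have "\<dots> \<le> (\<Sum>j\<in>indices J. p j * (s j)\<^sup>2) / t\<^sup>2"
    by (rule std_normals_weighted_abs_tail) (use p \<open>0 < t\<close> in auto)
  finally show ?thesis by (simp add: s2 sum_distrib_left ac_simps)
qed

text \<open>The linear functional of the centred draw has variance equal to the sum of the squares
  of \<open>p j * w j\<close> times \<open>v / post_prec\<close>; the bound on the weights then
  removes \<open>w\<close>. The squared cell probabilities are what later produces
  \<open>V2\<close>.\<close>

lemma posterior_given_le_linear:
  fixes \<zeta> :: "('d::finite \<Rightarrow> nat) \<Rightarrow> real"
  assumes J: "0 < J" and "0 \<le> v" "0 < t"
    and w: "\<And>j. \<bar>w j\<bar> \<le> 1"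
    and A: "\<And>\<theta>. step_fn J \<theta> \<in> A \<Longrightarrow> t \<le> \<bar>\<Sum>j\<in>indices J. p j * w j * (\<theta> j - post_mean J \<zeta> lam n xs ys j)\<bar>"
  shows "posterior_given J \<zeta> lam n xs ys v A \<le> v * ((\<Sum>j\<in>indices J. (p j)\<^sup>2 / post_prec J lam n xs j) / t\<^sup>2)"
proof -
  let ?Z = "std_normals (indices J :: ('d \<Rightarrow> nat) set)"
  define s where "s = (\<lambda>j. sqrt (max 0 (v / post_prec J lam n xs j)))"
  have s2: "(s j)\<^sup>2 = v / post_prec J lam n xs j" for j
    using \<open>0 \<le> v\<close> by (simp add: s_def)
  have "posterior_given J \<zeta> lam n xs ys v A
      \<le> measure ?Z {z \<in> space ?Z. t \<le> \<bar>\<Sum>j\<in>indices J. (p j * w j * s j) * z j\<bar>}"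
  proof (rule posterior_given_le[OF J])
    fix z assume "z \<in> space ?Z" "step_fn J (post_draw J \<zeta> lam n xs ys v z) \<in> A"
    then show "z \<in> {z \<in> space ?Z. t \<le> \<bar>\<Sum>j\<in>indices J. (p j * w j * s j) * z j\<bar>}"
      using A[of "post_draw J \<zeta> lam n xs ys v z"] by (simp add: post_draw_def s_def ac_simps)
  qed measurable
  also have "\<dots> \<le> (\<Sum>j\<in>indices J. (p j * w j * s j)\<^sup>2) / t\<^sup>2"
    by (rule std_normals_linear_tail) (use \<open>0 < t\<close> in auto)
  also have "\<dots> \<le> (\<Sum>j\<in>indices J. (p j)\<^sup>2 * (s j)\<^sup>2) / t\<^sup>2"
  proof (intro divide_right_mono sum_mono)
    fix j
    have "(w j)\<^sup>2 \<le> 1" using w[of j] by (simp add: abs_square_le_1)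
    then have "(p j)\<^sup>2 * (s j)\<^sup>2 * (w j)\<^sup>2 \<le> (p j)\<^sup>2 * (s j)\<^sup>2 * 1" by (intro mult_left_mono) auto
    then show "(p j * w j * s j)\<^sup>2 \<le> (p j)\<^sup>2 * (s j)\<^sup>2" by (simp add: power_mult_distrib ac_simps)
  qed simp
  finally show ?thesis by (simp add: s2 sum_distrib_left ac_simps)
qed

text \<open>Cauchy-Schwarz inside a cell shows that the subtracted term is at most that cell's share
  of the sum of squares. The estimate therefore lies between 0 and the raw mean of squared residuals
  around the prior means.\<close>

lemma sigma2_hat_bounds:
  fixes \<zeta> :: "('d::finite \<Rightarrow> nat) \<Rightarrow> real"
  assumes J: "0 < J"
  shows "0 \<le> sigma2_hat J \<zeta> lam n xs ys"
    and "sigma2_hat J \<zeta> lam n xs ys \<le> (\<Sum>i<n. (ys i - \<zeta> (cell_index J (xs i)))\<^sup>2) / real n"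
proof -
  define q where "q = (\<lambda>i. (ys i - \<zeta> (cell_index J (xs i)))\<^sup>2)"
  define B where "B = (\<lambda>j. {i. i < n \<and> xs i \<in> cell J j})"
  let ?t = "\<lambda>j. (cell_count J n xs j)\<^sup>2 * (cell_mean J n xs ys j - \<zeta> j)\<^sup>2 / (cell_count J n xs j + inverse ((lam j)\<^sup>2))"
  have fin: "finite (B j)" for j by (auto simp: B_def)
  have t0: "0 \<le> ?t j" for j by (intro divide_nonneg_nonneg add_nonneg_nonneg) auto
  have t: "?t j \<le> sum q (B j)" if j: "j \<in> indices J" for j
  proof (cases "B j = {}")
    case True
    then have "cell_count J n xs j = 0" by (simp add: cell_count_def B_def)
    then show ?thesis using True by simp
  next
    case False
    have N: "cell_count J n xs j = real (card (B j))" by (simp add: cell_count_def B_def)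
    have N0: "0 < real (card (B j))" using False fin by (simp add: card_gt_0_iff)
    have "cell_count J n xs j * (cell_mean J n xs ys j - \<zeta> j) = (\<Sum>i\<in>B j. ys i - \<zeta> j)"
      using N0 False by (simp add: cell_mean_def N sum_subtractf right_diff_distrib B_def)
    then have "(cell_count J n xs j)\<^sup>2 * (cell_mean J n xs ys j - \<zeta> j)\<^sup>2 = (\<Sum>i\<in>B j. ys i - \<zeta> j)\<^sup>2"
      by (metis power_mult_distrib)
    also have "\<dots> \<le> (\<Sum>i\<in>B j. 1\<^sup>2) * (\<Sum>i\<in>B j. (ys i - \<zeta> j)\<^sup>2)"
      using Cauchy_Schwarz_ineq_sum[of "\<lambda>_. 1" "\<lambda>i. ys i - \<zeta> j" "B j"] by simp
    also have "(\<Sum>i\<in>B j. (ys i - \<zeta> j)\<^sup>2) = sum q (B j)"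
      by (intro sum.cong) (auto simp: q_def B_def cell_index_eq[OF j J])
    finally have "?t j \<le> (real (card (B j)) * sum q (B j)) / (cell_count J n xs j + inverse ((lam j)\<^sup>2))"
      by (intro divide_right_mono) auto
    \<comment> \<open>The prior precision only enlarges the denominator, so dropping it gives an
      upper bound.\<close>
    also have "\<dots> \<le> (real (card (B j)) * sum q (B j)) / real (card (B j))"
      using N0 by (intro divide_left_mono) (auto simp: N q_def sum_nonneg intro!: mult_nonneg_nonneg mult_pos_pos add_pos_nonneg)
    finally show ?thesis using N0 by simp
  qed
  have "(\<Sum>j\<in>indices J. ?t j) \<le> (\<Sum>j\<in>indices J. sum q (B j))" by (rule sum_mono) (rule t)
  also have "\<dots> = sum q (\<Union>j\<in>indices J. B j)"
    using J by (intro sum.UNION_disjoint[symmetric] ballI) (auto simp: fin, auto simp: B_def dest: cell_unique)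
  also have "\<dots> \<le> sum q {..<n}"
    by (intro sum_mono2) (auto simp: B_def q_def)
  finally have le: "(\<Sum>j\<in>indices J. ?t j) \<le> sum q {..<n}" .
  then show "0 \<le> sigma2_hat J \<zeta> lam n xs ys" by (simp add: sigma2_hat_def q_def)
  have "0 \<le> (\<Sum>j\<in>indices J. ?t j)" by (intro sum_nonneg t0)
  then show "sigma2_hat J \<zeta> lam n xs ys \<le> (\<Sum>i<n. (ys i - \<zeta> (cell_index J (xs i)))\<^sup>2) / real n"
    unfolding sigma2_hat_def by (intro divide_right_mono) auto
qed

text \<open>
  Posterior probabilities given \<open>\<sigma>\<^sup>2\<close> are bounded linearly in \<open>\<sigma>\<^sup>2\<close>, so in the hierarchical case only
  the posterior mean of \<open>\<sigma>\<^sup>2\<close> matters.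
\<close>

fun post_var :: "sigma_treatment \<Rightarrow> nat \<Rightarrow> real \<Rightarrow> real" where
  "post_var (Known \<sigma>) n s = \<sigma>\<^sup>2"
| "post_var Marginal_MLE n s = s"
| "post_var (Inverse_Gamma \<beta>1 \<beta>2) n s = (\<beta>2 + real n * s / 2) / (\<beta>1 + real n / 2 - 1)"

fun valid_treatment :: "sigma_treatment \<Rightarrow> bool" where
  "valid_treatment (Known \<sigma>) = True"
| "valid_treatment Marginal_MLE = True"
| "valid_treatment (Inverse_Gamma \<beta>1 \<beta>2) = (0 < \<beta>1 \<and> 0 < \<beta>2)"

lemma post_var_le:
  assumes "valid_treatment S"
  obtains C where "0 < C" "\<And>n s. 4 \<le> n \<Longrightarrow> 0 \<le> s \<Longrightarrow> post_var S n s \<le> C * (1 + s)"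
proof (cases S)
  case (Known \<sigma>)
  have "post_var S n s \<le> (1 + \<sigma>\<^sup>2) * (1 + s)" if "0 \<le> s" for n s
    using Known that by (simp add: algebra_simps)
  then show ?thesis by (intro that[of "1 + \<sigma>\<^sup>2"]) (auto simp: add_pos_nonneg)
next
  case Marginal_MLE
  then show ?thesis by (intro that[of 1]) auto
next
  case (Inverse_Gamma \<beta>1 \<beta>2)
  then have \<beta>: "0 < \<beta>1" "0 < \<beta>2" using assms by auto
  have "post_var S n s \<le> (2 + \<beta>2) * (1 + s)" if "4 \<le> n" "0 \<le> s" for n s
  proof -
    have n: "0 < real n" "4 \<le> real n" using that(1) by auto
    have "post_var S n s \<le> (\<beta>2 + real n * s / 2) / (real n / 4)"
      unfolding Inverse_Gamma post_var.simps using \<beta> n that by (intro divide_left_mono) (auto intro!: mult_pos_pos)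
    also have "\<dots> = 4 * \<beta>2 / real n + 2 * s" using n by (simp add: field_simps)
    also have "\<dots> \<le> \<beta>2 + 2 * s" using n \<beta> by (simp add: field_simps)
    also have "\<dots> \<le> (2 + \<beta>2) * (1 + s)" using \<beta> that by (simp add: algebra_simps)
    finally show ?thesis .
  qed
  then show ?thesis using \<beta> by (intro that[of "2 + \<beta>2"]) auto
qed

text \<open>A known or estimated variance is simply plugged in. Under the inverse gamma law the
  linear bound is integrated, which replaces v by the posterior mean of the variance.\<close>

lemma
  fixes \<zeta> :: "('d::finite \<Rightarrow> nat) \<Rightarrow> real"
  assumes S: "valid_treatment S" and J: "0 < J" and n: "4 \<le> n"
  shows posterior_le: "0 \<le> c \<Longrightarrow> (\<And>v. 0 \<le> v \<Longrightarrow> posterior_given J \<zeta> lam n xs ys v A \<le> v * c) \<Longrightarrow>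
      posterior S J \<zeta> lam n xs ys A \<le> post_var S n (sigma2_hat J \<zeta> lam n xs ys) * c"
    and posterior_ge: "{\<theta> \<in> space (\<Pi>\<^sub>M j\<in>indices J. borel). step_fn J \<theta> \<in> A} \<in> sets (\<Pi>\<^sub>M j\<in>indices J. borel) \<Longrightarrow>
      (\<And>v. 0 \<le> v \<Longrightarrow> posterior_given J \<zeta> lam n xs ys v (- A) \<le> v * c) \<Longrightarrow>
      1 - post_var S n (sigma2_hat J \<zeta> lam n xs ys) * c \<le> posterior S J \<zeta> lam n xs ys A"
proof -
  let ?s = "sigma2_hat J \<zeta> lam n xs ys"
  have s: "0 \<le> ?s" by (rule sigma2_hat_bounds(1)[OF J])
  have IG: "prob_space (inverse_gamma_law (\<beta>1 + real n / 2) (\<beta>2 + real n * ?s / 2))"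
    "has_bochner_integral (inverse_gamma_law (\<beta>1 + real n / 2) (\<beta>2 + real n * ?s / 2)) (\<lambda>v. v)
      ((\<beta>2 + real n * ?s / 2) / (\<beta>1 + real n / 2 - 1))" if "0 < \<beta>1" "0 < \<beta>2" for \<beta>1 \<beta>2
    using that n s by (auto intro!: prob_space_inverse_gamma_law inverse_gamma_law_mean add_pos_nonneg)
  show "posterior S J \<zeta> lam n xs ys A \<le> post_var S n ?s * c"
    if c: "0 \<le> c" and le: "\<And>v. 0 \<le> v \<Longrightarrow> posterior_given J \<zeta> lam n xs ys v A \<le> v * c"
  proof (cases S)
    case (Inverse_Gamma \<beta>1 \<beta>2)
    let ?I = "inverse_gamma_law (\<beta>1 + real n / 2) (\<beta>2 + real n * ?s / 2)"
    have \<beta>: "0 < \<beta>1" "0 < \<beta>2" using S Inverse_Gamma by auto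
    have "(\<integral>v. posterior_given J \<zeta> lam n xs ys v A \<partial>?I) \<le> (\<integral>v. v * c \<partial>?I)"
    \<comment> \<open>This comparison does not ask the smaller integrand to be integrable. If it is
      not, its integral is 0, and the claim follows because v * c is nonnegative.\<close>
    proof (rule integral_mono_AE')
      show "integrable ?I (\<lambda>v. v * c)" using IG(2)[OF \<beta>] by (intro integrable_mult_left integrable.intros)
      show "AE v in ?I. posterior_given J \<zeta> lam n xs ys v A \<le> v * c"
        using AE_inverse_gamma_law_pos by eventually_elim (simp add: le)
      show "AE v in ?I. 0 \<le> v * c"
        using AE_inverse_gamma_law_pos by eventually_elim (simp add: c)
    qed
    also have "\<dots> = post_var S n ?s * c"
      using has_bochner_integral_integral_eq[OF IG(2)[OF \<beta>]] Inverse_Gamma by simp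
    finally show ?thesis by (simp add: Inverse_Gamma)
  qed (use le s in auto)
  show "1 - post_var S n ?s * c \<le> posterior S J \<zeta> lam n xs ys A"
    if A: "{\<theta> \<in> space (\<Pi>\<^sub>M j\<in>indices J. borel). step_fn J \<theta> \<in> A} \<in> sets (\<Pi>\<^sub>M j\<in>indices J. borel)"
      and le: "\<And>v. 0 \<le> v \<Longrightarrow> posterior_given J \<zeta> lam n xs ys v (- A) \<le> v * c"
  proof -
    have ge: "1 - v * c \<le> posterior_given J \<zeta> lam n xs ys v A" if "0 \<le> v" for v
      using le[OF that] posterior_given_compl[OF J A, of \<zeta> lam n xs ys v] by linarith
    show ?thesis
    proof (cases S)
      case (Inverse_Gamma \<beta>1 \<beta>2)
      let ?I = "inverse_gamma_law (\<beta>1 + real n / 2) (\<beta>2 + real n * ?s / 2)"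
      have \<beta>: "0 < \<beta>1" "0 < \<beta>2" using S Inverse_Gamma by auto
      interpret I: prob_space ?I by (rule IG[OF \<beta>])
      have int: "integrable ?I (\<lambda>v. v * c)" using IG(2)[OF \<beta>] by (intro integrable_mult_left integrable.intros)
      have "1 - post_var S n ?s * c = (\<integral>v. 1 - v * c \<partial>?I)"
        using has_bochner_integral_integral_eq[OF IG(2)[OF \<beta>]] Inverse_Gamma int by (simp add: I.prob_space)
      also have "\<dots> \<le> (\<integral>v. posterior_given J \<zeta> lam n xs ys v A \<partial>?I)"
      proof (rule integral_mono_AE)
        show "integrable ?I (\<lambda>v. 1 - v * c)" using int by simp
        show "integrable ?I (\<lambda>v. posterior_given J \<zeta> lam n xs ys v A)"
        proof (rule I.integrable_const_bound[of _ 1])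
          show "AE v in ?I. norm (posterior_given J \<zeta> lam n xs ys v A) \<le> 1"
            unfolding posterior_given_def
            by (intro AE_I2) (simp add: prob_space.prob_le_1[OF prob_space_coef_posterior[OF J]])
          show "(\<lambda>v. posterior_given J \<zeta> lam n xs ys v A) \<in> borel_measurable ?I"
            using posterior_given_measurable[OF J A] by simp
        qed
        show "AE v in ?I. 1 - v * c \<le> posterior_given J \<zeta> lam n xs ys v A"
          using AE_inverse_gamma_law_pos by eventually_elim (simp add: ge)
      qed
      finally show ?thesis by (simp add: Inverse_Gamma)
    qed (use ge s in auto)
  qed
qed

section \<open>Distances between step functions\<close>

lemma L1_dist_nonneg: "0 \<le> L1_dist G f h"
  by (simp add: L1_dist_def integral_nonneg_AE)

lemma L1_setdist_le: "h \<in> A \<Longrightarrow> L1_setdist G f A \<le> L1_dist G f h"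
  unfolding L1_setdist_def by (intro cINF_lower) (auto intro!: bdd_belowI[of _ 0] L1_dist_nonneg)

lemma L1_setdist_greatest: "A \<noteq> {} \<Longrightarrow> (\<And>h. h \<in> A \<Longrightarrow> c \<le> L1_dist G f h) \<Longrightarrow> c \<le> L1_setdist G f A"
  unfolding L1_setdist_def by (rule cINF_greatest)

lemma L1_dist_step_fn:
  fixes G :: "(real ^ 'd) measure"
  assumes "finite_measure G" and [measurable_cong]: "sets G = sets borel" and J: "0 < J"
  shows "L1_dist G (step_fn J \<theta>) (step_fn J \<theta>') = (\<Sum>j\<in>indices J. measure G (cell J j) * \<bar>\<theta> j - \<theta>' j\<bar>)"
proof -
  interpret finite_measure G by fact
  have eq: "\<bar>step_fn J \<theta> x - step_fn J \<theta>' x\<bar> = (\<Sum>j\<in>indices J. \<bar>\<theta> j - \<theta>' j\<bar> * indicator (cell J j) x)" for x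
  proof (cases "\<exists>j\<in>indices J. x \<in> cell J j")
    case True
    then obtain j where j: "j \<in> indices J" "x \<in> cell J j" by auto
    have "\<bar>step_fn J \<theta> x - step_fn J \<theta>' x\<bar> = step_fn J (\<lambda>j. \<bar>\<theta> j - \<theta>' j\<bar>) x"
      by (simp only: step_fn_eq[OF j(1) J j(2)])
    then show ?thesis by (simp only: step_fn_def)
  next
    case False
    then have "step_fn J c x = 0" for c unfolding step_fn_def by (intro sum.neutral) auto
    from this[of \<theta>] this[of \<theta>'] this[of "\<lambda>j. \<bar>\<theta> j - \<theta>' j\<bar>"] show ?thesis
      by (simp only: step_fn_def)
  qed
  have "L1_dist G (step_fn J \<theta>) (step_fn J \<theta>') = (\<integral>x. \<bar>step_fn J \<theta> x - step_fn J \<theta>' x\<bar> \<partial>G)"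
    unfolding L1_dist_def by (rule integral_completion) measurable
  also have "\<dots> = (\<integral>x. (\<Sum>j\<in>indices J. \<bar>\<theta> j - \<theta>' j\<bar> * indicator (cell J j) x) \<partial>G)"
    by (simp only: eq)
  also have "\<dots> = (\<Sum>j\<in>indices J. measure G (cell J j) * \<bar>\<theta> j - \<theta>' j\<bar>)"
  proof (subst Bochner_Integration.integral_sum)
    have c: "cell J j \<in> sets G" for j by (simp add: assms(2))
    show "integrable G (\<lambda>x. \<bar>\<theta> j - \<theta>' j\<bar> * indicator (cell J j) x)" for j
      using c by (intro integrable_mult_right integrable_real_indicator) (auto simp: less_top[symmetric])
    have "cell J j \<inter> space G = cell J j" for j using sets.sets_into_space[OF c] by blast
    then show "(\<Sum>j\<in>indices J. \<integral>x. \<bar>\<theta> j - \<theta>' j\<bar> * indicator (cell J j) x \<partial>G)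
        = (\<Sum>j\<in>indices J. measure G (cell J j) * \<bar>\<theta> j - \<theta>' j\<bar>)"
      by (simp add: mult.commute)
  qed
  finally show ?thesis .
qed

lemma sum_cell_measure_le:
  fixes G :: "(real ^ 'd) measure"
  assumes "prob_space G" and "sets G = sets borel" and J: "0 < J"
  shows "(\<Sum>j\<in>indices J. measure G (cell J j)) \<le> 1"
proof -
  interpret prob_space G by fact
  have "(\<Sum>j\<in>indices J. measure G (cell J j)) = measure G (\<Union>j\<in>indices J. cell J j)"
    using J by (intro finite_measure_finite_Union[symmetric]) (auto simp: assms(2) disjoint_family_on_def dest: cell_unique)
  then show ?thesis by simp
qed

text \<open>Restriction to \<open>indices J\<close> makes the rounded vectors extensional; having
  rational values on a finite set, they form a countable family.\<close>

definition floor_coefs :: "nat \<Rightarrow> nat \<Rightarrow> (('d \<Rightarrow> nat) \<Rightarrow> real) \<Rightarrow> ('d::finite \<Rightarrow> nat) \<Rightarrow> real" where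
  "floor_coefs J k a = (\<lambda>j\<in>indices J. real_of_int \<lfloor>real (Suc k) * a j\<rfloor> / real (Suc k))"

lemma monotone_coefs_nonempty: "(\<lambda>_. 0) \<in> monotone_coefs J"
  by (simp add: monotone_coefs_def)

text \<open>Rounding down preserves monotonicity, so the infimum may be taken over a countable set.\<close>

lemma L1_setdist_monotone_step_fns_measurable:
  fixes G :: "(real ^ 'd) measure"
  assumes G: "prob_space G" and Gs: "sets G = sets borel" and J: "0 < J"
  shows "(\<lambda>\<theta>. L1_setdist G (step_fn J \<theta>) (monotone_step_fns J)) \<in> borel_measurable (\<Pi>\<^sub>M j\<in>indices J. borel)"
proof -
  interpret prob_space G by fact
  define p where "p = (\<lambda>j. measure G (cell J j))"
  define D where "D = (\<lambda>\<theta> a :: ('d \<Rightarrow> nat) \<Rightarrow> real. \<Sum>j\<in>indices J. p j * \<bar>\<theta> j - a j\<bar>)"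
  define Q :: "(('d \<Rightarrow> nat) \<Rightarrow> real) set" where "Q = (\<lambda>(k, a). floor_coefs J k a) ` (UNIV \<times> monotone_coefs J)"
  have p: "0 \<le> p j" "sum p (indices J) \<le> 1" for j
    using sum_cell_measure_le[OF assms] by (auto simp: p_def)
  have D: "L1_dist G (step_fn J \<theta>) (step_fn J a) = D \<theta> a" for \<theta> a
    unfolding D_def p_def by (rule L1_dist_step_fn[OF _ Gs J]) unfold_locales
  have D0: "0 \<le> D \<theta> a" for \<theta> a using p by (auto simp: D_def intro!: sum_nonneg)
  have "Q \<subseteq> PiE (indices J) (\<lambda>_. \<rat>)" by (auto simp: Q_def floor_coefs_def)
  then have cnt: "countable Q" by (rule countable_subset) (intro countable_PiE finite_indices countable_rat)
  have Q: "Q \<subseteq> monotone_coefs J"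
    by (auto simp: Q_def floor_coefs_def monotone_coefs_def intro!: divide_right_mono floor_mono mult_left_mono)
  have Q0: "Q \<noteq> {}" using monotone_coefs_nonempty by (auto simp: Q_def)
  have "L1_setdist G (step_fn J \<theta>) (monotone_step_fns J) = (INF a\<in>Q. D \<theta> a)" for \<theta>
  proof (rule antisym)
    show "L1_setdist G (step_fn J \<theta>) (monotone_step_fns J) \<le> (INF a\<in>Q. D \<theta> a)"
    proof (rule cINF_greatest[OF Q0])
      fix a assume "a \<in> Q"
      then have "step_fn J a \<in> monotone_step_fns J" using Q by (auto simp: monotone_step_fns_eq[OF J])
      then show "L1_setdist G (step_fn J \<theta>) (monotone_step_fns J) \<le> D \<theta> a"
        using L1_setdist_le D by metis
    qed
    show "(INF a\<in>Q. D \<theta> a) \<le> L1_setdist G (step_fn J \<theta>) (monotone_step_fns J)"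
    proof (rule L1_setdist_greatest)
      show "(monotone_step_fns J :: (real ^ 'd \<Rightarrow> real) set) \<noteq> {}"
        using monotone_coefs_nonempty by (auto simp: monotone_step_fns_eq[OF J])
      fix h :: "real ^ 'd \<Rightarrow> real" assume "h \<in> monotone_step_fns J"
      then obtain a where a: "a \<in> monotone_coefs J" "h = step_fn J a" by (auto simp: monotone_step_fns_eq[OF J])
      have le: "(INF a\<in>Q. D \<theta> a) \<le> D \<theta> a + inverse (real (Suc k))" for k
      proof -
        let ?f = "floor_coefs J k a"
        have "(INF a\<in>Q. D \<theta> a) \<le> D \<theta> ?f"
        proof (rule cINF_lower)
          show "bdd_below (D \<theta> ` Q)" using D0 by (auto intro!: bdd_belowI[of _ 0])
          show "?f \<in> Q" using a(1) by (auto simp: Q_def)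
        qed
        also have "\<dots> \<le> (\<Sum>j\<in>indices J. p j * \<bar>\<theta> j - a j\<bar> + p j * inverse (real (Suc k)))"
          unfolding D_def
        proof (intro sum_mono)
          fix j :: "'d \<Rightarrow> nat" assume j: "j \<in> indices J"
          have "\<bar>a j - ?f j\<bar> = \<bar>real (Suc k) * a j - \<lfloor>real (Suc k) * a j\<rfloor>\<bar> / real (Suc k)"
          proof -
            have "a j - ?f j = (real (Suc k) * a j - \<lfloor>real (Suc k) * a j\<rfloor>) / real (Suc k)"
              using j by (simp add: floor_coefs_def diff_divide_distrib del: of_nat_Suc)
            then show ?thesis by (simp add: abs_divide del: of_nat_Suc)
          qed
          also have "\<dots> \<le> 1 / real (Suc k)" by (intro divide_right_mono) linarith+
          finally have "\<bar>\<theta> j - ?f j\<bar> \<le> \<bar>\<theta> j - a j\<bar> + inverse (real (Suc k))" by (simp add: inverse_eq_divide)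
          then show "p j * \<bar>\<theta> j - ?f j\<bar> \<le> p j * \<bar>\<theta> j - a j\<bar> + p j * inverse (real (Suc k))"
            using p(1) by (simp only: distrib_left[symmetric]) (rule mult_left_mono)
        qed
        also have "\<dots> = D \<theta> a + sum p (indices J) * inverse (real (Suc k))"
          by (simp add: sum.distrib D_def sum_distrib_right)
        also have "\<dots> \<le> D \<theta> a + 1 * inverse (real (Suc k))"
          by (intro add_left_mono mult_right_mono p) simp
        finally show ?thesis by simp
      qed
      have "(\<lambda>k. D \<theta> a + inverse (real (Suc k))) \<longlonglongrightarrow> D \<theta> a + 0"
        by (intro tendsto_intros LIMSEQ_inverse_real_of_nat)
      then have "(INF a\<in>Q. D \<theta> a) \<le> D \<theta> a + 0" by (rule LIMSEQ_le_const) (use le in auto)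
      then show "(INF a\<in>Q. D \<theta> a) \<le> L1_dist G (step_fn J \<theta>) h" by (simp add: a D)
    qed
  qed
  moreover have "(\<lambda>\<theta>. INF a\<in>Q. D \<theta> a) \<in> borel_measurable (\<Pi>\<^sub>M j\<in>indices J. borel)"
  proof (rule borel_measurable_cINF_real[OF cnt])
    show "(\<lambda>\<theta>. D \<theta> a) \<in> borel_measurable (\<Pi>\<^sub>M j\<in>indices J. borel)" for a
      unfolding D_def by measurable
  qed
  ultimately show ?thesis by simp
qed

text \<open>The bounded density makes cell probabilities at most of order J to the power -d, so a
  sum of oscillations weighted by \<open>G\<close> can be compared with the unweighted sum over the
  cells.\<close>

lemma measure_cell_le:
  fixes G :: "(real ^ 'd) measure"
  assumes g: "g \<in> borel_measurable borel" "\<And>x. g x \<le> B" "0 \<le> B" and G: "G = density lborel (\<lambda>x. ennreal (g x))" and J: "0 < J"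
  shows "measure G (cell J j) \<le> B * (1 / real J) ^ CARD('d)"
proof -
  have "emeasure G (cell J j) = (\<integral>\<^sup>+x. ennreal (g x) * indicator (cell J j) x \<partial>lborel)"
    unfolding G using g(1) by (intro emeasure_density) auto
  also have "\<dots> \<le> (\<integral>\<^sup>+x. ennreal B * indicator (cell J j) x \<partial>lborel)"
    by (intro nn_integral_mono mult_right_mono ennreal_leI g) simp
  also have "\<dots> = ennreal B * emeasure lborel (cell J j)" by (subst nn_integral_cmult_indicator) auto
  also have "\<dots> \<le> ennreal B * ennreal ((1 / real J) ^ CARD('d))"
    by (intro mult_left_mono emeasure_cell_le J) simp
  also have "\<dots> = ennreal (B * (1 / real J) ^ CARD('d))" using g(3) by (simp add: ennreal_mult)
  finally have "emeasure G (cell J j) \<le> ennreal (B * (1 / real J) ^ CARD('d))" .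
  then show ?thesis using g(3) unfolding measure_def by (intro enn2real_leI) auto
qed

text \<open>Triangle inequality in which \<open>f\<close> may fail to be measurable: a
  non-integrable function has integral 0, and the right-hand side is nonnegative.\<close>

lemma L1_dist_le_step_fn:
  fixes G :: "(real ^ 'd) measure"
  assumes "prob_space G" and Gs[measurable_cong]: "sets G = sets borel" and J: "0 < J"
    and cube: "AE x in G. x \<in> {0..1}"
    and osc: "\<And>j x. j \<in> indices J \<Longrightarrow> x \<in> cell J j \<Longrightarrow> \<bar>f x - \<theta> j\<bar> \<le> b" and "0 \<le> b"
  shows "L1_dist G f (step_fn J a) \<le> b + L1_dist G (step_fn J \<theta>) (step_fn J a)"
proof -
  interpret prob_space G by fact
  interpret c: prob_space "completion G" by (rule prob_space_completion)
  have int: "integrable (completion G) (\<lambda>x. \<bar>step_fn J \<theta> x - step_fn J a x\<bar>)"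
    unfolding step_fn_def
    by (intro integrable_abs Bochner_Integration.integrable_diff Bochner_Integration.integrable_sum integrable_mult_right integrable_real_indicator)
      (auto simp: Gs less_top[symmetric])
  have "AE x in G. \<bar>f x - step_fn J a x\<bar> \<le> b + \<bar>step_fn J \<theta> x - step_fn J a x\<bar>"
    using cube
  proof eventually_elim
    fix x :: "real ^ 'd" assume x: "x \<in> {0..1}"
    obtain j where j: "j \<in> indices J" "x \<in> cell J j" using ex_cell[OF x J] .
    show "\<bar>f x - step_fn J a x\<bar> \<le> b + \<bar>step_fn J \<theta> x - step_fn J a x\<bar>"
      using osc[OF j] by (simp add: step_fn_eq[OF j(1) J j(2)])
  qed
  then have "AE x in completion G. \<bar>f x - step_fn J a x\<bar> \<le> b + \<bar>step_fn J \<theta> x - step_fn J a x\<bar>"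
    by (rule AE_completion)
  then have "L1_dist G f (step_fn J a) \<le> (\<integral>x. b + \<bar>step_fn J \<theta> x - step_fn J a x\<bar> \<partial>completion G)"
    unfolding L1_dist_def using int \<open>0 \<le> b\<close> by (intro integral_mono_AE') auto
  also have "\<dots> = b + L1_dist G (step_fn J \<theta>) (step_fn J a)"
    using int by (simp add: L1_dist_def prob_space)
  finally show ?thesis .
qed

text \<open>
  Summing the increments along the diagonal \<open>(1, \<dots>, 1)\<close> telescopes, leaving only the boundary
  cells, of which there are \<open>J\<^sup>d - (J - 1)\<^sup>d\<close>.
\<close>

lemma sum_diagonal_increments_le:
  fixes F :: "real ^ 'd \<Rightarrow> real"
  assumes F: "F \<in> monotone_fns" and J: "0 < J"
  shows "(\<Sum>j\<in>indices J. F (upper J j) - F (lower J j)) \<le> real J ^ CARD('d) * (real CARD('d) / real J) * (F 1 - F 0)"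
proof -
  define A where "A = (indices J :: ('d \<Rightarrow> nat) set)"
  define s where "s = (\<lambda>(j :: 'd \<Rightarrow> nat) k. j k - 1)"
  have A: "A = {j. \<forall>k. 1 \<le> j k \<and> j k \<le> J}" by (auto simp: A_def indices_def PiE_def Pi_def)
  have fin: "finite A" by (simp add: A_def)
  have sinj: "inj_on s A"
  proof (rule inj_onI, rule ext)
    fix i j k assume "i \<in> A" "j \<in> A" "s i = s j"
    then have "i k - 1 = j k - 1" "1 \<le> i k" "1 \<le> j k" by (auto simp: s_def A dest: fun_cong[of _ _ k])
    then show "i k = j k" by simp
  qed
  have sA: "s ` A = {j. \<forall>k. j k < J}"
  proof safe
    fix j :: "'d \<Rightarrow> nat" and k assume "j \<in> A" then show "s j k < J"
      by (auto simp: A s_def dest!: spec[of _ k])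
  next
    fix j :: "'d \<Rightarrow> nat" assume "\<forall>k. j k < J"
    then show "j \<in> s ` A" by (intro image_eqI[of _ _ "\<lambda>k. Suc (j k)"]) (auto simp: s_def A Suc_le_eq)
  qed
  \<comment> \<open>\<open>s\<close> shifts an index by (1, ..., 1) downwards, so the lower corner
    of a cell is the upper corner belonging to the shifted index, and the increments become
    differences of \<open>H\<close>.\<close>
  have low: "lower J j = upper J (s j)" if "j \<in> A" for j
    using that by (auto simp: lower_def upper_def s_def A vec_eq_iff of_nat_diff)
  define H where "H = (\<lambda>j. F (upper J j))"
  have cube: "upper J j \<in> {0..1}" if "\<And>k. j k \<le> J" for j :: "'d \<Rightarrow> nat"
    using that J by (simp add: upper_def less_eq_vec_def)
  have H: "F 0 \<le> H j" "H j \<le> F 1" if "\<And>k. j k \<le> J" for j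
    using F cube[of j] that unfolding H_def monotone_fns_def mono_on_def
    by (auto simp: less_eq_vec_def)
  define m where "m = card (A - s ` A)"
  have AsA: "A \<inter> s ` A = UNIV \<rightarrow>\<^sub>E {1..J - 1}"
  proof -
    have iff: "1 \<le> m \<and> m \<le> J \<and> m < J \<longleftrightarrow> 1 \<le> m \<and> m \<le> J - 1" for m using J by auto
    have "A \<inter> s ` A = {j. \<forall>k. 1 \<le> j k \<and> j k \<le> J \<and> j k < J}" unfolding sA by (auto simp: A)
    then show ?thesis unfolding iff by (auto simp: PiE_def Pi_def)
  qed
  have cardI: "card (A \<inter> s ` A) = (J - 1) ^ CARD('d)"
    unfolding AsA by (simp add: card_PiE)
  have m1: "real m = real J ^ CARD('d) - (real J - 1) ^ CARD('d)"
  proof -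
    have "card A = m + card (A \<inter> s ` A)" unfolding m_def using fin by (metis card_Diff_subset_Int finite_Int Int_lower1 card_mono le_add_diff_inverse2)
    then have "real (card A) = real m + real (card (A \<inter> s ` A))" by simp
    moreover have "real (card A) = real J ^ CARD('d)" by (simp add: A_def card_indices)
    ultimately show ?thesis unfolding cardI using J by (simp add: of_nat_diff)
  qed
  have m2: "card (s ` A - A) = m"
    unfolding m_def using fin sinj by (simp add: card_Diff_subset_Int card_image Int_commute)
  \<comment> \<open>Bernoulli's inequality for (1 - 1/J) to the power d turns the exact count of
    boundary indices into a number of order J to the power d - 1.\<close>
  have "real m \<le> real J ^ CARD('d) * (real CARD('d) / real J)"
  proof -
    have "1 + real CARD('d) * (- 1 / real J) \<le> (1 + - 1 / real J) ^ CARD('d)"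
      using J by (intro Bernoulli_inequality) simp
    then have "real J ^ CARD('d) * (1 - real CARD('d) / real J) \<le> real J ^ CARD('d) * (1 - 1 / real J) ^ CARD('d)"
      by (intro mult_left_mono) auto
    also have "\<dots> = (real J - 1) ^ CARD('d)"
      unfolding power_mult_distrib[symmetric] using J by (simp add: right_diff_distrib)
    finally show ?thesis unfolding m1 by (simp add: algebra_simps)
  qed
  moreover have "F 0 \<le> F 1" 
    using F unfolding monotone_fns_def by (auto intro!: mono_onD[of "{0..1}" F] simp: less_eq_vec_def)
  ultimately have mF: "real m * (F 1 - F 0) \<le> real J ^ CARD('d) * (real CARD('d) / real J) * (F 1 - F 0)"
    by (intro mult_right_mono) auto
  have "(\<Sum>j\<in>A. F (upper J j) - F (lower J j)) = sum H A - (\<Sum>j\<in>A. H (s j))"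
    by (simp add: sum_subtractf H_def low)
  also have "(\<Sum>j\<in>A. H (s j)) = sum H (s ` A)" using sinj by (simp add: sum.reindex)
  \<comment> \<open>The common indices cancel. The two remaining layers both have m elements, and on
    them \<open>H\<close> lies between \<open>F 0\<close> and \<open>F 1\<close>.\<close>
  also have "sum H A - sum H (s ` A) = sum H (A - s ` A) - sum H (s ` A - A)"
    using fin sum.Int_Diff[of A H "s ` A"] sum.Int_Diff[of "s ` A" H A] by (simp add: Int_commute)
  also have "\<dots> \<le> real m * F 1 - real m * F 0"
  proof (rule diff_mono)
    show "sum H (A - s ` A) \<le> real m * F 1"
      unfolding m_def by (rule sum_bounded_above) (auto simp: A intro!: H)
    show "real m * F 0 \<le> sum H (s ` A - A)"
      unfolding m2[symmetric] by (rule sum_bounded_below) (auto simp: sA less_imp_le intro!: H)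
  qed
  also have "\<dots> \<le> real J ^ CARD('d) * (real CARD('d) / real J) * (F 1 - F 0)"
    using mF by (simp add: algebra_simps)
  finally show ?thesis by (simp add: A_def)
qed

section \<open>Random design\<close>

lemma cell_count_eq: "cell_count J n xs j = (\<Sum>i<n. indicator (cell J j) (xs i))"
proof -
  have "(\<Sum>i<n. indicator (cell J j) (xs i) :: real) = (\<Sum>i\<in>{i. i < n \<and> xs i \<in> cell J j}. 1)"
    by (rule sum.mono_neutral_cong_right) (auto simp: indicator_def)
  then show ?thesis by (simp add: cell_count_def)
qed

lemma cell_sum_eq:
  "cell_count J n xs j * cell_mean J n xs ys j = (\<Sum>i<n. indicator (cell J j) (xs i) * ys i)"
proof -
  have "cell_count J n xs j * cell_mean J n xs ys j = (\<Sum>i | i < n \<and> xs i \<in> cell J j. ys i)"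
  proof (cases "{i. i < n \<and> xs i \<in> cell J j} = {}")
    case True then show ?thesis unfolding cell_mean_def cell_count_def True by simp
  next
    case False
    then have "cell_count J n xs j \<noteq> 0" by (simp add: cell_count_def card_eq_0_iff)
    then show ?thesis by (simp add: cell_mean_def)
  qed
  also have "\<dots> = (\<Sum>i<n. indicator (cell J j) (xs i) * ys i)"
    by (rule sum.mono_neutral_cong_left) (auto simp: indicator_def)
  finally show ?thesis .
qed

text \<open>The three terms are bias, noise and the pull of the prior. Since the precision is the
  cell count plus the prior precision, the multiple of \<open>a\<close> that is subtracted splits
  accordingly between data and prior.\<close>

lemma post_mean_deviation:
  fixes \<zeta> :: "('d::finite \<Rightarrow> nat) \<Rightarrow> real"
  assumes "lam j \<noteq> 0" and r_def: "r = post_prec J lam n xs j"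
  shows "\<bar>post_mean J \<zeta> lam n xs (\<lambda>i. f (xs i) + es i) j - a\<bar>
    \<le> (\<Sum>i<n. indicator (cell J j) (xs i) * \<bar>f (xs i) - a\<bar>) / r
      + \<bar>\<Sum>i<n. es i * (indicator (cell J j) (xs i) / r)\<bar>
      + inverse ((lam j)\<^sup>2) * (\<bar>\<zeta> j\<bar> + \<bar>a\<bar>) / r"
proof -
  define c where "c = inverse ((lam j)\<^sup>2)"
  define I where "I = (\<lambda>i. indicator (cell J j) (xs i) :: real)"
  have r: "0 < r" unfolding r_def using post_prec_pos[of lam j J n xs] assms(1) by simp
  have re: "r = sum I {..<n} + c" by (simp add: r_def post_prec_def cell_count_eq I_def c_def)
  have c: "0 \<le> c" by (simp add: c_def)
  have "post_mean J \<zeta> lam n xs (\<lambda>i. f (xs i) + es i) j - a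
      = ((\<Sum>i<n. I i * (f (xs i) + es i)) + \<zeta> j * c - a * r) / r"
    using r by (simp add: post_mean_def cell_sum_eq diff_divide_distrib I_def c_def flip: r_def)
  also have "(\<Sum>i<n. I i * (f (xs i) + es i)) + \<zeta> j * c - a * r
      = (\<Sum>i<n. I i * (f (xs i) - a)) + (\<Sum>i<n. es i * I i) + c * (\<zeta> j - a)"
    unfolding re by (simp add: algebra_simps sum.distrib sum_subtractf sum_distrib_left)
  also have "\<dots> / r = (\<Sum>i<n. I i * (f (xs i) - a)) / r + (\<Sum>i<n. es i * (I i / r)) + c * (\<zeta> j - a) / r"
    by (simp add: add_divide_distrib sum_divide_distrib)
  also have "\<bar>\<dots>\<bar> \<le> \<bar>(\<Sum>i<n. I i * (f (xs i) - a)) / r\<bar> + \<bar>\<Sum>i<n. es i * (I i / r)\<bar> + \<bar>c * (\<zeta> j - a) / r\<bar>"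
    by (intro order_trans[OF abs_triangle_ineq] add_mono abs_triangle_ineq) simp
  also have "\<bar>(\<Sum>i<n. I i * (f (xs i) - a)) / r\<bar> \<le> (\<Sum>i<n. I i * \<bar>f (xs i) - a\<bar>) / r"
    using r by (auto simp: abs_divide I_def abs_mult intro!: divide_right_mono order_trans[OF sum_abs])
  also have "\<bar>c * (\<zeta> j - a) / r\<bar> \<le> c * (\<bar>\<zeta> j\<bar> + \<bar>a\<bar>) / r"
    using r c by (auto simp: abs_divide abs_mult intro!: divide_right_mono mult_left_mono)
  finally show ?thesis by (simp add: I_def c_def)
qed

lemma post_prec_measurable [measurable]:
  "(\<lambda>xs. post_prec J lam n xs j) \<in> borel_measurable (\<Pi>\<^sub>M i\<in>UNIV. borel)"
  unfolding post_prec_def cell_count_eq by measurable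

locale random_design = prob_space P for P :: "'w measure" +
  fixes G :: "(real ^ 'd) measure" and X :: "nat \<Rightarrow> 'w \<Rightarrow> real ^ 'd" and eps :: "nat \<Rightarrow> 'w \<Rightarrow> real" and \<sigma>0 :: real
  assumes X_indep: "indep_vars (\<lambda>_. borel) X UNIV" and X_distr: "\<And>i. distr P borel (X i) = G"
    and eps_indep: "indep_vars (\<lambda>_. borel) eps UNIV"
    and X_eps_indep: "indep_set
      (sets (vimage_algebra (space P) (\<lambda>\<omega> i. X i \<omega>) (\<Pi>\<^sub>M i\<in>UNIV. borel)))
      (sets (vimage_algebra (space P) (\<lambda>\<omega> i. eps i \<omega>) (\<Pi>\<^sub>M i\<in>UNIV. borel)))"
    and eps_integrable: "\<And>i. integrable P (eps i)" and eps_mean: "\<And>i. expectation (eps i) = 0"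
    and eps2_integrable: "\<And>i. integrable P (\<lambda>\<omega>. (eps i \<omega>)\<^sup>2)"
    and eps_variance: "\<And>i. variance (eps i) = \<sigma>0\<^sup>2"
begin

lemma X_measurable [measurable]: "X i \<in> borel_measurable P"
  using X_indep by (auto simp: indep_vars_def)

lemma eps_measurable [measurable]: "eps i \<in> borel_measurable P"
  using eps_integrable by blast

lemma prob_space_G: "prob_space G"
  using prob_space_distr[OF X_measurable] X_distr by metis

lemma sets_G [measurable_cong, simp]: "sets G = sets borel"
  using X_distr[of 0] by (metis sets_distr)

lemma space_G [simp]: "space G = UNIV"
  using sets_eq_imp_space_eq[OF sets_G] by simp

lemma has_bochner_integral_X:
  fixes f :: "real ^ 'd \<Rightarrow> real"
  assumes "integrable G f"
  shows "has_bochner_integral P (\<lambda>\<omega>. f (X i \<omega>)) (\<integral>x. f x \<partial>G)"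
proof -
  have f: "f \<in> borel_measurable borel" using assms by (simp add: measurable_cong_sets[OF sets_G refl, symmetric])
  show ?thesis
    using assms integrable_distr_eq[OF X_measurable f, of i] integral_distr[OF X_measurable f, of i]
    by (simp add: X_distr has_bochner_integral_iff)
qed

lemma AE_X: "(AE x in G. R x) \<Longrightarrow> AE \<omega> in P. R (X i \<omega>)"
  by (rule AE_distrD[OF X_measurable, of R i, unfolded X_distr])

lemma X_process_measurable [measurable]: "(\<lambda>\<omega> i. X i \<omega>) \<in> measurable P (\<Pi>\<^sub>M i\<in>UNIV. borel)"
  by (auto intro!: measurable_PiM_single')

lemma eps_process_measurable [measurable]: "(\<lambda>\<omega> i. eps i \<omega>) \<in> measurable P (\<Pi>\<^sub>M i\<in>UNIV. borel)"
  by (auto intro!: measurable_PiM_single')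

text \<open>Preimages of Borel sets under a functional of the process lie in the sigma-algebra
  generated by that process, and independence passes to subfamilies.\<close>

lemma indep_X_eps:
  assumes "F \<in> borel_measurable (\<Pi>\<^sub>M i\<in>UNIV. borel)" "H \<in> borel_measurable (\<Pi>\<^sub>M i\<in>UNIV. borel)"
  shows "indep_var borel (\<lambda>\<omega>. F (\<lambda>i. X i \<omega>)) borel (\<lambda>\<omega>. H (\<lambda>i. eps i \<omega>))"
proof -
  define VX where "VX = vimage_algebra (space P) (\<lambda>\<omega> i. X i \<omega>) (\<Pi>\<^sub>M i\<in>UNIV. borel)"
  define VE where "VE = vimage_algebra (space P) (\<lambda>\<omega> i. eps i \<omega>) (\<Pi>\<^sub>M i\<in>UNIV. borel)"
  have space_VX: "space VX = space P" and space_VE: "space VE = space P" by (simp_all add: VX_def VE_def)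
  have X: "(\<lambda>\<omega>. F (\<lambda>i. X i \<omega>)) -` A \<inter> space P \<in> sets VX" if "A \<in> sets borel" for A
    using measurable_sets[OF measurable_compose[OF measurable_vimage_algebra1 assms(1)] that, of "\<lambda>\<omega> i. X i \<omega>" "space P"]
    by (simp add: VX_def space_PiM)
  have E: "(\<lambda>\<omega>. H (\<lambda>i. eps i \<omega>)) -` A \<inter> space P \<in> sets VE" if "A \<in> sets borel" for A
    using measurable_sets[OF measurable_compose[OF measurable_vimage_algebra1 assms(2)] that, of "\<lambda>\<omega> i. eps i \<omega>" "space P"]
    by (simp add: VE_def space_PiM)
  have "sigma_sets (space P) {(\<lambda>\<omega>. F (\<lambda>i. X i \<omega>)) -` A \<inter> space P |A. A \<in> sets borel} \<subseteq> sets VX"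
    using X by (subst space_VX[symmetric], intro sets.sigma_sets_subset) (auto simp: space_VX)
  moreover have "sigma_sets (space P) {(\<lambda>\<omega>. H (\<lambda>i. eps i \<omega>)) -` A \<inter> space P |A. A \<in> sets borel} \<subseteq> sets VE"
    using E by (subst space_VE[symmetric], intro sets.sigma_sets_subset) (auto simp: space_VE)
  moreover have "indep_set (sets VX) (sets VE)" using X_eps_indep by (simp add: VX_def VE_def)
  ultimately have "indep_set (sigma_sets (space P) {(\<lambda>\<omega>. F (\<lambda>i. X i \<omega>)) -` A \<inter> space P |A. A \<in> sets borel})
      (sigma_sets (space P) {(\<lambda>\<omega>. H (\<lambda>i. eps i \<omega>)) -` A \<inter> space P |A. A \<in> sets borel})"
    unfolding indep_sets2_eq by blast
  then show ?thesis
    unfolding indep_var_eq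
    using measurable_compose[OF X_process_measurable assms(1)] measurable_compose[OF eps_process_measurable assms(2)]
    by simp
qed

lemma eps_second_moments:
  "has_bochner_integral P (\<lambda>\<omega>. eps i \<omega> * eps k \<omega>) (if i = k then \<sigma>0\<^sup>2 else 0)"
proof (cases "i = k")
  case True
  have "expectation (\<lambda>\<omega>. (eps i \<omega>)\<^sup>2) = \<sigma>0\<^sup>2" using eps_variance[of i] by (simp add: eps_mean)
  then show ?thesis using True eps2_integrable[of i] by (simp add: has_bochner_integral_iff power2_eq_square)
next
  case False
  have ind: "indep_vars (\<lambda>_. borel) eps {i, k}" by (rule indep_vars_subset[OF eps_indep]) simp
  show ?thesis
    using indep_vars_lebesgue_integral[OF _ ind] indep_vars_integrable[OF _ ind] False
    by (auto simp: has_bochner_integral_iff eps_integrable eps_mean)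
qed

abbreviation Xs :: "'w \<Rightarrow> nat \<Rightarrow> real ^ 'd" where
  "Xs \<omega> \<equiv> \<lambda>i. X i \<omega>"

abbreviation Ys :: "(real ^ 'd \<Rightarrow> real) \<Rightarrow> 'w \<Rightarrow> nat \<Rightarrow> real" where
  "Ys f \<omega> \<equiv> \<lambda>i. f (X i \<omega>) + eps i \<omega>"

text \<open>Number of the other design points in \<open>A\<close>. It is a function of the
  observations different from \<open>i\<close>, hence independent of \<open>X i\<close>, and it
  determines the full count when \<open>X i\<close> lies in \<open>A\<close>.\<close>

definition loo_count :: "(real ^ 'd) set \<Rightarrow> nat \<Rightarrow> nat \<Rightarrow> 'w \<Rightarrow> real" where
  "loo_count A n i \<omega> = (\<Sum>k\<in>{..<n} - {i}. indicator A (X k \<omega>))"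

lemma loo_nonneg: "0 \<le> loo_count A n i \<omega>"
  by (simp add: loo_count_def sum_nonneg)

lemma loo_eq: "i < n \<Longrightarrow> X i \<omega> \<in> A \<Longrightarrow> 1 + loo_count A n i \<omega> = (\<Sum>k<n. indicator A (X k \<omega>))"
  unfolding loo_count_def by (subst sum.remove[of _ i]) auto

lemma loo_le: "loo_count A n i \<omega> \<le> (\<Sum>k<n. indicator A (X k \<omega>))"
  unfolding loo_count_def by (rule sum_mono2) auto

lemma loo_measurable [measurable]:
  assumes [measurable]: "A \<in> sets borel"
  shows "loo_count A n i \<in> borel_measurable P"
  unfolding loo_count_def by measurable

lemma loo_inverse_integrable:
  assumes [measurable]: "A \<in> sets borel"
  shows "integrable P (\<lambda>\<omega>. 1 / (1 + loo_count A n i \<omega>))"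
proof (rule integrable_const_bound[of _ 1])
  show "AE \<omega> in P. norm (1 / (1 + loo_count A n i \<omega>)) \<le> 1"
    by (intro AE_I2) (simp add: abs_divide loo_nonneg divide_le_eq_1 add_pos_nonneg)
qed measurable

lemma loo_indep:
  assumes "integrable G f" and A [measurable]: "A \<in> sets borel"
  shows "has_bochner_integral P (\<lambda>\<omega>. f (X i \<omega>) * (1 / (1 + loo_count A n i \<omega>)))
    ((\<integral>x. f x \<partial>G) * expectation (\<lambda>\<omega>. 1 / (1 + loo_count A n i \<omega>)))"
proof -
  have f [measurable]: "f \<in> borel_measurable borel" using assms(1) by (simp add: measurable_cong_sets[OF sets_G refl, symmetric])
  let ?B = "{..<n} - {i}"
  have "indep_var (PiM {i} (\<lambda>_. borel)) (\<lambda>\<omega>. restrict (Xs \<omega>) {i}) (PiM ?B (\<lambda>_. borel)) (\<lambda>\<omega>. restrict (Xs \<omega>) ?B)"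
    by (rule indep_var_restrict[OF X_indep]) auto
  then have "indep_var borel ((\<lambda>x. f (x i)) \<circ> (\<lambda>\<omega>. restrict (Xs \<omega>) {i}))
      borel ((\<lambda>x. 1 / (1 + (\<Sum>k\<in>?B. indicator A (x k)))) \<circ> (\<lambda>\<omega>. restrict (Xs \<omega>) ?B))"
    by (rule indep_var_compose) measurable
  moreover have "(\<lambda>x. 1 / (1 + (\<Sum>k\<in>?B. indicator A (x k)))) \<circ> (\<lambda>\<omega>. restrict (Xs \<omega>) ?B) = (\<lambda>\<omega>. 1 / (1 + loo_count A n i \<omega>))"
    by (simp add: fun_eq_iff loo_count_def)
  ultimately have ind: "indep_var borel (\<lambda>\<omega>. f (X i \<omega>)) borel (\<lambda>\<omega>. 1 / (1 + loo_count A n i \<omega>))"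
    by (simp add: comp_def)
  show ?thesis
    using indep_var_lebesgue_integral[OF ind] indep_var_integrable[OF ind]
      has_bochner_integral_X[OF assms(1), of i] loo_inverse_integrable[OF A, of n i]
    by (auto simp: has_bochner_integral_iff)
qed

text \<open>The left-hand side equals the expectation of \<open>\<Sum>\<^sub>i 1\<^sub>A(X\<^sub>i) / N\<^sub>A \<le> 1\<close>, by independence of
  \<open>X\<^sub>i\<close> and the other design points.\<close>

lemma loo_sum_le:
  assumes A: "A \<in> sets borel"
  shows "measure G A * (\<Sum>i<n. expectation (\<lambda>\<omega>. 1 / (1 + loo_count A n i \<omega>))) \<le> 1"
proof -
  interpret G: prob_space G by (rule prob_space_G)
  have h: "has_bochner_integral P (\<lambda>\<omega>. \<Sum>i<n. indicator A (X i \<omega>) * (1 / (1 + loo_count A n i \<omega>)))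
      (\<Sum>i<n. (\<integral>x. indicator A x \<partial>G) * expectation (\<lambda>\<omega>. 1 / (1 + loo_count A n i \<omega>)))"
    using A by (intro has_bochner_integral_sum loo_indep integrable_real_indicator) (auto simp: less_top[symmetric])
  have le: "(\<Sum>i<n. indicator A (X i \<omega>) * (1 / (1 + loo_count A n i \<omega>))) \<le> (1::real)" for \<omega>
  proof -
    let ?N = "\<Sum>k<n. indicator A (X k \<omega>) :: real"
    have "(\<Sum>i<n. indicator A (X i \<omega>) * (1 / (1 + loo_count A n i \<omega>))) = (\<Sum>i<n. indicator A (X i \<omega>) * (1 / ?N))"
      by (intro sum.cong) (auto simp: indicator_def loo_eq)
    also have "\<dots> = ?N * (1 / ?N)" by (simp only: sum_distrib_right)
    also have "\<dots> \<le> 1" by simp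
    finally show ?thesis .
  qed
  have "(\<Sum>i<n. (\<integral>x. indicator A x \<partial>G) * expectation (\<lambda>\<omega>. 1 / (1 + loo_count A n i \<omega>))) \<le> 1"
    using has_bochner_integral_integral_eq[OF h] integral_le_const[OF integrable.intros[OF h], of 1] le by auto
  then show ?thesis by (simp add: sum_distrib_left)
qed

text \<open>The full count dominates each leave-one-out count. Summing over the n observations gives
  n copies of the same expectation on one side and \<open>loo_sum_le\<close> bounds the
  other.\<close>

lemma expectation_inverse_count_le:
  assumes A: "A \<in> sets borel" and n: "0 < n"
  shows "integrable P (\<lambda>\<omega>. 1 / (1 + (\<Sum>k<n. indicator A (X k \<omega>))) :: real)"
    and "measure G A * expectation (\<lambda>\<omega>. 1 / (1 + (\<Sum>k<n. indicator A (X k \<omega>)))) \<le> 1 / real n"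
proof -
  let ?f = "\<lambda>\<omega>. 1 / (1 + (\<Sum>k<n. indicator A (X k \<omega>))) :: real"
  show int: "integrable P ?f"
  proof (rule integrable_const_bound[of _ 1])
    have "0 \<le> (\<Sum>k<n. indicator A (X k \<omega>) :: real)" for \<omega> by (intro sum_nonneg) auto
    then show "AE \<omega> in P. norm (?f \<omega>) \<le> 1" by (intro AE_I2) (simp add: abs_divide divide_le_eq_1 add_pos_nonneg)
  qed (use A in measurable)
  have "expectation ?f \<le> expectation (\<lambda>\<omega>. 1 / (1 + loo_count A n i \<omega>))" for i
    using loo_le[of A n i] loo_nonneg[of A n i]
    by (intro integral_mono int loo_inverse_integrable A divide_left_mono)
      (auto intro!: mult_pos_pos add_pos_nonneg sum_nonneg)
  then have "(\<Sum>i<n. expectation ?f) \<le> (\<Sum>i<n. expectation (\<lambda>\<omega>. 1 / (1 + loo_count A n i \<omega>)))"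
    by (rule sum_mono)
  then have "measure G A * (real n * expectation ?f) \<le> measure G A * (\<Sum>i<n. expectation (\<lambda>\<omega>. 1 / (1 + loo_count A n i \<omega>)))"
    by (intro mult_left_mono) auto
  also have "\<dots> \<le> 1" by (rule loo_sum_le[OF A])
  finally show "measure G A * expectation ?f \<le> 1 / real n"
    using n by (simp add: field_simps)
qed

text \<open>A summand with \<open>X i\<close> in \<open>A\<close> has denominator
  \<open>1 + loo_count\<close>, which is independent of its numerator; \<open>loo_sum_le\<close>
  then controls the denominators. An empty cell contributes 0 by division by zero. Integrability of
  \<open>f\<close> suffices, which is what consistency for unbounded functions rests on.\<close>

lemma expectation_cell_average_le:
  assumes f: "integrable G f" "\<And>x. 0 \<le> f x" and A: "A \<in> sets borel"
  shows "integrable P (\<lambda>\<omega>. (\<Sum>i<n. indicator A (X i \<omega>) * f (X i \<omega>)) / (\<Sum>k<n. indicator A (X k \<omega>)))"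
    and "measure G A * expectation (\<lambda>\<omega>. (\<Sum>i<n. indicator A (X i \<omega>) * f (X i \<omega>)) / (\<Sum>k<n. indicator A (X k \<omega>)))
      \<le> (\<integral>x. indicator A x * f x \<partial>G)"
proof -
  let ?I = "\<integral>x. indicator A x * f x \<partial>G"
  have int: "integrable G (\<lambda>x. indicator A x * f x)" using integrable_real_mult_indicator[OF _ f(1), of A] A by (simp add: mult.commute)
  have "has_bochner_integral P (\<lambda>\<omega>. \<Sum>i<n. (indicator A (X i \<omega>) * f (X i \<omega>)) * (1 / (1 + loo_count A n i \<omega>)))
      (\<Sum>i<n. ?I * expectation (\<lambda>\<omega>. 1 / (1 + loo_count A n i \<omega>)))"
    by (intro has_bochner_integral_sum loo_indep[OF int] A)
  moreover have "(\<Sum>i<n. (indicator A (X i \<omega>) * f (X i \<omega>)) * (1 / (1 + loo_count A n i \<omega>)))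
      = (\<Sum>i<n. indicator A (X i \<omega>) * f (X i \<omega>)) / (\<Sum>k<n. indicator A (X k \<omega>))" for \<omega>
    unfolding sum_divide_distrib by (intro sum.cong) (auto simp: indicator_def loo_eq)
  ultimately have h: "has_bochner_integral P (\<lambda>\<omega>. (\<Sum>i<n. indicator A (X i \<omega>) * f (X i \<omega>)) / (\<Sum>k<n. indicator A (X k \<omega>)))
      (?I * (\<Sum>i<n. expectation (\<lambda>\<omega>. 1 / (1 + loo_count A n i \<omega>))))"
    by (simp add: sum_distrib_left)
  show "integrable P (\<lambda>\<omega>. (\<Sum>i<n. indicator A (X i \<omega>) * f (X i \<omega>)) / (\<Sum>k<n. indicator A (X k \<omega>)))"
    using h by (rule integrable.intros)
  have "0 \<le> ?I" using f(2) by (intro integral_nonneg_AE) auto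
  then have "?I * (measure G A * (\<Sum>i<n. expectation (\<lambda>\<omega>. 1 / (1 + loo_count A n i \<omega>)))) \<le> ?I * 1"
    by (intro mult_left_mono loo_sum_le A)
  then show "measure G A * expectation (\<lambda>\<omega>. (\<Sum>i<n. indicator A (X i \<omega>) * f (X i \<omega>)) / (\<Sum>k<n. indicator A (X k \<omega>))) \<le> ?I"
    using has_bochner_integral_integral_eq[OF h] by (simp add: ac_simps)
qed

text \<open>The weights may depend on the whole design, as they do when divided by random counts.
  Given the design the errors remain orthogonal, so only the diagonal terms survive; boundedness of
  the weights provides integrability.\<close>

lemma noise_second_moment:
  assumes W: "\<And>i. W i \<in> borel_measurable (\<Pi>\<^sub>M i\<in>UNIV. borel)" and b: "\<And>i xs. \<bar>W i xs\<bar> \<le> b"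
  shows "has_bochner_integral P (\<lambda>\<omega>. (\<Sum>i<n. eps i \<omega> * W i (Xs \<omega>))\<^sup>2)
    (\<sigma>0\<^sup>2 * expectation (\<lambda>\<omega>. \<Sum>i<n. (W i (Xs \<omega>))\<^sup>2))"
proof -
  let ?X = "\<lambda>\<omega> i. X i \<omega>"
  have int: "integrable P (\<lambda>\<omega>. W i (?X \<omega>) * W k (?X \<omega>))" for i k
  proof (rule integrable_const_bound[of _ "b * b"])
    have "0 \<le> b" using b[of 0 undefined] by linarith
    then show "AE \<omega> in P. norm (W i (?X \<omega>) * W k (?X \<omega>)) \<le> b * b"
      using b by (auto simp: abs_mult intro!: mult_mono)
    show "(\<lambda>\<omega>. W i (?X \<omega>) * W k (?X \<omega>)) \<in> borel_measurable P"
      using W by measurable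
  qed
  have 1: "has_bochner_integral P (\<lambda>\<omega>. (W i (?X \<omega>) * W k (?X \<omega>)) * (eps i \<omega> * eps k \<omega>))
      (expectation (\<lambda>\<omega>. W i (?X \<omega>) * W k (?X \<omega>)) * (if i = k then \<sigma>0\<^sup>2 else 0))" for i k
  proof -
    have ind: "indep_var borel (\<lambda>\<omega>. W i (?X \<omega>) * W k (?X \<omega>)) borel (\<lambda>\<omega>. eps i \<omega> * eps k \<omega>)"
      using indep_X_eps[of "\<lambda>xs. W i xs * W k xs" "\<lambda>es. es i * es k"] W by simp
    show ?thesis
      using indep_var_lebesgue_integral[OF ind int] indep_var_integrable[OF ind int] eps_second_moments[of i k]
      by (auto simp: has_bochner_integral_iff)
  qed
  have "has_bochner_integral P (\<lambda>\<omega>. \<Sum>i<n. \<Sum>k<n. (W i (?X \<omega>) * W k (?X \<omega>)) * (eps i \<omega> * eps k \<omega>))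
      (\<Sum>i<n. \<Sum>k<n. expectation (\<lambda>\<omega>. W i (?X \<omega>) * W k (?X \<omega>)) * (if i = k then \<sigma>0\<^sup>2 else 0))"
    by (intro has_bochner_integral_sum 1)
  moreover have "(\<Sum>i<n. \<Sum>k<n. expectation (\<lambda>\<omega>. W i (?X \<omega>) * W k (?X \<omega>)) * (if i = k then \<sigma>0\<^sup>2 else 0))
      = (\<Sum>i<n. expectation (\<lambda>\<omega>. W i (?X \<omega>) * W i (?X \<omega>)) * \<sigma>0\<^sup>2)"
    by (intro sum.cong) (auto simp: if_distrib cong: if_cong)
  moreover have "\<dots> = \<sigma>0\<^sup>2 * expectation (\<lambda>\<omega>. \<Sum>i<n. (W i (?X \<omega>))\<^sup>2)"
    using int by (simp add: power2_eq_square sum_distrib_left mult.commute)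
  moreover have "(\<lambda>\<omega>. \<Sum>i<n. \<Sum>k<n. (W i (?X \<omega>) * W k (?X \<omega>)) * (eps i \<omega> * eps k \<omega>))
      = (\<lambda>\<omega>. (\<Sum>i<n. eps i \<omega> * W i (?X \<omega>))\<^sup>2)"
    by (simp add: power2_eq_square sum_product ac_simps)
  ultimately show ?thesis by simp
qed

text \<open>The estimated variance contains the mean of squared errors, of which only the
  expectation is controlled. Independence from the design lets the expectation of its product with a
  design functional factorise, so no law of large numbers or fourth moment is called for.\<close>

lemma mean_square_noise:
  assumes F: "F \<in> borel_measurable (\<Pi>\<^sub>M i\<in>UNIV. borel)" and int: "integrable P (\<lambda>\<omega>. F (Xs \<omega>))" and n: "0 < n"
  shows "has_bochner_integral P (\<lambda>\<omega>. F (Xs \<omega>) * ((\<Sum>i<n. (eps i \<omega>)\<^sup>2) / real n))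
    (expectation (\<lambda>\<omega>. F (Xs \<omega>)) * \<sigma>0\<^sup>2)"
proof -
  have "has_bochner_integral P (\<lambda>\<omega>. \<Sum>i<n. eps i \<omega> * eps i \<omega>) (\<Sum>i<n. if i = i then \<sigma>0\<^sup>2 else 0)"
    by (intro has_bochner_integral_sum eps_second_moments)
  then have "has_bochner_integral P (\<lambda>\<omega>. (\<Sum>i<n. (eps i \<omega>)\<^sup>2) / real n) (real n * \<sigma>0\<^sup>2 / real n)"
    by (intro has_bochner_integral_divide_zero) (simp add: power2_eq_square)
  then have e: "has_bochner_integral P (\<lambda>\<omega>. (\<Sum>i<n. (eps i \<omega>)\<^sup>2) / real n) (\<sigma>0\<^sup>2)"
    using n by simp
  have ind: "indep_var borel (\<lambda>\<omega>. F (Xs \<omega>)) borel (\<lambda>\<omega>. (\<Sum>i<n. (eps i \<omega>)\<^sup>2) / real n)"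
    by (rule indep_X_eps[of F "\<lambda>es. (\<Sum>i<n. (es i)\<^sup>2) / real n"]) (use F in measurable)
  show ?thesis
    using indep_var_lebesgue_integral[OF ind int] indep_var_integrable[OF ind int] has_bochner_integral_integral_eq[OF e] integrable.intros[OF e]
    by (simp only: has_bochner_integral_iff)
qed

end

section \<open>Noise and posterior spread\<close>

text \<open>The condition \<open>1 \<le> b\<close> is a normalisation: it makes the posterior
  precision at least (1 + N)/b, where N is the cell count, also when the bound on the prior
  variances is below 1.\<close>

definition prior_bounded :: "real \<Rightarrow> real \<Rightarrow> real \<Rightarrow> nat \<Rightarrow> (('d::finite \<Rightarrow> nat) \<Rightarrow> real) \<Rightarrow> (('d \<Rightarrow> nat) \<Rightarrow> real) \<Rightarrow> bool" where
  "prior_bounded B a b J \<zeta> lam \<longleftrightarrow> 0 < a \<and> 0 \<le> B \<and> 1 \<le> b \<and>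
     (\<forall>j\<in>indices J. \<bar>\<zeta> j\<bar> \<le> B \<and> a \<le> (lam j)\<^sup>2 \<and> (lam j)\<^sup>2 \<le> b)"

context
  fixes B a b :: real and J :: nat and \<zeta> lam :: "('d::finite \<Rightarrow> nat) \<Rightarrow> real" and j :: "'d \<Rightarrow> nat"
  assumes prior: "prior_bounded B a b J \<zeta> lam" and j: "j \<in> indices J"
begin

lemma prior_boundedD: "0 < a" "0 \<le> B" "1 \<le> b" "\<bar>\<zeta> j\<bar> \<le> B" "lam j \<noteq> 0"
    "inverse ((lam j)\<^sup>2) \<le> 1 / a" "1 / b \<le> inverse ((lam j)\<^sup>2)"
proof -
  have h: "0 < a" "0 \<le> B" "1 \<le> b" "\<bar>\<zeta> j\<bar> \<le> B" "a \<le> (lam j)\<^sup>2" "(lam j)\<^sup>2 \<le> b"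
    using prior j by (auto simp: prior_bounded_def)
  then show "0 < a" "0 \<le> B" "1 \<le> b" "\<bar>\<zeta> j\<bar> \<le> B" by auto
  show "lam j \<noteq> 0" using h(1,5) by auto
  then show "inverse ((lam j)\<^sup>2) \<le> 1 / a" "1 / b \<le> inverse ((lam j)\<^sup>2)"
    using h by (auto simp: inverse_eq_divide intro!: divide_left_mono mult_pos_pos)
qed

lemma inverse_post_prec_le:
  "1 / post_prec J lam n xs j \<le> b * (1 / (1 + cell_count J n xs j))" "1 / post_prec J lam n xs j \<le> b"
proof -
  have p: "0 < post_prec J lam n xs j" by (rule post_prec_pos) (rule prior_boundedD)
  have b: "0 < b" using prior_boundedD(3) by simp
  have c: "1 \<le> b * inverse ((lam j)\<^sup>2)" using prior_boundedD(7) b by (simp add: field_simps)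
  have N: "cell_count J n xs j \<le> b * cell_count J n xs j"
    using mult_right_mono[OF prior_boundedD(3) cell_count_nonneg] by simp
  have "1 + cell_count J n xs j \<le> b * post_prec J lam n xs j"
    using c N by (simp add: post_prec_def distrib_left)
  then show "1 / post_prec J lam n xs j \<le> b * (1 / (1 + cell_count J n xs j))"
    using p by (simp add: field_simps add_pos_nonneg)
  have "1 \<le> b * post_prec J lam n xs j"
    using \<open>1 + cell_count J n xs j \<le> b * post_prec J lam n xs j\<close> cell_count_nonneg[of J n xs j] by linarith
  then show "1 / post_prec J lam n xs j \<le> b" using p by (simp add: field_simps)
qed

end

context random_design
begin

abbreviation cell_prob :: "nat \<Rightarrow> ('d \<Rightarrow> nat) \<Rightarrow> real" where
  "cell_prob J j \<equiv> measure G (cell J j)"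

text \<open>
  Up to the factor \<open>\<sigma>\<^sup>2\<close>, \<open>V1\<close> bounds the squared \<open>L\<^sub>1\<close> spread of the posterior and \<open>V2\<close> the variance
  of a linear functional with bounded weights; the latter is smaller by the number of cells.
\<close>

definition V1 :: "nat \<Rightarrow> (('d \<Rightarrow> nat) \<Rightarrow> real) \<Rightarrow> nat \<Rightarrow> (nat \<Rightarrow> real ^ 'd) \<Rightarrow> real" where
  "V1 J lam n xs = (\<Sum>j\<in>indices J. cell_prob J j / post_prec J lam n xs j)"

definition V2 :: "nat \<Rightarrow> (('d \<Rightarrow> nat) \<Rightarrow> real) \<Rightarrow> nat \<Rightarrow> (nat \<Rightarrow> real ^ 'd) \<Rightarrow> real" where
  "V2 J lam n xs = (\<Sum>j\<in>indices J. (cell_prob J j)\<^sup>2 / post_prec J lam n xs j)"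

lemma V1_measurable [measurable]: "V1 J lam n \<in> borel_measurable (\<Pi>\<^sub>M i\<in>UNIV. borel)"
  unfolding V1_def by measurable

lemma V2_measurable [measurable]: "V2 J lam n \<in> borel_measurable (\<Pi>\<^sub>M i\<in>UNIV. borel)"
  unfolding V2_def by measurable

lemma V1_nonneg: "0 \<le> V1 J lam n xs" and V2_nonneg: "0 \<le> V2 J lam n xs"
  by (auto simp: V1_def V2_def intro!: sum_nonneg divide_nonneg_nonneg)

lemma sum_cell_prob_le: "0 < J \<Longrightarrow> (\<Sum>j\<in>indices J. cell_prob J j) \<le> 1"
  by (rule sum_cell_measure_le[OF prob_space_G sets_G])

lemma expectation_inverse_post_prec:
  assumes prior: "prior_bounded B a b J \<zeta> lam" and j: "j \<in> indices J" and n: "0 < n"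
  shows "integrable P (\<lambda>\<omega>. 1 / post_prec J lam n (Xs \<omega>) j)"
    and "cell_prob J j * expectation (\<lambda>\<omega>. 1 / post_prec J lam n (Xs \<omega>) j) \<le> b / real n"
proof -
  note le = inverse_post_prec_le[OF prior j, where n = n]
  note cnt = expectation_inverse_count_le[OF cell_measurable n, of J j, folded cell_count_eq]
  have b: "0 < b" using prior_boundedD(3)[OF prior j] by simp
  show int: "integrable P (\<lambda>\<omega>. 1 / post_prec J lam n (Xs \<omega>) j)"
  proof (rule integrable_const_bound[of _ b])
    show "AE \<omega> in P. norm (1 / post_prec J lam n (Xs \<omega>) j) \<le> b"
      using le by (intro AE_I2) (simp add: abs_divide)
  qed measurable
  have "expectation (\<lambda>\<omega>. 1 / post_prec J lam n (Xs \<omega>) j)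
      \<le> expectation (\<lambda>\<omega>. b * (1 / (1 + cell_count J n (Xs \<omega>) j)))"
    using int cnt(1) le by (intro integral_mono integrable_mult_right) auto
  also have "\<dots> = b * expectation (\<lambda>\<omega>. 1 / (1 + cell_count J n (Xs \<omega>) j))"
    by (rule integral_mult_right_zero)
  finally have "cell_prob J j * expectation (\<lambda>\<omega>. 1 / post_prec J lam n (Xs \<omega>) j)
      \<le> cell_prob J j * (b * expectation (\<lambda>\<omega>. 1 / (1 + cell_count J n (Xs \<omega>) j)))"
    by (rule mult_left_mono) simp
  also have "\<dots> = b * (cell_prob J j * expectation (\<lambda>\<omega>. 1 / (1 + cell_count J n (Xs \<omega>) j)))" by simp
  also have "\<dots> \<le> b * (1 / real n)" using cnt(2) b by (intro mult_left_mono) auto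
  finally show "cell_prob J j * expectation (\<lambda>\<omega>. 1 / post_prec J lam n (Xs \<omega>) j) \<le> b / real n" by simp
qed

lemma expectation_V1:
  assumes prior: "prior_bounded B a b J \<zeta> lam" and n: "0 < n"
  shows "integrable P (\<lambda>\<omega>. V1 J lam n (Xs \<omega>))"
    and "expectation (\<lambda>\<omega>. V1 J lam n (Xs \<omega>)) \<le> b * (real J ^ CARD('d) / real n)"
proof -
  note e = expectation_inverse_post_prec[OF prior _ n]
  have h: "has_bochner_integral P (\<lambda>\<omega>. \<Sum>j\<in>indices J. cell_prob J j * (1 / post_prec J lam n (Xs \<omega>) j))
      (\<Sum>j\<in>indices J. cell_prob J j * expectation (\<lambda>\<omega>. 1 / post_prec J lam n (Xs \<omega>) j))"
    using e(1) by (intro has_bochner_integral_sum has_bochner_integral_mult_right) (simp add: has_bochner_integral_iff)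
  then show "integrable P (\<lambda>\<omega>. V1 J lam n (Xs \<omega>))" by (simp add: V1_def has_bochner_integral_iff)
  have "expectation (\<lambda>\<omega>. V1 J lam n (Xs \<omega>))
      = (\<Sum>j\<in>indices J. cell_prob J j * expectation (\<lambda>\<omega>. 1 / post_prec J lam n (Xs \<omega>) j))"
    using has_bochner_integral_integral_eq[OF h] by (simp add: V1_def)
  also have "\<dots> \<le> (\<Sum>j\<in>(indices J :: ('d \<Rightarrow> nat) set). b / real n)" by (intro sum_mono e(2))
  also have "\<dots> = b * (real J ^ CARD('d) / real n)" by (simp add: card_indices)
  finally show "expectation (\<lambda>\<omega>. V1 J lam n (Xs \<omega>)) \<le> b * (real J ^ CARD('d) / real n)" .
qed

text \<open>One cell probability is used up by the bound b/n on each cell; the others sum to at most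
  1, so the number of cells does not appear.\<close>

lemma expectation_V2:
  assumes prior: "prior_bounded B a b J \<zeta> lam" and n: "0 < n" and J: "0 < J"
  shows "integrable P (\<lambda>\<omega>. V2 J lam n (Xs \<omega>))"
    and "expectation (\<lambda>\<omega>. V2 J lam n (Xs \<omega>)) \<le> b / real n"
proof -
  note e = expectation_inverse_post_prec[OF prior _ n]
  have b: "0 \<le> b" using prior by (simp add: prior_bounded_def)
  have h: "has_bochner_integral P (\<lambda>\<omega>. \<Sum>j\<in>indices J. cell_prob J j * (cell_prob J j * (1 / post_prec J lam n (Xs \<omega>) j)))
      (\<Sum>j\<in>indices J. cell_prob J j * (cell_prob J j * expectation (\<lambda>\<omega>. 1 / post_prec J lam n (Xs \<omega>) j)))"
    using e(1) by (intro has_bochner_integral_sum has_bochner_integral_mult_right) (simp add: has_bochner_integral_iff)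
  then show "integrable P (\<lambda>\<omega>. V2 J lam n (Xs \<omega>))" by (simp add: V2_def has_bochner_integral_iff power2_eq_square)
  have "expectation (\<lambda>\<omega>. V2 J lam n (Xs \<omega>))
      = (\<Sum>j\<in>indices J. cell_prob J j * (cell_prob J j * expectation (\<lambda>\<omega>. 1 / post_prec J lam n (Xs \<omega>) j)))"
    using has_bochner_integral_integral_eq[OF h] by (simp add: V2_def power2_eq_square)
  also have "\<dots> \<le> (\<Sum>j\<in>(indices J :: ('d \<Rightarrow> nat) set). cell_prob J j * (b / real n))"
    by (intro sum_mono mult_left_mono e(2)) auto
  also have "\<dots> = (\<Sum>j\<in>(indices J :: ('d \<Rightarrow> nat) set). cell_prob J j) * (b / real n)"
    by (simp only: sum_distrib_right)
  also have "\<dots> \<le> 1 * (b / real n)" using b by (intro mult_right_mono sum_cell_prob_le J) auto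
  finally show "expectation (\<lambda>\<omega>. V2 J lam n (Xs \<omega>)) \<le> b / real n" by simp
qed

definition noise_L1 :: "nat \<Rightarrow> (('d \<Rightarrow> nat) \<Rightarrow> real) \<Rightarrow> nat \<Rightarrow> 'w \<Rightarrow> real" where
  "noise_L1 J lam n \<omega> = (\<Sum>j\<in>indices J. cell_prob J j *
     \<bar>\<Sum>i<n. eps i \<omega> * (indicator (cell J j) (X i \<omega>) / post_prec J lam n (Xs \<omega>) j)\<bar>)"

lemma noise_L1_measurable [measurable]: "noise_L1 J lam n \<in> borel_measurable P"
  unfolding noise_L1_def by measurable

lemma noise_L1_nonneg: "0 \<le> noise_L1 J lam n \<omega>"
  unfolding noise_L1_def by (intro sum_nonneg mult_nonneg_nonneg) auto

text \<open>In each cell the noise has variance at most the error variance times the mean inverse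
  precision, which the cell probability reduces to order 1/n. The sum over all cells yields the
  factor J to the power d, and Chebyshev concludes.\<close>

lemma noise_L1_tail:
  assumes prior: "prior_bounded B a b J \<zeta> lam" and n: "0 < n" and J: "0 < J" and t: "0 < t"
  shows "prob {\<omega> \<in> space P. t \<le> noise_L1 J lam n \<omega>} \<le> \<sigma>0\<^sup>2 * b * (real J ^ CARD('d) / real n) / t\<^sup>2"
proof -
  define W where "W = (\<lambda>j i xs. indicator (cell J j) (xs i) / post_prec J lam n xs j)"
  have Wm [measurable]: "W j i \<in> borel_measurable (\<Pi>\<^sub>M i\<in>UNIV. borel)" for i j
    unfolding W_def by measurable
  have Wb: "\<bar>W j i xs\<bar> \<le> b" if "j \<in> indices J" for i j xs
    using inverse_post_prec_le(2)[OF prior that, of n xs] prior_boundedD(3)[OF prior that]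
    by (auto simp: W_def indicator_def abs_divide)
  \<comment> \<open>The indicator is its own square, so the sum equals the cell count over the
    squared precision, and the count is at most the precision.\<close>
  have sumW: "(\<Sum>i<n. (W j i xs)\<^sup>2) \<le> 1 / post_prec J lam n xs j" if j: "j \<in> indices J" for j xs
  proof -
    let ?r = "post_prec J lam n xs j"
    have r: "0 < ?r" by (rule post_prec_pos) (rule prior_boundedD[OF prior j])
    have "(\<Sum>i<n. (W j i xs)\<^sup>2) = (\<Sum>i<n. indicator (cell J j) (xs i) / ?r\<^sup>2)"
      by (intro sum.cong) (auto simp: W_def indicator_def power_divide)
    also have "\<dots> = cell_count J n xs j / ?r\<^sup>2" by (simp add: cell_count_eq sum_divide_distrib)
    also have "\<dots> \<le> ?r / ?r\<^sup>2" by (intro divide_right_mono) (auto simp: post_prec_def)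
    also have "\<dots> = 1 / ?r" using r by (simp add: power2_eq_square)
    finally show ?thesis .
  qed
  have h: "has_bochner_integral P (\<lambda>\<omega>. (\<Sum>i<n. eps i \<omega> * W j i (Xs \<omega>))\<^sup>2)
      (\<sigma>0\<^sup>2 * expectation (\<lambda>\<omega>. \<Sum>i<n. (W j i (Xs \<omega>))\<^sup>2))" if "j \<in> indices J" for j
    using noise_second_moment[of "W j" b n] Wm Wb[OF that] by auto
  have Wint: "integrable P (\<lambda>\<omega>. \<Sum>i<n. (W j i (Xs \<omega>))\<^sup>2)" if "j \<in> indices J" for j
  proof (rule integrable_const_bound[of _ b])
    show "AE \<omega> in P. norm (\<Sum>i<n. (W j i (Xs \<omega>))\<^sup>2) \<le> b"
      using order_trans[OF sumW[OF that] inverse_post_prec_le(2)[OF prior that]] by (simp add: sum_nonneg)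
  qed measurable
  let ?g = "\<lambda>\<omega>. \<Sum>j\<in>indices J. cell_prob J j * (\<Sum>i<n. eps i \<omega> * W j i (Xs \<omega>))\<^sup>2"
  let ?c = "\<Sum>j\<in>indices J. cell_prob J j * (\<sigma>0\<^sup>2 * expectation (\<lambda>\<omega>. \<Sum>i<n. (W j i (Xs \<omega>))\<^sup>2))"
  have g: "has_bochner_integral P ?g ?c"
    by (intro has_bochner_integral_sum has_bochner_integral_mult_right h)
  have le: "(noise_L1 J lam n \<omega>)\<^sup>2 \<le> ?g \<omega>" for \<omega>
    unfolding noise_L1_def W_def by (intro weighted_sum_abs_square_le sum_cell_prob_le J) auto
  have int: "integrable P (\<lambda>\<omega>. (noise_L1 J lam n \<omega>)\<^sup>2)"
  proof (rule Bochner_Integration.integrable_bound)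
    show "integrable P ?g" using g by (rule integrable.intros)
    show "AE \<omega> in P. norm ((noise_L1 J lam n \<omega>)\<^sup>2) \<le> norm (?g \<omega>)"
      unfolding real_norm_def abs_power2 by (intro AE_I2 order_trans[OF le abs_ge_self])
  qed measurable
  have "?c \<le> (\<Sum>j\<in>(indices J :: ('d \<Rightarrow> nat) set). \<sigma>0\<^sup>2 * (b / real n))"
  proof (rule sum_mono)
    fix j :: "'d \<Rightarrow> nat" assume j: "j \<in> indices J"
    note e = expectation_inverse_post_prec[OF prior j n]
    have "expectation (\<lambda>\<omega>. \<Sum>i<n. (W j i (Xs \<omega>))\<^sup>2) \<le> expectation (\<lambda>\<omega>. 1 / post_prec J lam n (Xs \<omega>) j)"
      by (intro integral_mono Wint j e(1) sumW)
    then have "\<sigma>0\<^sup>2 * (cell_prob J j * expectation (\<lambda>\<omega>. \<Sum>i<n. (W j i (Xs \<omega>))\<^sup>2))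
        \<le> \<sigma>0\<^sup>2 * (cell_prob J j * expectation (\<lambda>\<omega>. 1 / post_prec J lam n (Xs \<omega>) j))"
      by (intro mult_left_mono) auto
    also have "\<dots> \<le> \<sigma>0\<^sup>2 * (b / real n)" by (intro mult_left_mono e(2)) simp
    finally show "cell_prob J j * (\<sigma>0\<^sup>2 * expectation (\<lambda>\<omega>. \<Sum>i<n. (W j i (Xs \<omega>))\<^sup>2)) \<le> \<sigma>0\<^sup>2 * (b / real n)"
      by (simp only: mult.left_commute)
  qed
  also have "\<dots> = \<sigma>0\<^sup>2 * b * (real J ^ CARD('d) / real n)" by (simp add: card_indices)
  finally have c: "?c \<le> \<sigma>0\<^sup>2 * b * (real J ^ CARD('d) / real n)" .
  have "{\<omega> \<in> space P. t \<le> noise_L1 J lam n \<omega>} = {\<omega> \<in> space P. t \<le> \<bar>noise_L1 J lam n \<omega>\<bar>}"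
    using noise_L1_nonneg by (auto simp: abs_of_nonneg)
  then have "prob {\<omega> \<in> space P. t \<le> noise_L1 J lam n \<omega>} \<le> expectation (\<lambda>\<omega>. (noise_L1 J lam n \<omega>)\<^sup>2) / t\<^sup>2"
    using second_moment_method[OF noise_L1_measurable int t] by simp
  also have "\<dots> \<le> ?c / t\<^sup>2"
    using integral_mono[OF int integrable.intros[OF g] le] has_bochner_integral_integral_eq[OF g]
    by (intro divide_right_mono) auto
  also have "\<dots> \<le> \<sigma>0\<^sup>2 * b * (real J ^ CARD('d) / real n) / t\<^sup>2" by (intro divide_right_mono c) simp
  finally show ?thesis .
qed

text \<open>The bias term is left unevaluated because it is bounded in two ways: by cell
  oscillations when these are controlled, and in mean through \<open>cell_dev\<close> for an
  integrable function.\<close>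

lemma post_mean_L1_deviation:
  assumes prior: "prior_bounded B a b J \<zeta> lam" and \<theta>: "\<And>j. j \<in> indices J \<Longrightarrow> \<bar>\<theta> j\<bar> \<le> \<beta>"
  shows "(\<Sum>j\<in>indices J. cell_prob J j * \<bar>post_mean J \<zeta> lam n (Xs \<omega>) (Ys f \<omega>) j - \<theta> j\<bar>)
    \<le> (\<Sum>j\<in>indices J. cell_prob J j *
        ((\<Sum>i<n. indicator (cell J j) (X i \<omega>) * \<bar>f (X i \<omega>) - \<theta> j\<bar>) / post_prec J lam n (Xs \<omega>) j))
      + noise_L1 J lam n \<omega> + (B + \<beta>) / a * V1 J lam n (Xs \<omega>)"
proof -
  let ?X = "Xs \<omega>"
  let ?r = "\<lambda>j. post_prec J lam n ?X j"
  have "(\<Sum>j\<in>indices J. cell_prob J j * \<bar>post_mean J \<zeta> lam n ?X (Ys f \<omega>) j - \<theta> j\<bar>)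
    \<le> (\<Sum>j\<in>indices J. cell_prob J j * ((\<Sum>i<n. indicator (cell J j) (X i \<omega>) * \<bar>f (X i \<omega>) - \<theta> j\<bar>) / ?r j)
       + cell_prob J j * \<bar>\<Sum>i<n. eps i \<omega> * (indicator (cell J j) (X i \<omega>) / ?r j)\<bar>
       + (B + \<beta>) / a * (cell_prob J j / ?r j))"
  proof (rule sum_mono)
    fix j :: "'d \<Rightarrow> nat" assume j: "j \<in> indices J"
    note pb = prior_boundedD[OF prior j]
    have r: "0 < ?r j" using post_prec_pos[of lam j] pb(5) by simp
    have "inverse ((lam j)\<^sup>2) * (\<bar>\<zeta> j\<bar> + \<bar>\<theta> j\<bar>) / ?r j \<le> 1 / a * (B + \<beta>) / ?r j"
      using pb \<theta>[OF j] r by (intro divide_right_mono mult_mono add_mono) auto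
    then have le: "\<bar>post_mean J \<zeta> lam n ?X (Ys f \<omega>) j - \<theta> j\<bar>
        \<le> (\<Sum>i<n. indicator (cell J j) (X i \<omega>) * \<bar>f (X i \<omega>) - \<theta> j\<bar>) / ?r j
          + \<bar>\<Sum>i<n. eps i \<omega> * (indicator (cell J j) (X i \<omega>) / ?r j)\<bar> + 1 / a * (B + \<beta>) / ?r j"
      using post_mean_deviation[of lam j "?r j" J n ?X \<zeta> f "\<lambda>i. eps i \<omega>" "\<theta> j", OF pb(5) refl] by linarith
    show "cell_prob J j * \<bar>post_mean J \<zeta> lam n ?X (Ys f \<omega>) j - \<theta> j\<bar>
      \<le> cell_prob J j * ((\<Sum>i<n. indicator (cell J j) (X i \<omega>) * \<bar>f (X i \<omega>) - \<theta> j\<bar>) / ?r j)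
       + cell_prob J j * \<bar>\<Sum>i<n. eps i \<omega> * (indicator (cell J j) (X i \<omega>) / ?r j)\<bar>
       + (B + \<beta>) / a * (cell_prob J j / ?r j)"
      using mult_left_mono[OF le, of "cell_prob J j"] by (simp add: distrib_left ac_simps)
  qed
  also have "\<dots> = (\<Sum>j\<in>indices J. cell_prob J j * ((\<Sum>i<n. indicator (cell J j) (X i \<omega>) * \<bar>f (X i \<omega>) - \<theta> j\<bar>) / ?r j))
      + noise_L1 J lam n \<omega> + (B + \<beta>) / a * V1 J lam n ?X"
    by (simp add: sum.distrib noise_L1_def V1_def sum_distrib_left)
  finally show ?thesis .
qed

text \<open>If \<open>T\<close> is not measurable then its integral is \<open>0\<close>, so only \<open>E\<close> has to be an event.\<close>

lemma test_expectation_le: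
  assumes E: "E \<in> events" and "AE \<omega> in P. T \<omega> \<le> indicator E \<omega>"
  shows "(\<integral>\<omega>. T \<omega> \<partial>completion P) \<le> prob E"
proof -
  have "(\<integral>\<omega>. T \<omega> \<partial>completion P) \<le> (\<integral>\<omega>. indicator E \<omega> \<partial>completion P)"
  proof (rule integral_mono_AE')
    show "integrable (completion P) (indicator E :: 'w \<Rightarrow> real)"
      using E by (intro integrable_real_indicator) (auto simp: less_top[symmetric])
  qed (use AE_completion[OF assms(2)] in auto)
  also have "\<dots> = prob E" using E sets.sets_into_space[OF E] by (simp add: Int_absorb1 Int_absorb2)
  finally show ?thesis .
qed

end

section \<open>Exceptional events for bounded regression functions\<close>

context random_design
begin

definition mean_sq_noise :: "nat \<Rightarrow> 'w \<Rightarrow> real" where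
  "mean_sq_noise n \<omega> = (\<Sum>i<n. (eps i \<omega>)\<^sup>2) / real n"

lemma mean_sq_noise_measurable [measurable]: "mean_sq_noise n \<in> borel_measurable P"
  unfolding mean_sq_noise_def by measurable

lemma mean_sq_noise_nonneg: "0 \<le> mean_sq_noise n \<omega>"
  by (simp add: mean_sq_noise_def sum_nonneg)

lemma sigma2_hat_le_bounded:
  assumes prior: "prior_bounded B a b J \<zeta> lam" and J: "0 < J" and n: "0 < n"
    and X: "\<And>i. i < n \<Longrightarrow> X i \<omega> \<in> {0..1}" and f: "\<And>x. x \<in> {0..1} \<Longrightarrow> \<bar>f x\<bar> \<le> \<beta>"
  shows "sigma2_hat J \<zeta> lam n (Xs \<omega>) (Ys f \<omega>) \<le> 2 * (\<beta> + B)\<^sup>2 + 2 * mean_sq_noise n \<omega>"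
proof -
  have "sigma2_hat J \<zeta> lam n (Xs \<omega>) (Ys f \<omega>)
      \<le> (\<Sum>i<n. (f (X i \<omega>) + eps i \<omega> - \<zeta> (cell_index J (X i \<omega>)))\<^sup>2) / real n"
    by (rule sigma2_hat_bounds(2)[OF J])
  also have "\<dots> \<le> (\<Sum>i<n. 2 * (\<beta> + B)\<^sup>2 + 2 * (eps i \<omega>)\<^sup>2) / real n"
  proof (intro divide_right_mono sum_mono)
    fix i assume "i \<in> {..<n}"
    then have x: "X i \<omega> \<in> {0..1}" using X by simp
    obtain j where j: "j \<in> indices J" "X i \<omega> \<in> cell J j" using ex_cell[OF x J] .
    define u where "u = f (X i \<omega>) - \<zeta> (cell_index J (X i \<omega>))"
    have "\<bar>u\<bar> \<le> \<beta> + B"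
      using f[OF x] prior_boundedD(4)[OF prior j(1)] by (simp add: u_def cell_index_eq[OF j(1) J j(2)])
    then have "u\<^sup>2 \<le> (\<beta> + B)\<^sup>2" by (metis abs_ge_zero power2_abs power_mono)
    moreover have "(u + eps i \<omega>)\<^sup>2 \<le> 2 * u\<^sup>2 + 2 * (eps i \<omega>)\<^sup>2"
      using sum_squares_ge_zero[of "u - eps i \<omega>" 0] by (simp add: power2_eq_square algebra_simps)
    ultimately show "(f (X i \<omega>) + eps i \<omega> - \<zeta> (cell_index J (X i \<omega>)))\<^sup>2 \<le> 2 * (\<beta> + B)\<^sup>2 + 2 * (eps i \<omega>)\<^sup>2"
      by (simp add: u_def algebra_simps)
  qed simp
  also have "\<dots> = 2 * (\<beta> + B)\<^sup>2 + 2 * mean_sq_noise n \<omega>"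
    using n by (simp add: sum.distrib mean_sq_noise_def add_divide_distrib sum_distrib_left)
  finally show ?thesis .
qed

text \<open>The affine function of the noise is the shape of the bound on \<open>post_var\<close>.
  Multiplied by \<open>V1\<close> or \<open>V2\<close> it bounds posterior probabilities, and
  Markov's inequality is applied to the product.\<close>

lemma expectation_affine_noise:
  assumes F: "F \<in> borel_measurable (\<Pi>\<^sub>M i\<in>UNIV. borel)" "integrable P (\<lambda>\<omega>. F (Xs \<omega>))"
    "expectation (\<lambda>\<omega>. F (Xs \<omega>)) \<le> e" and n: "0 < n" and c: "0 \<le> c1" "0 \<le> c2"
  shows "integrable P (\<lambda>\<omega>. (c1 + c2 * mean_sq_noise n \<omega>) * F (Xs \<omega>))"
    and "expectation (\<lambda>\<omega>. (c1 + c2 * mean_sq_noise n \<omega>) * F (Xs \<omega>)) \<le> (c1 + c2 * \<sigma>0\<^sup>2) * e"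
proof -
  note m = mean_square_noise[OF F(1,2) n]
  have "has_bochner_integral P (\<lambda>\<omega>. c1 * F (Xs \<omega>) + c2 * (F (Xs \<omega>) * ((\<Sum>i<n. (eps i \<omega>)\<^sup>2) / real n)))
    (c1 * expectation (\<lambda>\<omega>. F (Xs \<omega>)) + c2 * (expectation (\<lambda>\<omega>. F (Xs \<omega>)) * \<sigma>0\<^sup>2))"
    using F(2) by (intro has_bochner_integral_add has_bochner_integral_mult_right m) (simp add: has_bochner_integral_iff)
  then have h: "has_bochner_integral P (\<lambda>\<omega>. (c1 + c2 * mean_sq_noise n \<omega>) * F (Xs \<omega>))
    ((c1 + c2 * \<sigma>0\<^sup>2) * expectation (\<lambda>\<omega>. F (Xs \<omega>)))"
    by (simp add: mean_sq_noise_def algebra_simps)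
  then show "integrable P (\<lambda>\<omega>. (c1 + c2 * mean_sq_noise n \<omega>) * F (Xs \<omega>))" by (rule integrable.intros)
  have "(c1 + c2 * \<sigma>0\<^sup>2) * expectation (\<lambda>\<omega>. F (Xs \<omega>)) \<le> (c1 + c2 * \<sigma>0\<^sup>2) * e"
    using c by (intro mult_left_mono F(3)) auto
  then show "expectation (\<lambda>\<omega>. (c1 + c2 * mean_sq_noise n \<omega>) * F (Xs \<omega>)) \<le> (c1 + c2 * \<sigma>0\<^sup>2) * e"
    using has_bochner_integral_integral_eq[OF h] by (simp only: mult.assoc)
qed

text \<open>
  Quantifying over the regression function \<open>f\<close> here makes the exceptional event, hence the bound on its
  probability, uniform over a Hoelder class.
\<close>

definition good_data :: "sigma_treatment \<Rightarrow> real \<Rightarrow> real \<Rightarrow> real \<Rightarrow> nat \<Rightarrow> (('d \<Rightarrow> nat) \<Rightarrow> real) \<Rightarrow> (('d \<Rightarrow> nat) \<Rightarrow> real) \<Rightarrow> nat \<Rightarrow> 'w \<Rightarrow> bool" where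
  "good_data S \<beta> t \<delta> J \<zeta> lam n \<omega> \<longleftrightarrow> (\<forall>f \<theta> r A.
      (\<forall>x\<in>{0..1}. \<bar>f x\<bar> \<le> \<beta>) \<longrightarrow> (\<forall>j\<in>indices J. \<bar>\<theta> j\<bar> \<le> \<beta>) \<longrightarrow>
      (\<forall>j\<in>indices J. \<forall>x\<in>cell J j. \<bar>f x - \<theta> j\<bar> \<le> r j) \<longrightarrow>
      ((\<forall>\<theta>'. step_fn J \<theta>' \<in> A \<longrightarrow> (\<Sum>j\<in>indices J. cell_prob J j * r j) + 2 * t \<le> (\<Sum>j\<in>indices J. cell_prob J j * \<bar>\<theta>' j - \<theta> j\<bar>))
         \<longrightarrow> posterior S J \<zeta> lam n (Xs \<omega>) (Ys f \<omega>) A < \<delta>) \<and>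
      ({\<theta>' \<in> space (\<Pi>\<^sub>M j\<in>indices J. borel). step_fn J \<theta>' \<in> A} \<in> sets (\<Pi>\<^sub>M j\<in>indices J. borel) \<longrightarrow>
       (\<forall>\<theta>'. step_fn J \<theta>' \<notin> A \<longrightarrow> (\<Sum>j\<in>indices J. cell_prob J j * r j) + 2 * t \<le> (\<Sum>j\<in>indices J. cell_prob J j * \<bar>\<theta>' j - \<theta> j\<bar>))
         \<longrightarrow> 1 - \<delta> < posterior S J \<zeta> lam n (Xs \<omega>) (Ys f \<omega>) A))"

lemma good_dataD:
  assumes good: "good_data S \<beta> t \<delta> J \<zeta> lam n \<omega>"
    and f: "\<And>x. x \<in> {0..1} \<Longrightarrow> \<bar>f x\<bar> \<le> \<beta>" and \<theta>: "\<And>j. j \<in> indices J \<Longrightarrow> \<bar>\<theta> j\<bar> \<le> \<beta>"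
    and r: "\<And>j x. j \<in> indices J \<Longrightarrow> x \<in> cell J j \<Longrightarrow> \<bar>f x - \<theta> j\<bar> \<le> r j"
  shows "(\<And>\<theta>'. step_fn J \<theta>' \<in> A \<Longrightarrow> (\<Sum>j\<in>indices J. cell_prob J j * r j) + 2 * t \<le> (\<Sum>j\<in>indices J. cell_prob J j * \<bar>\<theta>' j - \<theta> j\<bar>))
      \<Longrightarrow> posterior S J \<zeta> lam n (Xs \<omega>) (Ys f \<omega>) A < \<delta>"
    and "{\<theta>' \<in> space (\<Pi>\<^sub>M j\<in>indices J. borel). step_fn J \<theta>' \<in> A} \<in> sets (\<Pi>\<^sub>M j\<in>indices J. borel) \<Longrightarrow>
      (\<And>\<theta>'. step_fn J \<theta>' \<notin> A \<Longrightarrow> (\<Sum>j\<in>indices J. cell_prob J j * r j) + 2 * t \<le> (\<Sum>j\<in>indices J. cell_prob J j * \<bar>\<theta>' j - \<theta> j\<bar>))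
      \<Longrightarrow> 1 - \<delta> < posterior S J \<zeta> lam n (Xs \<omega>) (Ys f \<omega>) A"
proof -
  have f': "\<forall>x\<in>{0..1}. \<bar>f x\<bar> \<le> \<beta>" and \<theta>': "\<forall>j\<in>indices J. \<bar>\<theta> j\<bar> \<le> \<beta>"
    and r': "\<forall>j\<in>indices J. \<forall>x\<in>cell J j. \<bar>f x - \<theta> j\<bar> \<le> r j"
    using f \<theta> r by blast+
  note g = good[unfolded good_data_def, THEN spec, THEN spec, THEN spec, THEN spec, THEN mp, THEN mp, THEN mp, OF f' \<theta>' r', of A]
  show "posterior S J \<zeta> lam n (Xs \<omega>) (Ys f \<omega>) A < \<delta>"
    if "\<And>\<theta>'. step_fn J \<theta>' \<in> A \<Longrightarrow> (\<Sum>j\<in>indices J. cell_prob J j * r j) + 2 * t \<le> (\<Sum>j\<in>indices J. cell_prob J j * \<bar>\<theta>' j - \<theta> j\<bar>)"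
    by (rule mp[OF conjunct1[OF g]]) (use that in blast)
  show "1 - \<delta> < posterior S J \<zeta> lam n (Xs \<omega>) (Ys f \<omega>) A"
    if "{\<theta>' \<in> space (\<Pi>\<^sub>M j\<in>indices J. borel). step_fn J \<theta>' \<in> A} \<in> sets (\<Pi>\<^sub>M j\<in>indices J. borel)"
      "\<And>\<theta>'. step_fn J \<theta>' \<notin> A \<Longrightarrow> (\<Sum>j\<in>indices J. cell_prob J j * r j) + 2 * t \<le> (\<Sum>j\<in>indices J. cell_prob J j * \<bar>\<theta>' j - \<theta> j\<bar>)"
    by (rule mp[OF mp[OF conjunct2[OF g] that(1)]]) (use that(2) in blast)
qed

text \<open>Noise and prior pull take t/2 each, so the posterior mean is within the bias plus t of
  \<open>\<theta>\<close>. A coefficient vector at distance at least the bias plus 2t from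
  \<open>\<theta>\<close> is then at least t away from the posterior mean, and Chebyshev's bound
  with the last hypothesis gives posterior mass below \<open>\<delta>\<close>.\<close>

lemma good_dataI:
  assumes S: "valid_treatment S" and prior: "prior_bounded B a b J \<zeta> lam" and J: "0 < J" and n: "4 \<le> n" and t: "0 < t" and \<beta>: "0 \<le> \<beta>"
    and C: "0 < C" "\<And>n s. 4 \<le> n \<Longrightarrow> 0 \<le> s \<Longrightarrow> post_var S n s \<le> C * (1 + s)"
    and X: "\<And>i. i < n \<Longrightarrow> X i \<omega> \<in> {0..1}"
    and 1: "noise_L1 J lam n \<omega> < t / 2" and 2: "(B + \<beta>) / a * V1 J lam n (Xs \<omega>) < t / 2"
    and 3: "(C * (1 + 2 * (\<beta> + B)\<^sup>2) + 2 * C * mean_sq_noise n \<omega>) * V1 J lam n (Xs \<omega>) < \<delta> * t\<^sup>2"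
  shows "good_data S \<beta> t \<delta> J \<zeta> lam n \<omega>"
  unfolding good_data_def
proof (intro allI impI)
  fix f :: "real ^ 'd \<Rightarrow> real" and \<theta> r :: "('d \<Rightarrow> nat) \<Rightarrow> real" and A :: "(real ^ 'd \<Rightarrow> real) set"
  assume f: "\<forall>x\<in>{0..1}. \<bar>f x\<bar> \<le> \<beta>" and \<theta>: "\<forall>j\<in>indices J. \<bar>\<theta> j\<bar> \<le> \<beta>"
    and r: "\<forall>j\<in>indices J. \<forall>x\<in>cell J j. \<bar>f x - \<theta> j\<bar> \<le> r j"
  let ?X = "Xs \<omega>"
  let ?Y = "Ys f \<omega>"
  let ?m = "post_mean J \<zeta> lam n ?X ?Y"
  let ?p = "cell_prob J"
  let ?s = "sigma2_hat J \<zeta> lam n ?X ?Y"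
  let ?V = "V1 J lam n ?X / t\<^sup>2"
  have s: "0 \<le> ?s" by (rule sigma2_hat_bounds(1)[OF J])
  have r0: "0 \<le> r j" if "j \<in> indices J" for j
    using r that upper_in_cell[OF that J] by (meson abs_ge_zero order_trans)
  have bias: "(\<Sum>i<n. indicator (cell J j) (X i \<omega>) * \<bar>f (X i \<omega>) - \<theta> j\<bar>) / post_prec J lam n ?X j \<le> r j" if j: "j \<in> indices J" for j
  proof -
    have p: "0 < post_prec J lam n ?X j" using post_prec_pos[of lam j] prior_boundedD(5)[OF prior j] by simp
    have "(\<Sum>i<n. indicator (cell J j) (X i \<omega>) * \<bar>f (X i \<omega>) - \<theta> j\<bar>) \<le> (\<Sum>i<n. indicator (cell J j) (X i \<omega>) * r j)"
      using r j by (intro sum_mono) (auto simp: indicator_def)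
    also have "\<dots> = r j * cell_count J n ?X j" by (simp add: cell_count_eq sum_distrib_left mult.commute)
    also have "\<dots> \<le> r j * post_prec J lam n ?X j"
      using r0[OF j] by (intro mult_left_mono) (auto simp: post_prec_def)
    finally show ?thesis using p by (simp add: field_simps)
  qed
  have "(\<Sum>j\<in>indices J. ?p j * \<bar>?m j - \<theta> j\<bar>)
      \<le> (\<Sum>j\<in>indices J. ?p j * ((\<Sum>i<n. indicator (cell J j) (X i \<omega>) * \<bar>f (X i \<omega>) - \<theta> j\<bar>) / post_prec J lam n ?X j))
        + noise_L1 J lam n \<omega> + (B + \<beta>) / a * V1 J lam n ?X"
    using \<theta> by (intro post_mean_L1_deviation[OF prior]) auto
  also have "(\<Sum>j\<in>indices J. ?p j * ((\<Sum>i<n. indicator (cell J j) (X i \<omega>) * \<bar>f (X i \<omega>) - \<theta> j\<bar>) / post_prec J lam n ?X j))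
      \<le> (\<Sum>j\<in>indices J. ?p j * r j)"
    by (intro sum_mono mult_left_mono bias) auto
  finally have dev: "(\<Sum>j\<in>indices J. ?p j * \<bar>?m j - \<theta> j\<bar>) \<le> (\<Sum>j\<in>indices J. ?p j * r j) + t"
    using 1 2 by linarith
  have far: "t \<le> (\<Sum>j\<in>indices J. ?p j * \<bar>\<theta>' j - ?m j\<bar>)"
    if "(\<Sum>j\<in>indices J. ?p j * r j) + 2 * t \<le> (\<Sum>j\<in>indices J. ?p j * \<bar>\<theta>' j - \<theta> j\<bar>)" for \<theta>'
  proof -
    have "(\<Sum>j\<in>indices J. ?p j * \<bar>\<theta>' j - \<theta> j\<bar>) \<le> (\<Sum>j\<in>indices J. ?p j * \<bar>\<theta>' j - ?m j\<bar> + ?p j * \<bar>?m j - \<theta> j\<bar>)"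
      unfolding distrib_left[symmetric] by (intro sum_mono mult_left_mono) auto
    then show ?thesis using that dev by (simp add: sum.distrib)
  qed
  have "post_var S n ?s \<le> C * (1 + ?s)" by (rule C(2)[OF n s])
  also have "\<dots> \<le> C * (1 + (2 * (\<beta> + B)\<^sup>2 + 2 * mean_sq_noise n \<omega>))"
    using f n C(1) by (intro mult_left_mono add_left_mono sigma2_hat_le_bounded[OF prior J _ X]) auto
  also have "\<dots> = C * (1 + 2 * (\<beta> + B)\<^sup>2) + 2 * C * mean_sq_noise n \<omega>" by (simp add: algebra_simps)
  finally have "post_var S n ?s * V1 J lam n ?X \<le> (C * (1 + 2 * (\<beta> + B)\<^sup>2) + 2 * C * mean_sq_noise n \<omega>) * V1 J lam n ?X"
    by (intro mult_right_mono V1_nonneg)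
  then have "post_var S n ?s * V1 J lam n ?X < \<delta> * t\<^sup>2" using 3 by linarith
  then have small: "post_var S n ?s * ?V < \<delta>" using t by (simp add: field_simps)
  have V: "0 \<le> ?V" using V1_nonneg by (intro divide_nonneg_nonneg) auto
  have L1: "posterior_given J \<zeta> lam n ?X ?Y v A' \<le> v * ?V"
    if "0 \<le> v" "\<And>\<theta>'. step_fn J \<theta>' \<in> A' \<Longrightarrow> (\<Sum>j\<in>indices J. ?p j * r j) + 2 * t \<le> (\<Sum>j\<in>indices J. ?p j * \<bar>\<theta>' j - \<theta> j\<bar>)" for v A'
    unfolding V1_def using that(2) by (intro posterior_given_le_L1[OF J that(1) t _ sum_cell_prob_le[OF J]] far) auto
  show "((\<forall>\<theta>'. step_fn J \<theta>' \<in> A \<longrightarrow> (\<Sum>j\<in>indices J. ?p j * r j) + 2 * t \<le> (\<Sum>j\<in>indices J. ?p j * \<bar>\<theta>' j - \<theta> j\<bar>))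
         \<longrightarrow> posterior S J \<zeta> lam n ?X ?Y A < \<delta>) \<and>
      ({\<theta>' \<in> space (\<Pi>\<^sub>M j\<in>indices J. borel). step_fn J \<theta>' \<in> A} \<in> sets (\<Pi>\<^sub>M j\<in>indices J. borel) \<longrightarrow>
       (\<forall>\<theta>'. step_fn J \<theta>' \<notin> A \<longrightarrow> (\<Sum>j\<in>indices J. ?p j * r j) + 2 * t \<le> (\<Sum>j\<in>indices J. ?p j * \<bar>\<theta>' j - \<theta> j\<bar>))
         \<longrightarrow> 1 - \<delta> < posterior S J \<zeta> lam n ?X ?Y A)"
  proof (intro conjI impI)
    assume "\<forall>\<theta>'. step_fn J \<theta>' \<in> A \<longrightarrow> (\<Sum>j\<in>indices J. ?p j * r j) + 2 * t \<le> (\<Sum>j\<in>indices J. ?p j * \<bar>\<theta>' j - \<theta> j\<bar>)"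
    then have "posterior S J \<zeta> lam n ?X ?Y A \<le> post_var S n ?s * ?V"
      by (intro posterior_le[OF S J n V] L1) auto
    then show "posterior S J \<zeta> lam n ?X ?Y A < \<delta>" using small by linarith
  next
    assume A: "{\<theta>' \<in> space (\<Pi>\<^sub>M j\<in>indices J. borel). step_fn J \<theta>' \<in> A} \<in> sets (\<Pi>\<^sub>M j\<in>indices J. borel)"
      and "\<forall>\<theta>'. step_fn J \<theta>' \<notin> A \<longrightarrow> (\<Sum>j\<in>indices J. ?p j * r j) + 2 * t \<le> (\<Sum>j\<in>indices J. ?p j * \<bar>\<theta>' j - \<theta> j\<bar>)"
    then have "1 - post_var S n ?s * ?V \<le> posterior S J \<zeta> lam n ?X ?Y A"
      by (intro posterior_ge[OF S J n A] L1) auto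
    then show "1 - \<delta> < posterior S J \<zeta> lam n ?X ?Y A" using small by linarith
  qed
qed

lemma Markov_le:
  assumes "integrable P f" "\<And>\<omega>. 0 \<le> f \<omega>" "0 < c" "expectation f \<le> e"
  shows "prob {\<omega> \<in> space P. c \<le> f \<omega>} \<le> e / c"
proof -
  have "prob {\<omega> \<in> space P. c \<le> f \<omega>} \<le> expectation f / c"
    using assms(1-3) by (intro integral_Markov_inequality_measure[of _ _ "space P"]) auto
  also have "\<dots> \<le> e / c" using assms(3,4) by (intro divide_right_mono) auto
  finally show ?thesis .
qed

text \<open>Three failures are excluded: large noise by Chebyshev, large prior pull and large
  posterior spread by Markov. All have probability of order J to the power d over n, times a power
  of 1/t. The constant \<open>K\<close> precedes the quantifiers over n, J, the hyperparameters and
  t, so t may later vary with n.\<close>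

lemma good_data_event:
  assumes S: "valid_treatment S" and cube: "AE x in G. x \<in> {0..1}" and \<delta>: "0 < \<delta>" and \<beta>: "0 \<le> \<beta>" and ab: "0 < a" "0 \<le> B" "1 \<le> b"
  shows "\<exists>K>0. \<forall>(n :: nat) J \<zeta> (lam :: ('d \<Rightarrow> nat) \<Rightarrow> real) t. prior_bounded B a b J \<zeta> lam \<longrightarrow> 0 < J \<longrightarrow> 4 \<le> n \<longrightarrow> 0 < t \<longrightarrow>
    (\<exists>E\<in>events. prob E \<le> K * (real J ^ CARD('d) / real n) * (1 / t + 1 / t\<^sup>2) \<and>
      (AE \<omega> in P. \<omega> \<notin> E \<longrightarrow> good_data S \<beta> t \<delta> J \<zeta> lam n \<omega>))"
proof -
  obtain C where C: "0 < C" "\<And>n s. 4 \<le> n \<Longrightarrow> 0 \<le> s \<Longrightarrow> post_var S n s \<le> C * (1 + s)"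
    using post_var_le[OF S] by metis
  define c1 where "c1 = C * (1 + 2 * (\<beta> + B)\<^sup>2)"
  define c2 where "c2 = 2 * C"
  have c: "0 \<le> c1" "0 \<le> c2" using C(1) by (auto simp: c1_def c2_def)
  define K where "K = 1 + 4 * \<sigma>0\<^sup>2 * b + 2 * ((B + \<beta>) / a) * b + (c1 + c2 * \<sigma>0\<^sup>2) * b / \<delta>"
  have K: "0 < K" using ab \<beta> c \<delta> unfolding K_def
    by (intro add_pos_nonneg mult_nonneg_nonneg divide_nonneg_nonneg add_nonneg_nonneg) auto
  show ?thesis
  proof (intro exI[of _ K] conjI K allI impI)
    fix n J :: nat and \<zeta> lam :: "('d \<Rightarrow> nat) \<Rightarrow> real" and t :: real
    assume prior: "prior_bounded B a b J \<zeta> lam" and J: "0 < J" and n: "4 \<le> n" and t: "0 < t"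
    have n0: "0 < n" using n by simp
    define q where "q = real J ^ CARD('d) / real n"
    have q: "0 \<le> q" by (simp add: q_def)
    define E1 where "E1 = {\<omega> \<in> space P. t / 2 \<le> noise_L1 J lam n \<omega>}"
    define E2 where "E2 = {\<omega> \<in> space P. t / 2 \<le> (B + \<beta>) / a * V1 J lam n (Xs \<omega>)}"
    define E3 where "E3 = {\<omega> \<in> space P. \<delta> * t\<^sup>2 \<le> (c1 + c2 * mean_sq_noise n \<omega>) * V1 J lam n (Xs \<omega>)}"
    have [measurable]: "(\<lambda>\<omega>. V1 J lam n (Xs \<omega>)) \<in> borel_measurable P"
      by (rule measurable_compose[OF X_process_measurable V1_measurable])
    have Em: "E1 \<in> events" "E2 \<in> events" "E3 \<in> events" unfolding E1_def E2_def E3_def by measurable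
    have "prob E1 \<le> \<sigma>0\<^sup>2 * b * q / (t / 2)\<^sup>2"
      unfolding E1_def q_def using t by (intro noise_L1_tail[OF prior n0 J]) auto
    then have P1: "prob E1 \<le> (4 * \<sigma>0\<^sup>2 * b) * q * (1 / t\<^sup>2)" by (simp add: power_divide ac_simps)
    have "prob E2 \<le> ((B + \<beta>) / a * (b * q)) / (t / 2)"
      unfolding E2_def q_def
    proof (rule Markov_le)
      show "integrable P (\<lambda>\<omega>. (B + \<beta>) / a * V1 J lam n (Xs \<omega>))"
        by (intro integrable_mult_right expectation_V1(1)[OF prior n0])
      show "expectation (\<lambda>\<omega>. (B + \<beta>) / a * V1 J lam n (Xs \<omega>)) \<le> (B + \<beta>) / a * (b * (real J ^ CARD('d) / real n))"
        unfolding integral_mult_right_zero using ab \<beta> by (intro mult_left_mono expectation_V1(2)[OF prior n0]) auto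
    qed (use t ab \<beta> V1_nonneg in auto)
    then have P2: "prob E2 \<le> (2 * ((B + \<beta>) / a) * b) * q * (1 / t)" by (simp add: field_simps)
    note e3 = expectation_affine_noise[OF V1_measurable expectation_V1[OF prior n0] n0 c]
    have "prob E3 \<le> ((c1 + c2 * \<sigma>0\<^sup>2) * (b * q)) / (\<delta> * t\<^sup>2)"
      unfolding E3_def q_def
      by (rule Markov_le[OF e3(1) _ _ e3(2)])
        (use t \<delta> c mean_sq_noise_nonneg V1_nonneg in \<open>auto intro!: mult_nonneg_nonneg add_nonneg_nonneg\<close>)
    then have P3: "prob E3 \<le> ((c1 + c2 * \<sigma>0\<^sup>2) * b / \<delta>) * q * (1 / t\<^sup>2)" by simp
    have le: "x * q * y \<le> x * q * (1 / t + 1 / t\<^sup>2)" if "0 \<le> x" "y \<le> 1 / t + 1 / t\<^sup>2" for x y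
      using that q by (intro mult_left_mono) auto
    have "prob (E1 \<union> E2 \<union> E3) \<le> prob E1 + prob E2 + prob E3"
      using measure_Un_le[OF sets.Un[OF Em(1,2)] Em(3)] measure_Un_le[OF Em(1,2)] by linarith
    also have "\<dots> \<le> (4 * \<sigma>0\<^sup>2 * b) * q * (1 / t + 1 / t\<^sup>2) + (2 * ((B + \<beta>) / a) * b) * q * (1 / t + 1 / t\<^sup>2)
        + ((c1 + c2 * \<sigma>0\<^sup>2) * b / \<delta>) * q * (1 / t + 1 / t\<^sup>2)"
      using ab \<beta> c \<delta> t by (intro add_mono order_trans[OF P1 le] order_trans[OF P2 le] order_trans[OF P3 le]) auto
    also have "\<dots> = (K - 1) * q * (1 / t + 1 / t\<^sup>2)" by (simp add: K_def algebra_simps)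
    also have "\<dots> \<le> K * q * (1 / t + 1 / t\<^sup>2)" using q t by (intro mult_right_mono) auto
    finally have "prob (E1 \<union> E2 \<union> E3) \<le> K * (real J ^ CARD('d) / real n) * (1 / t + 1 / t\<^sup>2)" by (simp add: q_def)
    moreover have "AE \<omega> in P. \<omega> \<notin> E1 \<union> E2 \<union> E3 \<longrightarrow> good_data S \<beta> t \<delta> J \<zeta> lam n \<omega>"
    proof -
      have "AE \<omega> in P. \<forall>i. X i \<omega> \<in> {0..1}" unfolding AE_all_countable using AE_X[OF cube] by blast
      then show ?thesis using AE_space
      proof eventually_elim
        fix \<omega> assume X: "\<forall>i. X i \<omega> \<in> {0..1}" and sp: "\<omega> \<in> space P"
        show "\<omega> \<notin> E1 \<union> E2 \<union> E3 \<longrightarrow> good_data S \<beta> t \<delta> J \<zeta> lam n \<omega>"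
        proof
          assume "\<omega> \<notin> E1 \<union> E2 \<union> E3"
          then have "noise_L1 J lam n \<omega> < t / 2" "(B + \<beta>) / a * V1 J lam n (Xs \<omega>) < t / 2"
            "(c1 + c2 * mean_sq_noise n \<omega>) * V1 J lam n (Xs \<omega>) < \<delta> * t\<^sup>2"
            using sp by (auto simp: E1_def E2_def E3_def not_le)
          then show "good_data S \<beta> t \<delta> J \<zeta> lam n \<omega>"
            using X unfolding c1_def c2_def by (intro good_dataI[OF S prior J n t \<beta> C]) auto
        qed
      qed
    qed
    ultimately show "\<exists>E\<in>events. prob E \<le> K * (real J ^ CARD('d) / real n) * (1 / t + 1 / t\<^sup>2) \<and>
      (AE \<omega> in P. \<omega> \<notin> E \<longrightarrow> good_data S \<beta> t \<delta> J \<zeta> lam n \<omega>)"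
      using Em by (intro bexI[of _ "E1 \<union> E2 \<union> E3"]) auto
  qed
qed

end

section \<open>Level of the test\<close>

lemma holder_classD:
  assumes "f \<in> holder_class \<alpha> L" "0 \<le> L"
  shows "x \<in> {0..1} \<Longrightarrow> \<bar>f x\<bar> \<le> L"
    and "x \<in> {0..1} \<Longrightarrow> y \<in> {0..1} \<Longrightarrow> \<bar>f x - f y\<bar> \<le> L * norm (x - y) powr \<alpha>"
proof -
  let ?A = "SUP x\<in>{0..1}. ennreal \<bar>f x\<bar>"
  let ?D = "{(x, y). x \<in> {0..1} \<and> y \<in> {0..1} \<and> x \<noteq> y}"
  let ?B = "SUP (x, y)\<in>?D. ennreal (\<bar>f x - f y\<bar> / norm (x - y) powr \<alpha>)"
  have AB: "?A + ?B \<le> ennreal L" using assms(1) by (simp add: holder_class_def)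
  show "\<bar>f x\<bar> \<le> L" if "x \<in> {0..1}"
  proof -
    have "ennreal \<bar>f x\<bar> \<le> ?A" using that by (rule SUP_upper)
    also have "\<dots> \<le> ?A + ?B" by simp
    finally show ?thesis using AB assms(2) by (auto dest: order_trans)
  qed
  show "\<bar>f x - f y\<bar> \<le> L * norm (x - y) powr \<alpha>" if "x \<in> {0..1}" "y \<in> {0..1}"
  proof (cases "x = y")
    case False
    then have "(x, y) \<in> ?D" using that by auto
    then have "(case (x, y) of (x, y) \<Rightarrow> ennreal (\<bar>f x - f y\<bar> / norm (x - y) powr \<alpha>)) \<le> ?B" by (rule SUP_upper)
    then have "ennreal (\<bar>f x - f y\<bar> / norm (x - y) powr \<alpha>) \<le> ?B" by simp
    also have "\<dots> \<le> ?A + ?B" by simp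
    finally have "ennreal (\<bar>f x - f y\<bar> / norm (x - y) powr \<alpha>) \<le> ennreal L" using AB by (rule order_trans)
    then have "\<bar>f x - f y\<bar> / norm (x - y) powr \<alpha> \<le> L" using assms(2) by simp
    moreover have "0 < norm (x - y) powr \<alpha>" using False by simp
    ultimately show ?thesis by (simp add: field_simps)
  qed (use assms(2) in auto)
qed

lemma L1_setdist_nearD:
  assumes "L1_setdist G f A < s" "A \<noteq> {}"
  obtains h where "h \<in> A" "L1_dist G f h < s"
proof -
  have "bdd_below (L1_dist G f ` A)" by (auto intro!: bdd_belowI[of _ 0] L1_dist_nonneg)
  then show ?thesis
    using assms that unfolding L1_setdist_def by (subst (asm) cINF_less_iff) auto
qed

lemma nonneg_tendsto_0:
  fixes u v :: "nat \<Rightarrow> real"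
  assumes "\<And>n. 0 \<le> u n" "eventually (\<lambda>n. u n \<le> v n) sequentially" "v \<longlonglongrightarrow> 0"
  shows "u \<longlonglongrightarrow> 0"
  using assms by (intro tendsto_sandwich[of "\<lambda>_. 0" u sequentially v 0]) auto

lemma corners_in_cube:
  assumes "j \<in> indices J" "0 < J"
  shows "upper J j \<in> {0..1}" "lower J j \<in> {0..1}"
proof -
  have "1 \<le> real (j k)" "real (j k) \<le> real J" for k using indicesD[OF assms(1), of k] by auto
  then have "0 \<le> real (j k) - 1" "real (j k) - 1 \<le> real J" for k
    by (auto intro: order_trans[of _ "real (j k)"])
  then show "upper J j \<in> {0..1}" "lower J j \<in> {0..1}"
    using assms(2) indicesD[OF assms(1)] by (auto simp: upper_def lower_def less_eq_vec_def divide_le_eq)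
qed

locale monotonicity_setting = random_design P G X eps \<sigma>0
  for P :: "'w measure" and G :: "(real ^ 'd) measure" and X eps \<sigma>0 +
  fixes g :: "real ^ 'd \<Rightarrow> real" and J :: "nat \<Rightarrow> nat" and \<zeta> lam :: "nat \<Rightarrow> ('d \<Rightarrow> nat) \<Rightarrow> real"
    and M :: "nat \<Rightarrow> real" and \<gamma> :: real and S :: sigma_treatment and B a b Bg :: real
  assumes density: "g \<in> borel_measurable borel" "\<And>x. g x \<le> Bg" "0 \<le> Bg" "G = density lborel (\<lambda>x. ennreal (g x))"
    and cube: "AE x in G. x \<in> {0..1}"
    and prior: "\<And>n. prior_bounded B a b (J n) (\<zeta> n) (lam n)"
    and ab: "0 < a" "0 \<le> B" "1 \<le> b"
    and S: "valid_treatment S" and \<gamma>: "0 < \<gamma>" "\<gamma> < 1"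
    and M: "filterlim M at_top sequentially"
    and J: "\<And>n. 0 < J n" "(\<lambda>n. real (J n)) \<in> \<Theta>(\<lambda>n. real n powr (1 / (2 + real CARD('d))))"
begin

definition rate :: "nat \<Rightarrow> real" where
  "rate n = real n powr (- 1 / (real CARD('d) + 2))"

abbreviation nbhd :: "nat \<Rightarrow> (real ^ 'd \<Rightarrow> real) set" where
  "nbhd n \<equiv> {f. L1_setdist G f (monotone_step_fns (J n)) \<le> M n * rate n}"

abbreviation test :: "nat \<Rightarrow> (nat \<Rightarrow> real ^ 'd) \<Rightarrow> (nat \<Rightarrow> real) \<Rightarrow> real" where
  "test n \<equiv> monotonicity_test G S \<gamma> (M n * rate n) (J n) (\<zeta> n) (lam n) n"

abbreviation acceptance :: "nat \<Rightarrow> (real ^ 'd \<Rightarrow> real) \<Rightarrow> real" where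
  "acceptance n f \<equiv> true_expectation P X eps f (\<lambda>xs ys. 1 - test n xs ys)"

lemma rate_tendsto: "rate \<longlonglongrightarrow> 0"
  unfolding rate_def by (rule tendsto_neg_powr) (auto intro: filterlim_real_sequentially)

lemma rate_pos: "0 < n \<Longrightarrow> 0 < rate n"
  by (simp add: rate_def)

text \<open>The chosen order of \<open>J\<close> balances the squared stochastic error, J to the
  power d over n, against the bias 1/J: both are expressed through \<open>rate\<close>.\<close>

lemma rates:
  obtains K where "0 < K" "eventually (\<lambda>n. real (J n) ^ CARD('d) / real n \<le> K * (rate n)\<^sup>2) sequentially"
    "eventually (\<lambda>n. 1 / real (J n) \<le> K * rate n) sequentially"
proof -
  let ?e = "\<lambda>n. real n powr (1 / (2 + real CARD('d)))"
  have "(\<lambda>n. real (J n)) \<in> O(?e)" using J(2) by (rule bigthetaD1)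
  then obtain c where c: "0 < c" "eventually (\<lambda>n. norm (real (J n)) \<le> c * norm (?e n)) sequentially"
    by (rule landau_o.bigE)
  have "?e \<in> O(\<lambda>n. real (J n))" using bigthetaD2[OF J(2)] by (simp add: bigomega_iff_bigo)
  then obtain c' where c': "0 < c'" "eventually (\<lambda>n. norm (?e n) \<le> c' * norm (real (J n))) sequentially"
    by (rule landau_o.bigE)
  have e: "?e n = 1 / rate n" for n
    by (simp add: rate_def powr_minus_divide add.commute)
  show ?thesis
  proof (rule that[of "c ^ CARD('d) + c'"])
    show "0 < c ^ CARD('d) + c'" using c(1) c'(1) by (simp add: add_pos_pos)
    show "eventually (\<lambda>n. real (J n) ^ CARD('d) / real n \<le> (c ^ CARD('d) + c') * (rate n)\<^sup>2) sequentially"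
      using c(2) eventually_gt_at_top[of 0]
    proof eventually_elim
      fix n :: nat assume h: "norm (real (J n)) \<le> c * norm (?e n)" and n: "0 < n"
      have "real (J n) ^ CARD('d) \<le> (c * ?e n) ^ CARD('d)" using h by (intro power_mono) auto
      also have "\<dots> = c ^ CARD('d) * real n powr (real CARD('d) / (2 + real CARD('d)))"
        using n by (simp add: power_mult_distrib powr_power)
      finally have "real (J n) ^ CARD('d) / real n \<le> c ^ CARD('d) * real n powr (real CARD('d) / (2 + real CARD('d))) / real n"
        by (rule divide_right_mono) simp
      also have "\<dots> = c ^ CARD('d) * (real n powr (real CARD('d) / (2 + real CARD('d))) * real n powr (- 1))"
        using n by (simp add: powr_minus divide_inverse)
      also have "real n powr (real CARD('d) / (2 + real CARD('d))) * real n powr (- 1) = (rate n)\<^sup>2"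
      proof -
        \<comment> \<open>The exponent d/(d+2) - 1 equals -2/(d+2), twice the exponent of
          \<open>rate\<close>.\<close>
        have "real CARD('d) / (2 + real CARD('d)) + - 1 = (- 1 / (real CARD('d) + 2)) + (- 1 / (real CARD('d) + 2))"
          by (simp add: field_simps)
        then show ?thesis unfolding power2_eq_square rate_def powr_add[symmetric] by simp
      qed
      also have "c ^ CARD('d) * (rate n)\<^sup>2 \<le> (c ^ CARD('d) + c') * (rate n)\<^sup>2"
        using c'(1) by (intro mult_right_mono) auto
      finally show "real (J n) ^ CARD('d) / real n \<le> (c ^ CARD('d) + c') * (rate n)\<^sup>2" .
    qed
    show "eventually (\<lambda>n. 1 / real (J n) \<le> (c ^ CARD('d) + c') * rate n) sequentially"
      using c'(2) eventually_gt_at_top[of 0]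
    proof eventually_elim
      fix n :: nat assume h: "norm (?e n) \<le> c' * norm (real (J n))" and n: "0 < n"
      have "1 / rate n \<le> c' * real (J n)" using h rate_pos[OF n] by (simp add: e)
      then have "1 / real (J n) \<le> c' * rate n"
        using rate_pos[OF n] J(1)[of n] by (simp add: field_simps)
      also have "\<dots> \<le> (c ^ CARD('d) + c') * rate n"
        using c(1) rate_pos[OF n] by (intro mult_right_mono) auto
      finally show "1 / real (J n) \<le> (c ^ CARD('d) + c') * rate n" .
    qed
  qed
qed

lemma cell_prob_L1_dist:
  "L1_dist G (step_fn (J n) \<theta>) (step_fn (J n) \<theta>') = (\<Sum>j\<in>indices (J n). cell_prob (J n) j * \<bar>\<theta> j - \<theta>' j\<bar>)"
proof -
  interpret G: prob_space G by (rule prob_space_G)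
  show ?thesis by (rule L1_dist_step_fn[OF _ sets_G J(1)]) unfold_locales
qed

lemma nbhd_measurable:
  "{\<theta> \<in> space (\<Pi>\<^sub>M j\<in>indices (J n). borel). step_fn (J n) \<theta> \<in> nbhd n} \<in> sets (\<Pi>\<^sub>M j\<in>indices (J n). borel)"
  using L1_setdist_monotone_step_fns_measurable[OF prob_space_G sets_G J(1)[of n]] by simp

lemma test_bounds: "0 \<le> test n xs ys" "test n xs ys \<le> 1"
  by (auto simp: monotonicity_test_def)

lemma true_expectation_nonneg: "0 \<le> true_expectation P X eps f (test n)"
    "0 \<le> acceptance n f"
  unfolding true_expectation_def using test_bounds by (auto intro!: integral_nonneg_AE)

text \<open>This is the bound of \<open>good_data_event\<close> with t a diverging multiple of
  \<open>rate\<close>. The squared rate cancels against 1/t squared, leaving the inverse square of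
  \<open>u\<close>; the 1/t term even keeps one factor \<open>rate\<close>.\<close>

lemma rate_bound_tendsto:
  assumes u: "filterlim u at_top sequentially" and "0 < c"
  shows "(\<lambda>n. K * (rate n)\<^sup>2 * (1 / (c * u n * rate n) + 1 / (c * u n * rate n)\<^sup>2)) \<longlonglongrightarrow> 0"
proof -
  have "(\<lambda>n. inverse (u n)) \<longlonglongrightarrow> 0" using u by (rule tendsto_inverse_0_at_top)
  then have "(\<lambda>n. K / c * rate n * inverse (u n) + K / c\<^sup>2 * (inverse (u n))\<^sup>2) \<longlonglongrightarrow> K / c * 0 * 0 + K / c\<^sup>2 * 0\<^sup>2"
    by (intro tendsto_intros rate_tendsto)
  then have lim: "(\<lambda>n. K / c * rate n * inverse (u n) + K / c\<^sup>2 * (inverse (u n))\<^sup>2) \<longlonglongrightarrow> 0" by simp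
  have "eventually (\<lambda>n. K / c * rate n * inverse (u n) + K / c\<^sup>2 * (inverse (u n))\<^sup>2
      = K * (rate n)\<^sup>2 * (1 / (c * u n * rate n) + 1 / (c * u n * rate n)\<^sup>2)) sequentially"
    using eventually_gt_at_top[of 0] filterlim_at_top_dense[THEN iffD1, OF u, rule_format, of 0]
  proof eventually_elim
    fix n :: nat assume "0 < n" "0 < u n"
    then show "K / c * rate n * inverse (u n) + K / c\<^sup>2 * (inverse (u n))\<^sup>2
      = K * (rate n)\<^sup>2 * (1 / (c * u n * rate n) + 1 / (c * u n * rate n)\<^sup>2)"
      using rate_pos[of n] \<open>0 < c\<close> by (simp add: field_simps power2_eq_square)
  qed
  from Lim_transform_eventually[OF lim this] show ?thesis .
qed

lemma monotone_bias_le: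
  assumes f: "f \<in> monotone_fns"
  shows "(\<Sum>j\<in>indices (J n). cell_prob (J n) j * (f (upper (J n) j) - f (lower (J n) j)))
    \<le> Bg * real CARD('d) * (f 1 - f 0) * (1 / real (J n))"
proof -
  let ?J = "J n"
  have "(\<Sum>j\<in>indices ?J. cell_prob ?J j * (f (upper ?J j) - f (lower ?J j)))
      \<le> (\<Sum>j\<in>indices ?J. (Bg * (1 / real ?J) ^ CARD('d)) * (f (upper ?J j) - f (lower ?J j)))"
  proof (intro sum_mono mult_right_mono measure_cell_le[OF density(1-4) J(1)])
    fix j :: "'d \<Rightarrow> nat" assume j: "j \<in> indices ?J"
    note ul = corners_in_cube[OF j J(1)]
    have "lower ?J j \<le> upper ?J j" using cell_bounds[OF upper_in_cell[OF j J(1)]] by blast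
    then have "f (lower ?J j) \<le> f (upper ?J j)" using f ul by (auto simp: monotone_fns_def intro: mono_onD)
    then show "0 \<le> f (upper ?J j) - f (lower ?J j)" by simp
  qed
  also have "\<dots> = Bg * (1 / real ?J) ^ CARD('d) * (\<Sum>j\<in>indices ?J. f (upper ?J j) - f (lower ?J j))"
    by (simp only: sum_distrib_left)
  also have "\<dots> \<le> Bg * (1 / real ?J) ^ CARD('d) * (real ?J ^ CARD('d) * (real CARD('d) / real ?J) * (f 1 - f 0))"
    using density(3) by (intro mult_left_mono sum_diagonal_increments_le f J) auto
  also have "\<dots> = Bg * real CARD('d) * (f 1 - f 0) * (1 / real ?J)"
    using J(1)[of n] by (simp add: power_divide)
  finally show ?thesis .
qed

text \<open>The values of \<open>f\<close> at the upper corners form a monotone coefficient vector.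
  A step function outside the neighbourhood is therefore farther than the radius from it, and such
  functions receive little posterior mass.\<close>

theorem test_level:
  assumes f: "f \<in> monotone_fns"
  shows "(\<lambda>n. true_expectation P X eps f (test n)) \<longlonglongrightarrow> 0"
proof -
  define \<beta> where "\<beta> = \<bar>f 0\<bar> + \<bar>f 1\<bar>"
  have f01: "f 0 \<le> f x" "f x \<le> f 1" if "x \<in> {0..1}" for x
    using f that by (auto simp: monotone_fns_def less_eq_vec_def intro!: mono_onD[of "{0..1}" f])
  have fb: "\<bar>f x\<bar> \<le> \<beta>" if "x \<in> {0..1}" for x using f01[OF that] by (auto simp: \<beta>_def)
  have \<beta>: "0 \<le> \<beta>" by (simp add: \<beta>_def)
  \<comment> \<open>With \<open>\<delta> = 1 - \<gamma>\<close> the lower bound 1 - \<delta> on the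
    posterior mass is exactly the threshold of the test.\<close>
  have \<gamma>1: "0 < 1 - \<gamma>" using \<gamma> by simp
  obtain K where K: "0 < K" "\<forall>n J \<zeta> lam t. prior_bounded B a b J \<zeta> lam \<longrightarrow> 0 < J \<longrightarrow> 4 \<le> n \<longrightarrow> 0 < t \<longrightarrow>
    (\<exists>E\<in>events. prob E \<le> K * (real J ^ CARD('d) / real n) * (1 / t + 1 / t\<^sup>2) \<and>
      (AE \<omega> in P. \<omega> \<notin> E \<longrightarrow> good_data S \<beta> t (1 - \<gamma>) J \<zeta> lam n \<omega>))"
    using good_data_event[OF S cube \<gamma>1 \<beta> ab] by (elim exE conjE) (rule that)
  obtain K' where K': "0 < K'" "eventually (\<lambda>n. real (J n) ^ CARD('d) / real n \<le> K' * (rate n)\<^sup>2) sequentially"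
    "eventually (\<lambda>n. 1 / real (J n) \<le> K' * rate n) sequentially" by (rule rates)
  define c where "c = Bg * real CARD('d) * (f 1 - f 0)"
  have "f 0 \<le> f 1" by (rule f01(1)) (simp add: less_eq_vec_def)
  then have c0: "0 \<le> c" unfolding c_def using density(3) by simp
  let ?bound = "\<lambda>n. K * K' * (rate n)\<^sup>2 * (1 / (1 / 4 * M n * rate n) + 1 / (1 / 4 * M n * rate n)\<^sup>2)"
  have "eventually (\<lambda>n. true_expectation P X eps f (test n) \<le> ?bound n) sequentially"
    using K'(2,3) eventually_ge_at_top[of 4] filterlim_at_top[THEN iffD1, OF M, rule_format, of "2 * c * K'"]
      filterlim_at_top_dense[THEN iffD1, OF M, rule_format, of 0]
  proof eventually_elim
    fix n :: nat
    assume Jn: "real (J n) ^ CARD('d) / real n \<le> K' * (rate n)\<^sup>2" "1 / real (J n) \<le> K' * rate n"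
      and n: "4 \<le> n" and Mn: "2 * c * K' \<le> M n" "0 < M n"
    let ?J = "J n"
    \<comment> \<open>Half of the radius is spent on 2t; the other half covers the bias once
      \<open>M n\<close> is large enough.\<close>
    define t where "t = 1 / 4 * M n * rate n"
    have rn: "0 < rate n" using n by (intro rate_pos) simp
    have t: "0 < t" using Mn rn by (simp add: t_def)
    obtain E where E: "E \<in> events" "prob E \<le> K * (real ?J ^ CARD('d) / real n) * (1 / t + 1 / t\<^sup>2)"
      "AE \<omega> in P. \<omega> \<notin> E \<longrightarrow> good_data S \<beta> t (1 - \<gamma>) ?J (\<zeta> n) (lam n) n \<omega>"
      using K(2)[rule_format, OF prior J(1) n t, of n] by blast
    define \<theta> where "\<theta> = (\<lambda>j. f (upper ?J j))"
    define r where "r = (\<lambda>j. f (upper ?J j) - f (lower ?J j))"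
    have up: "upper ?J j \<in> {0..1}" if "j \<in> indices ?J" for j
      by (rule corners_in_cube[OF that J(1)])
    have lo: "lower ?J j \<in> {0..1}" if j: "j \<in> indices ?J" for j
      by (rule corners_in_cube[OF that J(1)])
    have osc: "\<bar>f x - \<theta> j\<bar> \<le> r j" if j: "j \<in> indices ?J" and x: "x \<in> cell ?J j" for j x
    proof -
      have x1: "x \<in> {0..1}" using x cell_subset_cube[OF j] by blast
      have "f (lower ?J j) \<le> f x" "f x \<le> f (upper ?J j)"
        using f cell_bounds[OF x] x1 lo[OF j] up[OF j] by (auto simp: monotone_fns_def intro: mono_onD)
      then show ?thesis by (simp add: \<theta>_def r_def)
    qed
    have \<theta>b: "\<bar>\<theta> j\<bar> \<le> \<beta>" if "j \<in> indices ?J" for j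
      unfolding \<theta>_def by (rule fb[OF up[OF that]])
    have "\<theta> \<in> monotone_coefs ?J"
      unfolding monotone_coefs_def \<theta>_def
    proof safe
      fix i j :: "'d \<Rightarrow> nat" assume ij: "i \<in> indices ?J" "j \<in> indices ?J" "i \<le> j"
      have "upper ?J i \<le> upper ?J j"
        using ij(3) by (simp add: upper_def less_eq_vec_def le_fun_def divide_right_mono)
      then show "f (upper ?J i) \<le> f (upper ?J j)"
        using f up[OF ij(1)] up[OF ij(2)] unfolding monotone_fns_def by (auto intro: mono_onD)
    qed
    then have step: "step_fn ?J \<theta> \<in> monotone_step_fns ?J" by (auto simp: monotone_step_fns_eq[OF J(1)])
    have "(\<Sum>j\<in>indices ?J. cell_prob ?J j * r j) \<le> c * (1 / real ?J)"
      unfolding r_def c_def by (rule monotone_bias_le[OF f])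
    also have "\<dots> \<le> c * (K' * rate n)" by (intro mult_left_mono Jn c0)
    also have "\<dots> \<le> 1 / 2 * M n * rate n"
      using mult_right_mono[OF Mn(1) less_imp_le[OF rn]] by simp
    finally have bias: "(\<Sum>j\<in>indices ?J. cell_prob ?J j * r j) + 2 * t \<le> M n * rate n" by (simp add: t_def)
    have far: "(\<Sum>j\<in>indices ?J. cell_prob ?J j * r j) + 2 * t \<le> (\<Sum>j\<in>indices ?J. cell_prob ?J j * \<bar>\<theta>' j - \<theta> j\<bar>)"
      if "step_fn ?J \<theta>' \<notin> nbhd n" for \<theta>'
      using that L1_setdist_le[OF step, of G "step_fn ?J \<theta>'"] bias by (simp add: cell_prob_L1_dist)
    have "true_expectation P X eps f (test n) \<le> prob E"
      unfolding true_expectation_def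
    proof (rule test_expectation_le[OF E(1)])
      show "AE \<omega> in P. test n (Xs \<omega>) (Ys f \<omega>) \<le> indicator E \<omega>"
        using E(3)
      proof eventually_elim
        fix \<omega> assume good: "\<omega> \<notin> E \<longrightarrow> good_data S \<beta> t (1 - \<gamma>) ?J (\<zeta> n) (lam n) n \<omega>"
        show "test n (Xs \<omega>) (Ys f \<omega>) \<le> indicator E \<omega>"
        proof (cases "\<omega> \<in> E")
          case False
          then have "good_data S \<beta> t (1 - \<gamma>) ?J (\<zeta> n) (lam n) n \<omega>" using good by simp
          note good_dataD(2)[where f = f, OF this fb \<theta>b osc nbhd_measurable far]
          then show ?thesis by (simp add: monotonicity_test_def)
        qed (simp add: test_bounds)
      qed
    qed
    also have "\<dots> \<le> K * (real ?J ^ CARD('d) / real n) * (1 / t + 1 / t\<^sup>2)" by (rule E(2))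
    also have "\<dots> \<le> K * (K' * (rate n)\<^sup>2) * (1 / t + 1 / t\<^sup>2)"
      using K(1) t Jn(1) by (intro mult_right_mono mult_left_mono) auto
    finally show "true_expectation P X eps f (test n) \<le> ?bound n" by (simp add: t_def mult.assoc)
  qed
  moreover have "?bound \<longlonglongrightarrow> 0" by (rule rate_bound_tendsto[OF M]) simp
  ultimately show ?thesis by (rule nonneg_tendsto_0[OF true_expectation_nonneg(1)])
qed

end

section \<open>Power over Hoelder classes\<close>

context monotonicity_setting
begin

text \<open>The separation pays for the oscillation twice, once for replacing \<open>f\<close> by
  its step function and once for the bias of the posterior mean, then for 2t and for the radius of
  the neighbourhood. The exceptional event does not depend on \<open>f\<close>, which gives the
  supremum.\<close>

lemma holder_power_bound:
  fixes \<alpha> L :: real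
  assumes \<alpha>: "0 < \<alpha>" and L: "0 < L"
  shows "\<exists>K>0. \<forall>n t \<tau>. 4 \<le> n \<longrightarrow> 0 < t \<longrightarrow>
      2 * (L * (real CARD('d) / real (J n)) powr \<alpha>) + 2 * t + M n * rate n \<le> \<tau> \<longrightarrow>
      (SUP f\<in>{f \<in> holder_class \<alpha> L. L1_setdist G f monotone_fns > \<tau>}.
         ennreal (acceptance n f))
      \<le> ennreal (K * (real (J n) ^ CARD('d) / real n) * (1 / t + 1 / t\<^sup>2))"
proof -
  have L0: "0 \<le> L" using L by simp
  obtain K where K: "0 < K" "\<forall>n J \<zeta> lam t. prior_bounded B a b J \<zeta> lam \<longrightarrow> 0 < J \<longrightarrow> 4 \<le> n \<longrightarrow> 0 < t \<longrightarrow>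
    (\<exists>E\<in>events. prob E \<le> K * (real J ^ CARD('d) / real n) * (1 / t + 1 / t\<^sup>2) \<and>
      (AE \<omega> in P. \<omega> \<notin> E \<longrightarrow> good_data S L t \<gamma> J \<zeta> lam n \<omega>))"
    using good_data_event[OF S cube \<gamma>(1) L0 ab] by (elim exE conjE) (rule that)
  show ?thesis
  proof (intro exI[of _ K] conjI K(1) allI impI)
    fix n :: nat and t \<tau> :: real
    assume n: "4 \<le> n" and t: "0 < t" and
      \<tau>: "2 * (L * (real CARD('d) / real (J n)) powr \<alpha>) + 2 * t + M n * rate n \<le> \<tau>"
    let ?J = "J n"
    define osc0 where "osc0 = L * (real CARD('d) / real ?J) powr \<alpha>"
    have osc0: "0 \<le> osc0" using L by (simp add: osc0_def)
    obtain E where E: "E \<in> events" "prob E \<le> K * (real ?J ^ CARD('d) / real n) * (1 / t + 1 / t\<^sup>2)"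
      "AE \<omega> in P. \<omega> \<notin> E \<longrightarrow> good_data S L t \<gamma> ?J (\<zeta> n) (lam n) n \<omega>"
      using K(2)[rule_format, OF prior J(1) n t, of n] by blast
    show "(SUP f\<in>{f \<in> holder_class \<alpha> L. L1_setdist G f monotone_fns > \<tau>}.
         ennreal (acceptance n f))
      \<le> ennreal (K * (real (J n) ^ CARD('d) / real n) * (1 / t + 1 / t\<^sup>2))"
    proof (rule SUP_least)
      fix f :: "real ^ 'd \<Rightarrow> real" assume "f \<in> {f \<in> holder_class \<alpha> L. L1_setdist G f monotone_fns > \<tau>}"
      then have hold: "f \<in> holder_class \<alpha> L" and dist: "\<tau> < L1_setdist G f monotone_fns" by auto
      note fb = holder_classD[OF hold L0]
      define \<theta> where "\<theta> = (\<lambda>j. f (upper ?J j))"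
      have \<theta>b: "\<bar>\<theta> j\<bar> \<le> L" if "j \<in> indices ?J" for j
        unfolding \<theta>_def by (rule fb(1)[OF corners_in_cube(1)[OF that J(1)]])
      have osc: "\<bar>f x - \<theta> j\<bar> \<le> osc0" if j: "j \<in> indices ?J" and x: "x \<in> cell ?J j" for j x
      proof -
        have x1: "x \<in> {0..1}" using x cell_subset_cube[OF j] by blast
        have "\<bar>f x - f (upper ?J j)\<bar> \<le> L * norm (x - upper ?J j) powr \<alpha>"
          by (rule fb(2)[OF x1 corners_in_cube(1)[OF j J(1)]])
        also have "\<dots> \<le> osc0" unfolding osc0_def
          using L \<alpha> by (intro mult_left_mono powr_mono2 cell_diameter[OF x upper_in_cell[OF j J(1)]]) auto
        finally show ?thesis by (simp add: \<theta>_def)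
      qed
      have bias: "(\<Sum>j\<in>indices ?J. cell_prob ?J j * osc0) \<le> osc0"
        using mult_right_mono[OF sum_cell_prob_le[OF J(1)] osc0, of n] by (simp add: sum_distrib_right)
      have far: "(\<Sum>j\<in>indices ?J. cell_prob ?J j * osc0) + 2 * t \<le> (\<Sum>j\<in>indices ?J. cell_prob ?J j * \<bar>\<theta>' j - \<theta> j\<bar>)"
        if nb: "step_fn ?J \<theta>' \<in> nbhd n" for \<theta>'
      proof -
        let ?d = "\<Sum>j\<in>indices ?J. cell_prob ?J j * \<bar>\<theta>' j - \<theta> j\<bar>"
        \<comment> \<open>The distance to the cone is an infimum, so a near-minimiser with slack e
          is used and e is removed afterwards.\<close>
        have "\<tau> \<le> osc0 + ?d + M n * rate n + e" if "0 < e" for e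
        proof -
          have "L1_setdist G (step_fn ?J \<theta>') (monotone_step_fns ?J) < M n * rate n + e" using nb that by simp
          moreover have "monotone_step_fns ?J \<noteq> ({} :: (real ^ 'd \<Rightarrow> real) set)"
            using monotone_coefs_nonempty by (auto simp: monotone_step_fns_eq[OF J(1)])
          ultimately obtain h where h: "h \<in> monotone_step_fns ?J" "L1_dist G (step_fn ?J \<theta>') h < M n * rate n + e"
            by (rule L1_setdist_nearD)
          then obtain c where c: "c \<in> monotone_coefs ?J" "h = step_fn ?J c" by (auto simp: monotone_step_fns_eq[OF J(1)])
          have "\<tau> < L1_dist G f h"
            using dist L1_setdist_le[of h monotone_fns G f] h(1) by (simp add: monotone_step_fns_def)
          also have "\<dots> \<le> osc0 + L1_dist G (step_fn ?J \<theta>) h"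
            unfolding c(2) by (rule L1_dist_le_step_fn[OF prob_space_G sets_G J(1) cube osc osc0])
          also have "L1_dist G (step_fn ?J \<theta>) h \<le> ?d + L1_dist G (step_fn ?J \<theta>') h"
            unfolding c(2) cell_prob_L1_dist sum.distrib[symmetric] distrib_left[symmetric]
            by (intro sum_mono mult_left_mono) auto
          finally show ?thesis using h(2) by linarith
        qed
        then have "\<tau> \<le> osc0 + ?d + M n * rate n" by (rule field_le_epsilon)
        then show ?thesis using \<tau> bias unfolding osc0_def[symmetric] by linarith
      qed
      have "acceptance n f \<le> prob E"
        unfolding true_expectation_def
      proof (rule test_expectation_le[OF E(1)])
        show "AE \<omega> in P. 1 - test n (Xs \<omega>) (Ys f \<omega>) \<le> indicator E \<omega>"
          using E(3)
        proof eventually_elim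
          fix \<omega> assume good: "\<omega> \<notin> E \<longrightarrow> good_data S L t \<gamma> ?J (\<zeta> n) (lam n) n \<omega>"
          show "1 - test n (Xs \<omega>) (Ys f \<omega>) \<le> indicator E \<omega>"
          proof (cases "\<omega> \<in> E")
            case False
            then have "good_data S L t \<gamma> ?J (\<zeta> n) (lam n) n \<omega>" using good by simp
            note good_dataD(1)[where f = f and A = "nbhd n", OF this fb(1) \<theta>b osc far]
            then show ?thesis by (simp add: monotonicity_test_def)
          qed (simp add: test_bounds)
        qed
      qed
      then have "acceptance n f \<le> K * (real ?J ^ CARD('d) / real n) * (1 / t + 1 / t\<^sup>2)"
        using E(2) by linarith
      then show "ennreal (acceptance n f)
          \<le> ennreal (K * (real (J n) ^ CARD('d) / real n) * (1 / t + 1 / t\<^sup>2))" by (rule ennreal_leI)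
    qed
  qed
qed

lemma ennreal_squeeze_0:
  fixes F :: "nat \<Rightarrow> ennreal"
  assumes "eventually (\<lambda>n. F n \<le> ennreal (u n)) sequentially" "u \<longlonglongrightarrow> 0"
  shows "F \<longlonglongrightarrow> 0"
proof (rule tendsto_sandwich[OF _ assms(1) tendsto_const])
  show "(\<lambda>n. ennreal (u n)) \<longlonglongrightarrow> 0" using tendsto_ennrealI[OF assms(2)] by simp
qed simp

theorem test_power_holder:
  assumes \<alpha>: "0 < \<alpha>" "\<alpha> < 1" and L: "0 < L"
    and rad: "(\<lambda>n. M n * rate n) \<in> O(\<lambda>n. real n powr (- \<alpha> / (2 + real CARD('d))))"
  shows "\<exists>C>0. (\<lambda>n. SUP f\<in>{f \<in> holder_class \<alpha> L. L1_setdist G f monotone_fns > C * real n powr (- \<alpha> / (2 + real CARD('d)))}.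
         ennreal (acceptance n f)) \<longlonglongrightarrow> 0"
proof -
  obtain K where K: "0 < K" "\<forall>n t \<tau>. 4 \<le> n \<longrightarrow> 0 < t \<longrightarrow>
      2 * (L * (real CARD('d) / real (J n)) powr \<alpha>) + 2 * t + M n * rate n \<le> \<tau> \<longrightarrow>
      (SUP f\<in>{f \<in> holder_class \<alpha> L. L1_setdist G f monotone_fns > \<tau>}.
         ennreal (acceptance n f))
      \<le> ennreal (K * (real (J n) ^ CARD('d) / real n) * (1 / t + 1 / t\<^sup>2))"
    using holder_power_bound[OF \<alpha>(1) L] by (elim exE conjE) (rule that)
  obtain K' where K': "0 < K'" "eventually (\<lambda>n. real (J n) ^ CARD('d) / real n \<le> K' * (rate n)\<^sup>2) sequentially"
    "eventually (\<lambda>n. 1 / real (J n) \<le> K' * rate n) sequentially" by (rule rates)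
  obtain K2 where K2: "0 < K2" "eventually (\<lambda>n. norm (M n * rate n) \<le> K2 * norm (real n powr (- \<alpha> / (2 + real CARD('d))))) sequentially"
    using rad by (rule landau_o.bigE)
  define \<eta> where "\<eta> = (\<lambda>n. real n powr (- \<alpha> / (2 + real CARD('d))))"
  have \<eta>: "\<eta> n = rate n powr \<alpha>" for n
    by (simp add: \<eta>_def rate_def powr_powr add.commute)
  define K3 where "K3 = L * (real CARD('d) * K') powr \<alpha>"
  \<comment> \<open>The summands account for the oscillation counted twice, for 2t with t =
    \<open>\<eta> n\<close>, and for the radius of the neighbourhood.\<close>
  define C where "C = 2 * K3 + 2 + K2"
  have K3: "0 \<le> K3" using L by (simp add: K3_def)
  have C: "0 < C" using K3 K2(1) by (simp add: C_def)
  let ?F = "\<lambda>n. SUP f\<in>{f \<in> holder_class \<alpha> L. L1_setdist G f monotone_fns > C * \<eta> n}.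
         ennreal (acceptance n f)"
  \<comment> \<open>Writing \<open>\<eta> n\<close> as
    \<open>rate n powr (\<alpha> - 1) * rate n\<close> exhibits the diverging factor expected by
    \<open>rate_bound_tendsto\<close>; it diverges because \<alpha> < 1.\<close>
  let ?u = "\<lambda>n. K * K' * (rate n)\<^sup>2 * (1 / (1 * rate n powr (\<alpha> - 1) * rate n) + 1 / (1 * rate n powr (\<alpha> - 1) * rate n)\<^sup>2)"
  have "eventually (\<lambda>n. ?F n \<le> ennreal (?u n)) sequentially"
    using K'(2,3) K2(2) eventually_ge_at_top[of 4]
  proof eventually_elim
    fix n :: nat
    assume Jn: "real (J n) ^ CARD('d) / real n \<le> K' * (rate n)\<^sup>2" "1 / real (J n) \<le> K' * rate n"
      and r: "norm (M n * rate n) \<le> K2 * norm (real n powr (- \<alpha> / (2 + real CARD('d))))" and n: "4 \<le> n"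
    have rn: "0 < rate n" using n by (intro rate_pos) simp
    have \<eta>0: "0 < \<eta> n" using rn by (simp add: \<eta>)
    have "(real CARD('d) / real (J n)) powr \<alpha> \<le> (real CARD('d) * K' * rate n) powr \<alpha>"
      using Jn(2) \<alpha> mult_left_mono[OF Jn(2), of "real CARD('d)"] by (intro powr_mono2) auto
    also have "\<dots> = (real CARD('d) * K') powr \<alpha> * \<eta> n"
      using K'(1) rn by (simp add: \<eta> powr_mult)
    finally have "L * (real CARD('d) / real (J n)) powr \<alpha> \<le> K3 * \<eta> n"
      using L by (simp add: K3_def mult.assoc)
    moreover have "M n * rate n \<le> K2 * \<eta> n" using r by (simp add: \<eta>_def)
    ultimately have "2 * (L * (real CARD('d) / real (J n)) powr \<alpha>) + 2 * \<eta> n + M n * rate n \<le> C * \<eta> n"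
      by (simp add: C_def algebra_simps)
    then have "?F n \<le> ennreal (K * (real (J n) ^ CARD('d) / real n) * (1 / \<eta> n + 1 / (\<eta> n)\<^sup>2))"
      by (rule K(2)[rule_format, OF n \<eta>0])
    also have "\<dots> \<le> ennreal (K * (K' * (rate n)\<^sup>2) * (1 / \<eta> n + 1 / (\<eta> n)\<^sup>2))"
      using K(1) \<eta>0 Jn(1) by (intro ennreal_leI mult_right_mono mult_left_mono) auto
    finally have le: "?F n \<le> ennreal (K * (K' * (rate n)\<^sup>2) * (1 / \<eta> n + 1 / (\<eta> n)\<^sup>2))" .
    have "1 * rate n powr (\<alpha> - 1) * rate n = \<eta> n"
      using rn by (simp add: \<eta> powr_diff)
    then show "?F n \<le> ennreal (?u n)" using le by (simp only: mult.assoc)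
  qed
  moreover have "?u \<longlonglongrightarrow> 0"
  proof (rule rate_bound_tendsto)
    let ?s = "(1 - \<alpha>) / (real CARD('d) + 2)"
    have "(\<lambda>n. real n powr - ?s) \<longlonglongrightarrow> 0"
      using \<alpha> by (intro tendsto_neg_powr filterlim_real_sequentially) auto
    moreover have "eventually (\<lambda>n. 0 < real n powr - ?s) sequentially"
      using eventually_gt_at_top[of 0] by eventually_elim simp
    ultimately have "filterlim (\<lambda>n. inverse (real n powr - ?s)) at_top sequentially"
      by (rule filterlim_inverse_at_top)
    then have "filterlim (\<lambda>n. real n powr ?s) at_top sequentially"
      unfolding powr_minus by (simp only: inverse_inverse_eq)
    moreover have "- 1 / (real CARD('d) + 2) * (\<alpha> - 1) = (1 - \<alpha>) / (real CARD('d) + 2)" by (simp add: field_simps)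
    ultimately show "filterlim (\<lambda>n. rate n powr (\<alpha> - 1)) at_top sequentially"
      unfolding rate_def powr_powr by (simp only:)
  qed simp
  ultimately have "?F \<longlonglongrightarrow> 0" by (rule ennreal_squeeze_0)
  then show ?thesis using C unfolding \<eta>_def by blast
qed

theorem test_power_lipschitz:
  assumes L: "0 < L" and C: "1 < C"
  shows "(\<lambda>n. SUP f\<in>{f \<in> holder_class 1 L. L1_setdist G f monotone_fns > C * M n * rate n}.
         ennreal (acceptance n f)) \<longlonglongrightarrow> 0"
proof -
  obtain K where K: "0 < K" "\<forall>n t \<tau>. 4 \<le> n \<longrightarrow> 0 < t \<longrightarrow>
      2 * (L * (real CARD('d) / real (J n)) powr 1) + 2 * t + M n * rate n \<le> \<tau> \<longrightarrow>
      (SUP f\<in>{f \<in> holder_class 1 L. L1_setdist G f monotone_fns > \<tau>}.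
         ennreal (acceptance n f))
      \<le> ennreal (K * (real (J n) ^ CARD('d) / real n) * (1 / t + 1 / t\<^sup>2))"
    using holder_power_bound[OF zero_less_one L] by (elim exE conjE) (rule that)
  obtain K' where K': "0 < K'" "eventually (\<lambda>n. real (J n) ^ CARD('d) / real n \<le> K' * (rate n)\<^sup>2) sequentially"
    "eventually (\<lambda>n. 1 / real (J n) \<le> K' * rate n) sequentially" by (rule rates)
  \<comment> \<open>The excess (C - 1) * M n * rate n of the separation over the radius is split
    into four equal shares t: two for 2t and two for the oscillation terms, which are of order
    \<open>rate n\<close> and hence below t for large \<open>M n\<close>.\<close>
  define c where "c = (C - 1) / 4"
  have c: "0 < c" using C by (simp add: c_def)
  let ?F = "\<lambda>n. SUP f\<in>{f \<in> holder_class 1 L. L1_setdist G f monotone_fns > C * M n * rate n}.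
         ennreal (acceptance n f)"
  let ?u = "\<lambda>n. K * K' * (rate n)\<^sup>2 * (1 / (c * M n * rate n) + 1 / (c * M n * rate n)\<^sup>2)"
  have "eventually (\<lambda>n. ?F n \<le> ennreal (?u n)) sequentially"
    using K'(2,3) eventually_ge_at_top[of 4] filterlim_at_top_dense[THEN iffD1, OF M, rule_format, of 0]
      filterlim_at_top[THEN iffD1, OF M, rule_format, of "L * real CARD('d) * K' / c"]
  proof eventually_elim
    fix n :: nat
    assume Jn: "real (J n) ^ CARD('d) / real n \<le> K' * (rate n)\<^sup>2" "1 / real (J n) \<le> K' * rate n"
      and n: "4 \<le> n" and Mn: "0 < M n" "L * real CARD('d) * K' / c \<le> M n"
    have rn: "0 < rate n" using n by (intro rate_pos) simp
    define t where "t = c * M n * rate n"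
    have t: "0 < t" using c Mn rn by (simp add: t_def)
    have "L * real CARD('d) * (1 / real (J n)) \<le> L * real CARD('d) * (K' * rate n)"
      using Jn(2) L by (intro mult_left_mono) auto
    also have "\<dots> \<le> t"
    proof -
      have "L * real CARD('d) * K' \<le> c * M n" using Mn(2) c by (simp add: field_simps)
      from mult_right_mono[OF this, of "rate n"] rn show ?thesis by (simp add: t_def mult.assoc)
    qed
    finally have "2 * (L * (real CARD('d) / real (J n)) powr 1) + 2 * t + M n * rate n \<le> 4 * t + M n * rate n"
      by simp
    also have "\<dots> = C * M n * rate n" by (simp add: t_def c_def field_simps)
    finally have "?F n \<le> ennreal (K * (real (J n) ^ CARD('d) / real n) * (1 / t + 1 / t\<^sup>2))"
      by (rule K(2)[rule_format, OF n t])
    also have "\<dots> \<le> ennreal (K * (K' * (rate n)\<^sup>2) * (1 / t + 1 / t\<^sup>2))"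
      using K(1) t Jn(1) by (intro ennreal_leI mult_right_mono mult_left_mono) auto
    finally show "?F n \<le> ennreal (?u n)" by (simp only: mult.assoc t_def)
  qed
  moreover have "?u \<longlonglongrightarrow> 0" by (rule rate_bound_tendsto[OF M c])
  ultimately show ?thesis by (rule ennreal_squeeze_0)
qed

end

section \<open>Approximation in mean\<close>

text \<open>The bound \<open>b\<close> on the coefficients is chosen before \<open>J\<close>. It
  enters the prior pull as a constant, so it must not grow with the partition.\<close>

definition step_approximable :: "(real ^ 'd) measure \<Rightarrow> (real ^ 'd \<Rightarrow> real) \<Rightarrow> bool" where
  "step_approximable G f \<longleftrightarrow> (\<forall>e>0. \<exists>b\<ge>0. \<exists>K. \<forall>J\<ge>K. 0 < J \<longrightarrow>
     (\<exists>\<theta>. (\<forall>j. \<bar>\<theta> j\<bar> \<le> b) \<and> (\<integral>x. \<bar>f x - step_fn J \<theta> x\<bar> \<partial>G) \<le> e))"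

lemma step_fn_add: "step_fn J (\<lambda>j. \<theta> j + \<theta>' j) x = step_fn J \<theta> x + step_fn J \<theta>' x"
  by (simp add: step_fn_def sum.distrib distrib_right)

lemma step_fn_cmult: "step_fn J (\<lambda>j. c * \<theta> j) x = c * step_fn J \<theta> x"
  by (simp only: step_fn_def sum_distrib_left mult.assoc)

text \<open>A point at distance 0 from a closed set belongs to it, so the shells decrease to the
  empty set and continuity of the measure from above applies.\<close>

lemma infdist_compact_tail_null:
  fixes G :: "(real ^ 'd) measure"
  assumes "prob_space G" and Gs [measurable_cong, simp]: "sets G = sets borel" and K: "compact K" "K \<noteq> {}" and c: "0 \<le> c"
  shows "(\<lambda>m. measure G {x. infdist x K \<le> c / real (Suc m) \<and> x \<notin> K}) \<longlonglongrightarrow> 0"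
proof -
  interpret prob_space G by fact
  have cl: "closed K" using K by (simp add: compact_imp_closed)
  define U where "U = (\<lambda>m. {x. infdist x K \<le> c / real (Suc m) \<and> x \<notin> K})"
  have Km [measurable]: "K \<in> sets borel" using cl by (rule borel_closed)
  have U: "U m = {x. infdist x K \<le> c / real (Suc m)} - K" for m by (auto simp: U_def)
  have "closed {x. infdist x K \<le> c / real (Suc m)}" for m
    by (intro closed_Collect_le continuous_intros)
  then have meas: "range U \<subseteq> sets G" unfolding U using Km by auto
  have dec: "decseq U"
  proof (rule decseq_SucI, safe)
    fix m x assume "x \<in> U (Suc m)"
    moreover have "c / real (Suc (Suc m)) \<le> c / real (Suc m)" using c by (intro divide_left_mono) auto
    ultimately show "x \<in> U m" unfolding U_def by auto
  qed
  have "x \<notin> (\<Inter>m. U m)" for x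
  proof
    assume x: "x \<in> (\<Inter>m. U m)"
    have "(\<lambda>m. c * inverse (real (Suc m))) \<longlonglongrightarrow> c * 0"
      by (intro tendsto_intros LIMSEQ_inverse_real_of_nat)
    then have "infdist x K \<le> c * 0"
      by (rule LIMSEQ_le_const) (use x in \<open>auto simp: U_def divide_inverse\<close>)
    then have "infdist x K = 0" using infdist_nonneg[of x K] by simp
    then have "x \<in> K" using in_closed_iff_infdist_zero[OF cl K(2)] by simp
    then show False using x by (auto simp: U_def)
  qed
  then have "(\<Inter>m. U m) = {}" by blast
  then show ?thesis using finite_Lim_measure_decseq[OF meas dec] by (simp add: U_def)
qed

text \<open>Inner regularity supplies a compact \<open>K\<close> inside \<open>A\<close> with almost
  the same measure. Cells meeting \<open>K\<close> get value 1, all others 0. Errors occur only in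
  \<open>A - K\<close> or in a thin shell around \<open>K\<close>, since a cell meeting
  \<open>K\<close> stays within its diameter of \<open>K\<close>.\<close>

lemma step_approximable_indicator:
  fixes G :: "(real ^ 'd) measure"
  assumes "prob_space G" and Gs [measurable_cong, simp]: "sets G = sets borel"
    and cube: "AE x in G. x \<in> {0..1}" and A: "A \<in> sets borel"
  shows "step_approximable G (indicator A)"
  unfolding step_approximable_def
proof (intro allI impI)
  fix e :: real assume e: "0 < e"
  interpret prob_space G by fact
  have sp: "space G = UNIV" using sets_eq_imp_space_eq[OF Gs] by simp
  have int: "integrable G (\<lambda>x. \<bar>indicator A x - step_fn J \<theta> x\<bar>)" for J \<theta>
    unfolding step_fn_def using A
    by (intro integrable_abs Bochner_Integration.integrable_diff Bochner_Integration.integrable_sum integrable_mult_right integrable_real_indicator)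
      (auto simp: less_top[symmetric])
  have "emeasure G A = (SUP K\<in>{K. K \<subseteq> A \<and> compact K}. emeasure G K)"
    using A by (intro inner_regular) auto
  moreover have "\<exists>K\<in>{K. K \<subseteq> A \<and> compact K}. emeasure G A < emeasure G K + ennreal (e / 2)"
    unfolding calculation using e by (intro SUP_approx_ennreal[OF _ _ refl]) (auto simp flip: calculation)
  ultimately obtain K where K: "K \<subseteq> A" "compact K" "emeasure G A < emeasure G K + ennreal (e / 2)" by auto
  have Km: "K \<in> sets borel" using K(2) by (intro borel_closed compact_imp_closed)
  have "ennreal (measure G A) < ennreal (measure G K + e / 2)"
    using K(3) e by (simp add: emeasure_eq_measure flip: ennreal_plus)
  then have K3: "measure G A < measure G K + e / 2" by (simp add: ennreal_less_iff)
  have diff: "measure G (A - K) \<le> e / 2"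
    using finite_measure_Diff[of A K] A Km K(1,3) K3 by simp
  show "\<exists>b\<ge>0. \<exists>K. \<forall>J\<ge>K. 0 < J \<longrightarrow>
     (\<exists>\<theta>. (\<forall>j. \<bar>\<theta> j\<bar> \<le> b) \<and> (\<integral>x. \<bar>indicator A x - step_fn J \<theta> x\<bar> \<partial>G) \<le> e)"
  proof (cases "K = {}")
    case True
    have "(\<integral>x. \<bar>indicator A x - step_fn J (\<lambda>_. 0) x\<bar> \<partial>G) \<le> e" for J
    proof -
      have "(\<integral>x. \<bar>indicator A x - step_fn J (\<lambda>_. 0) x\<bar> \<partial>G) = (\<integral>x. indicator A x \<partial>G)"
        by (intro Bochner_Integration.integral_cong) (auto simp: step_fn_def indicator_def)
      then show ?thesis using diff True e sp by simp
    qed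
    then show ?thesis by (intro exI[of _ 0] conjI allI impI exI[of _ "\<lambda>_. 0"]) auto
  next
    case False
    let ?U = "\<lambda>c. {x. infdist x K \<le> c \<and> x \<notin> K}"
    define c where "c = real CARD('d)"
    have "(\<lambda>m. measure G (?U (c / real (Suc m)))) \<longlonglongrightarrow> 0"
      by (rule infdist_compact_tail_null[OF assms(1) Gs K(2) False]) (simp add: c_def)
    then have "eventually (\<lambda>m. measure G (?U (c / real (Suc m))) < e / 2) sequentially"
      using e by (intro order_tendstoD) auto
    then obtain m where m: "measure G (?U (c / real (Suc m))) < e / 2"
      by (auto simp: eventually_sequentially)
    define U where "U = ?U (c / real (Suc m))"
    have "closed {x. infdist x K \<le> c / real (Suc m)}" by (intro closed_Collect_le continuous_intros)
    moreover have "U = {x. infdist x K \<le> c / real (Suc m)} - K" by (auto simp: U_def)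
    ultimately have Um: "U \<in> sets borel" using Km by auto
    have "\<exists>\<theta>. (\<forall>j. \<bar>\<theta> j\<bar> \<le> 1) \<and> (\<integral>x. \<bar>indicator A x - step_fn J \<theta> x\<bar> \<partial>G) \<le> e" if J: "Suc m \<le> J" for J
    proof -
      have J0: "0 < J" using J by simp
      define \<theta> where "\<theta> = (\<lambda>j. if cell J j \<inter> K = {} then 0 else 1 :: real)"
      have ae: "AE x in G. \<bar>indicator A x - step_fn J \<theta> x\<bar> \<le> indicator (A - K) x + indicator U x"
        using cube
      proof eventually_elim
        fix x :: "real ^ 'd" assume x: "x \<in> {0..1}"
        obtain j where j: "j \<in> indices J" "x \<in> cell J j" using ex_cell[OF x J0] .
        have st: "step_fn J \<theta> x = \<theta> j" by (rule step_fn_eq[OF j(1) J0 j(2)])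
        show "\<bar>indicator A x - step_fn J \<theta> x\<bar> \<le> indicator (A - K) x + (indicator U x :: real)"
        proof (cases "cell J j \<inter> K = {}")
          case True
          then have "x \<notin> K" using j by blast
          have "step_fn J \<theta> x = 0" using True by (simp only: st) (simp add: \<theta>_def)
          then show ?thesis using \<open>x \<notin> K\<close> by (auto simp: indicator_def)
        next
          case False
          then obtain y where y: "y \<in> cell J j" "y \<in> K" by blast
          have "infdist x K \<le> dist x y" by (rule infdist_le[OF y(2)])
          also have "\<dots> \<le> c / real J" using cell_diameter[OF j(2) y(1)] by (simp add: dist_norm c_def)
          also have "\<dots> \<le> c / real (Suc m)" using J J0 by (intro divide_left_mono) (auto simp: c_def)
          finally have "x \<in> U" if "x \<notin> K" using that by (simp add: U_def)
          moreover have "step_fn J \<theta> x = 1" using False by (simp only: st) (simp add: \<theta>_def)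
          ultimately show ?thesis using K(1) by (auto simp: indicator_def)
        qed
      qed
      have "(\<integral>x. \<bar>indicator A x - step_fn J \<theta> x\<bar> \<partial>G) \<le> (\<integral>x. indicator (A - K) x + indicator U x \<partial>G)"
        using A Km Um by (intro integral_mono_AE int ae Bochner_Integration.integrable_add integrable_real_indicator) (auto simp: less_top[symmetric])
      also have "\<dots> = measure G (A - K) + measure G U"
        using A Km Um by (subst Bochner_Integration.integral_add) (auto simp: less_top[symmetric] sp)
      also have "\<dots> \<le> e" using diff m by (simp add: U_def)
      finally show ?thesis by (intro exI[of _ \<theta>]) (auto simp: \<theta>_def)
    qed
    then show ?thesis by (intro exI[of _ 1] conjI exI[of _ "Suc m"]) auto
  qed
qed

lemma integrable_step_fn:
  fixes G :: "(real ^ 'd) measure"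
  assumes "prob_space G" "sets G = sets borel"
  shows "integrable G (step_fn J \<theta>)"
proof -
  interpret prob_space G by fact
  show ?thesis unfolding step_fn_def
    by (intro Bochner_Integration.integrable_sum integrable_mult_right integrable_real_indicator) (auto simp: assms(2) less_top[symmetric])
qed

lemma integrable_step_approximable:
  fixes G :: "(real ^ 'd) measure"
  assumes G: "prob_space G" and Gs [measurable_cong, simp]: "sets G = sets borel"
    and cube: "AE x in G. x \<in> {0..1}" and f: "integrable G f"
  shows "step_approximable G f"
proof -
  note isf = integrable_step_fn[OF G Gs]
  show ?thesis
    using f
  proof (induct rule: integrable_induct)
    case (base A c)
    have ap: "step_approximable G (indicator A)" by (rule step_approximable_indicator[OF G Gs cube]) (use base in simp)
    show ?case unfolding step_approximable_def
    proof (intro allI impI)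
      fix e :: real assume e: "0 < e"
      define e' where "e' = e / (1 + \<bar>c\<bar>)"
      have e': "0 < e'" using e by (simp add: e'_def add_pos_nonneg)
      obtain b K where b: "0 \<le> b" and K: "\<And>J. K \<le> J \<Longrightarrow> 0 < J \<Longrightarrow> \<exists>\<theta>. (\<forall>j. \<bar>\<theta> j\<bar> \<le> b) \<and> (\<integral>x. \<bar>indicator A x - step_fn J \<theta> x\<bar> \<partial>G) \<le> e'"
        using ap[unfolded step_approximable_def, rule_format, OF e'] by blast
      have "\<exists>\<theta>. (\<forall>j. \<bar>\<theta> j\<bar> \<le> \<bar>c\<bar> * b) \<and> (\<integral>x. \<bar>indicator A x *\<^sub>R c - step_fn J \<theta> x\<bar> \<partial>G) \<le> e" if J: "K \<le> J" "0 < J" for J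
      proof -
        obtain \<theta> where \<theta>: "\<And>j. \<bar>\<theta> j\<bar> \<le> b" "(\<integral>x. \<bar>indicator A x - step_fn J \<theta> x\<bar> \<partial>G) \<le> e'" using K[OF J] by blast
        have "(\<integral>x. \<bar>indicator A x *\<^sub>R c - step_fn J (\<lambda>j. c * \<theta> j) x\<bar> \<partial>G) = (\<integral>x. \<bar>c\<bar> * \<bar>indicator A x - step_fn J \<theta> x\<bar> \<partial>G)"
          by (intro Bochner_Integration.integral_cong refl) (simp add: step_fn_cmult algebra_simps flip: abs_mult)
        also have "\<dots> = \<bar>c\<bar> * (\<integral>x. \<bar>indicator A x - step_fn J \<theta> x\<bar> \<partial>G)" by simp
        also have "\<dots> \<le> \<bar>c\<bar> * e'" by (intro mult_left_mono \<theta>) simp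
        also have "\<dots> \<le> e" using e by (simp add: e'_def field_simps)
        finally show ?thesis
          using \<theta>(1) by (intro exI[of _ "\<lambda>j. c * \<theta> j"]) (auto simp: abs_mult mult_left_mono)
      qed
      then show "\<exists>b\<ge>0. \<exists>K. \<forall>J\<ge>K. 0 < J \<longrightarrow> (\<exists>\<theta>. (\<forall>j. \<bar>\<theta> j\<bar> \<le> b) \<and> (\<integral>x. \<bar>indicator A x *\<^sub>R c - step_fn J \<theta> x\<bar> \<partial>G) \<le> e)"
        using b by (intro exI[of _ "\<bar>c\<bar> * b"] conjI exI[of _ K]) auto
    qed
  next
    case (add f g)
    show ?case unfolding step_approximable_def
    proof (intro allI impI)
      fix e :: real assume e: "0 < e"
      then have e2: "0 < e / 2" by simp
      obtain b K where b: "0 \<le> b" and K: "\<And>J. K \<le> J \<Longrightarrow> 0 < J \<Longrightarrow> \<exists>\<theta>. (\<forall>j. \<bar>\<theta> j\<bar> \<le> b) \<and> (\<integral>x. \<bar>f x - step_fn J \<theta> x\<bar> \<partial>G) \<le> e / 2"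
        using add(2)[unfolded step_approximable_def, rule_format, OF e2] by blast
      obtain b' K' where b': "0 \<le> b'" and K': "\<And>J. K' \<le> J \<Longrightarrow> 0 < J \<Longrightarrow> \<exists>\<theta>. (\<forall>j. \<bar>\<theta> j\<bar> \<le> b') \<and> (\<integral>x. \<bar>g x - step_fn J \<theta> x\<bar> \<partial>G) \<le> e / 2"
        using add(4)[unfolded step_approximable_def, rule_format, OF e2] by blast
      have "\<exists>\<theta>. (\<forall>j. \<bar>\<theta> j\<bar> \<le> b + b') \<and> (\<integral>x. \<bar>f x + g x - step_fn J \<theta> x\<bar> \<partial>G) \<le> e" if J: "max K K' \<le> J" "0 < J" for J
      proof -
        obtain \<theta> where \<theta>: "\<And>j. \<bar>\<theta> j\<bar> \<le> b" "(\<integral>x. \<bar>f x - step_fn J \<theta> x\<bar> \<partial>G) \<le> e / 2" using K[of J] J by auto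
        obtain \<theta>' where \<theta>': "\<And>j. \<bar>\<theta>' j\<bar> \<le> b'" "(\<integral>x. \<bar>g x - step_fn J \<theta>' x\<bar> \<partial>G) \<le> e / 2" using K'[of J] J by auto
        have "(\<integral>x. \<bar>f x + g x - step_fn J (\<lambda>j. \<theta> j + \<theta>' j) x\<bar> \<partial>G) \<le> (\<integral>x. \<bar>f x - step_fn J \<theta> x\<bar> + \<bar>g x - step_fn J \<theta>' x\<bar> \<partial>G)"
          unfolding step_fn_add using add(1,3) isf[of J \<theta>] isf[of J \<theta>'] by (intro integral_mono) auto
        also have "\<dots> = (\<integral>x. \<bar>f x - step_fn J \<theta> x\<bar> \<partial>G) + (\<integral>x. \<bar>g x - step_fn J \<theta>' x\<bar> \<partial>G)"
          using add(1,3) isf[of J \<theta>] isf[of J \<theta>'] by (intro Bochner_Integration.integral_add) auto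
        also have "\<dots> \<le> e" using \<theta>(2) \<theta>'(2) by simp
        moreover have "\<bar>\<theta> j + \<theta>' j\<bar> \<le> b + b'" for j using \<theta>(1)[of j] \<theta>'(1)[of j] by linarith
        ultimately show ?thesis by (intro exI[of _ "\<lambda>j. \<theta> j + \<theta>' j"]) auto
      qed
      then show "\<exists>b\<ge>0. \<exists>K. \<forall>J\<ge>K. 0 < J \<longrightarrow> (\<exists>\<theta>. (\<forall>j. \<bar>\<theta> j\<bar> \<le> b) \<and> (\<integral>x. \<bar>f x + g x - step_fn J \<theta> x\<bar> \<partial>G) \<le> e)"
        using b b' by (intro exI[of _ "b + b'"] conjI exI[of _ "max K K'"]) auto
    qed
  next
    case (lim f s)
    show ?case unfolding step_approximable_def
    proof (intro allI impI)
      fix e :: real assume e: "0 < e"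
      then have e2: "0 < e / 2" by simp
      have fs: "integrable G (\<lambda>x. \<bar>f x - s i x\<bar>)" for i using lim(1)[of i] lim(5) by auto
      have "(\<lambda>i. \<integral>x. \<bar>f x - s i x\<bar> \<partial>G) \<longlonglongrightarrow> (\<integral>x. 0 \<partial>G)"
      proof (rule integral_dominated_convergence[where w = "\<lambda>x. 3 * \<bar>f x\<bar>"])
        show "integrable G (\<lambda>x. 3 * \<bar>f x\<bar>)" using lim(5) by auto
        show "AE x in G. (\<lambda>i. \<bar>f x - s i x\<bar>) \<longlonglongrightarrow> 0"
        proof (rule AE_I2)
          fix x assume "x \<in> space G"
          from tendsto_rabs[OF tendsto_diff[OF tendsto_const[of "f x"] lim(3)[OF this]]]
          show "(\<lambda>i. \<bar>f x - s i x\<bar>) \<longlonglongrightarrow> 0" by simp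
        qed
        show "AE x in G. norm \<bar>f x - s i x\<bar> \<le> 3 * \<bar>f x\<bar>" for i
        proof (rule AE_I2)
          fix x assume "x \<in> space G"
          from lim(4)[OF this, of i] show "norm \<bar>f x - s i x\<bar> \<le> 3 * \<bar>f x\<bar>" by (simp add: abs_le_iff) linarith
        qed
        show "(\<lambda>x. \<bar>f x - s i x\<bar>) \<in> borel_measurable G" for i using fs by (rule borel_measurable_integrable)
      qed simp
      then have "eventually (\<lambda>i. (\<integral>x. \<bar>f x - s i x\<bar> \<partial>G) < e / 2) sequentially"
        using e2 by (intro order_tendstoD) auto
      then obtain i where i: "(\<integral>x. \<bar>f x - s i x\<bar> \<partial>G) < e / 2" by (auto simp: eventually_sequentially)
      obtain b K where b: "0 \<le> b" and K: "\<And>J. K \<le> J \<Longrightarrow> 0 < J \<Longrightarrow> \<exists>\<theta>. (\<forall>j. \<bar>\<theta> j\<bar> \<le> b) \<and> (\<integral>x. \<bar>s i x - step_fn J \<theta> x\<bar> \<partial>G) \<le> e / 2"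
        using lim(2)[of i, unfolded step_approximable_def, rule_format, OF e2] by blast
      have "\<exists>\<theta>. (\<forall>j. \<bar>\<theta> j\<bar> \<le> b) \<and> (\<integral>x. \<bar>f x - step_fn J \<theta> x\<bar> \<partial>G) \<le> e" if J: "K \<le> J" "0 < J" for J
      proof -
        obtain \<theta> where \<theta>: "\<And>j. \<bar>\<theta> j\<bar> \<le> b" "(\<integral>x. \<bar>s i x - step_fn J \<theta> x\<bar> \<partial>G) \<le> e / 2" using K[OF J] by blast
        have "(\<integral>x. \<bar>f x - step_fn J \<theta> x\<bar> \<partial>G) \<le> (\<integral>x. \<bar>f x - s i x\<bar> + \<bar>s i x - step_fn J \<theta> x\<bar> \<partial>G)"
          using lim(1)[of i] lim(5) isf[of J \<theta>] by (intro integral_mono) auto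
        also have "\<dots> = (\<integral>x. \<bar>f x - s i x\<bar> \<partial>G) + (\<integral>x. \<bar>s i x - step_fn J \<theta> x\<bar> \<partial>G)"
          using lim(1)[of i] lim(5) isf[of J \<theta>] by (intro Bochner_Integration.integral_add) auto
        also have "\<dots> \<le> e" using \<theta>(2) i by simp
        finally show ?thesis using \<theta>(1) by blast
      qed
      then show "\<exists>b\<ge>0. \<exists>K. \<forall>J\<ge>K. 0 < J \<longrightarrow> (\<exists>\<theta>. (\<forall>j. \<bar>\<theta> j\<bar> \<le> b) \<and> (\<integral>x. \<bar>f x - step_fn J \<theta> x\<bar> \<partial>G) \<le> e)"
        using b by blast
    qed
  qed
qed

section \<open>Variance estimate for an integrable regression function\<close>

context random_design
begin

text \<open>\<open>f\<close> need not be square integrable; the bound \<open>min (y\<^sup>2) 1 \<le> \<bar>y\<bar>\<close> makes \<open>\<bar>f\<bar>\<close> a dominating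
  function for the truncated summands.\<close>

lemma square_sum_tail_tendsto_0:
  assumes f: "integrable G f" and t: "0 < t" "t \<le> 1"
  shows "(\<lambda>n. prob {\<omega> \<in> space P. t \<le> (\<Sum>i<n. (f (X i \<omega>))\<^sup>2) / (real n)\<^sup>2}) \<longlonglongrightarrow> 0"
proof -
  have fm [measurable]: "f \<in> borel_measurable borel" using f by (simp add: measurable_cong_sets[OF sets_G refl, symmetric])
  \<comment> \<open>The factor n makes the integral of \<open>h n\<close> equal to the expectation
    of the whole sum of n truncated terms.\<close>
  define h where "h = (\<lambda>n x. real n * min ((f x / real n)\<^sup>2) 1)"
  have hm [measurable]: "h n \<in> borel_measurable borel" for n unfolding h_def by measurable
  have sq: "min (y\<^sup>2) 1 \<le> \<bar>y\<bar>" for y :: real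
  proof (cases "\<bar>y\<bar> \<le> 1")
    case True
    have "y\<^sup>2 = \<bar>y\<bar> * \<bar>y\<bar>" by (simp add: power2_eq_square)
    also have "\<dots> \<le> \<bar>y\<bar> * 1" using True by (intro mult_left_mono) auto
    finally show ?thesis by simp
  qed auto
  have hb: "\<bar>h n x\<bar> \<le> \<bar>f x\<bar>" for n x
  proof (cases "n = 0")
    case False
    have "\<bar>h n x\<bar> = real n * min ((f x / real n)\<^sup>2) 1" by (simp add: h_def abs_mult)
    also have "\<dots> \<le> real n * \<bar>f x / real n\<bar>" by (intro mult_left_mono sq) simp
    also have "\<dots> = \<bar>f x\<bar>" using False by (simp add: abs_divide)
    finally show ?thesis .
  qed (simp add: h_def)
  have hint: "integrable G (h n)" for n
    using hb by (intro Bochner_Integration.integrable_bound[OF f]) auto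
  have lim: "(\<lambda>n. \<integral>x. h n x \<partial>G) \<longlonglongrightarrow> (\<integral>x. 0 \<partial>G)"
  proof (rule integral_dominated_convergence[where w = "\<lambda>x. \<bar>f x\<bar>"])
    show "AE x in G. (\<lambda>n. h n x) \<longlonglongrightarrow> 0"
    proof (rule AE_I2)
      fix x
      have "(\<lambda>n. (f x)\<^sup>2 * inverse (real n)) \<longlonglongrightarrow> (f x)\<^sup>2 * 0"
        by (intro tendsto_intros lim_inverse_n)
      then have lim0: "(\<lambda>n. (f x)\<^sup>2 * inverse (real n)) \<longlonglongrightarrow> 0" by simp
      show "(\<lambda>n. h n x) \<longlonglongrightarrow> 0"
      proof (rule nonneg_tendsto_0[OF _ _ lim0])
        show "eventually (\<lambda>n. h n x \<le> (f x)\<^sup>2 * inverse (real n)) sequentially"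
          using eventually_gt_at_top[of 0]
        proof eventually_elim
          fix n :: nat assume "0 < n"
          have "h n x \<le> real n * (f x / real n)\<^sup>2" unfolding h_def by (intro mult_left_mono min.cobounded1) simp
          also have "\<dots> = (f x)\<^sup>2 * inverse (real n)" using \<open>0 < n\<close> by (simp add: power2_eq_square divide_inverse)
          finally show "h n x \<le> (f x)\<^sup>2 * inverse (real n)" .
        qed
      qed (auto simp: h_def)
    qed
  qed (use f hb in auto)
  have le: "prob {\<omega> \<in> space P. t \<le> (\<Sum>i<n. (f (X i \<omega>))\<^sup>2) / (real n)\<^sup>2} \<le> (\<integral>x. h n x \<partial>G) / t" if n: "0 < n" for n
  proof -
    let ?m = "\<lambda>x. min ((f x / real n)\<^sup>2) 1"
    have mint: "integrable G ?m" using integrable_mult_right[OF hint[of n], of "1 / real n"] n by (simp add: h_def)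
    have hbi: "has_bochner_integral P (\<lambda>\<omega>. \<Sum>i<n. ?m (X i \<omega>)) (\<Sum>i<n. \<integral>x. ?m x \<partial>G)"
      by (intro has_bochner_integral_sum has_bochner_integral_X mint)
    have "{\<omega> \<in> space P. t \<le> (\<Sum>i<n. (f (X i \<omega>))\<^sup>2) / (real n)\<^sup>2} \<subseteq> {\<omega> \<in> space P. t \<le> (\<Sum>i<n. ?m (X i \<omega>))}"
    proof safe
      fix \<omega> assume s: "t \<le> (\<Sum>i<n. (f (X i \<omega>))\<^sup>2) / (real n)\<^sup>2"
      \<comment> \<open>If some summand exceeds 1, its truncation alone already reaches t, as t
        \<le> 1. Otherwise truncation changes nothing.\<close>
      show "t \<le> (\<Sum>i<n. ?m (X i \<omega>))"
      proof (cases "\<exists>i<n. 1 < (f (X i \<omega>) / real n)\<^sup>2")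
        case True
        then obtain i where i: "i < n" "1 < (f (X i \<omega>) / real n)\<^sup>2" by blast
        have "?m (X i \<omega>) \<le> (\<Sum>i<n. ?m (X i \<omega>))" using i(1) by (intro member_le_sum) auto
        then show ?thesis using i(2) t(2) by simp
      next
        case False
        then have "(\<Sum>i<n. ?m (X i \<omega>)) = (\<Sum>i<n. (f (X i \<omega>) / real n)\<^sup>2)" by (intro sum.cong refl min_absorb1) (meson lessThan_iff not_less)
        then show ?thesis using s by (simp add: power_divide sum_divide_distrib)
      qed
    qed
    then have "prob {\<omega> \<in> space P. t \<le> (\<Sum>i<n. (f (X i \<omega>))\<^sup>2) / (real n)\<^sup>2} \<le> prob {\<omega> \<in> space P. t \<le> (\<Sum>i<n. ?m (X i \<omega>))}"
      by (intro finite_measure_mono) measurable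
    also have "\<dots> \<le> (\<Sum>i<n. \<integral>x. ?m x \<partial>G) / t"
      using has_bochner_integral_integral_eq[OF hbi] t
      by (intro Markov_le integrable.intros[OF hbi]) (auto intro!: sum_nonneg)
    also have "(\<Sum>i<n. \<integral>x. ?m x \<partial>G) = (\<integral>x. h n x \<partial>G)" by (simp add: h_def)
    finally show ?thesis .
  qed
  show ?thesis
  proof (rule nonneg_tendsto_0)
    show "eventually (\<lambda>n. prob {\<omega> \<in> space P. t \<le> (\<Sum>i<n. (f (X i \<omega>))\<^sup>2) / (real n)\<^sup>2} \<le> (\<integral>x. h n x \<partial>G) / t) sequentially"
      using eventually_gt_at_top[of 0] by eventually_elim (rule le)
    show "(\<lambda>n. (\<integral>x. h n x \<partial>G) / t) \<longlonglongrightarrow> 0" using tendsto_divide[OF lim tendsto_const[of t]] t by simp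
  qed simp
qed

text \<open>The last term is written as n times a quantity that vanishes in probability: in a
  product with \<open>V2\<close> the factor n is absorbed, since n * \<open>V2\<close> is bounded in
  mean.\<close>

lemma sigma2_hat_le_squares:
  assumes prior: "prior_bounded B a b J \<zeta> lam" and J: "0 < J" and n: "0 < n"
    and X: "\<And>i. i < n \<Longrightarrow> X i \<omega> \<in> {0..1}"
  shows "sigma2_hat J \<zeta> lam n (Xs \<omega>) (Ys f \<omega>)
    \<le> 3 * B\<^sup>2 + 3 * mean_sq_noise n \<omega> + 3 * real n * ((\<Sum>i<n. (f (X i \<omega>))\<^sup>2) / (real n)\<^sup>2)"
proof -
  have "sigma2_hat J \<zeta> lam n (Xs \<omega>) (Ys f \<omega>)
      \<le> (\<Sum>i<n. (f (X i \<omega>) + eps i \<omega> - \<zeta> (cell_index J (X i \<omega>)))\<^sup>2) / real n"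
    by (rule sigma2_hat_bounds(2)[OF J])
  also have "\<dots> \<le> (\<Sum>i<n. 3 * B\<^sup>2 + 3 * (eps i \<omega>)\<^sup>2 + 3 * (f (X i \<omega>))\<^sup>2) / real n"
  proof (intro divide_right_mono sum_mono)
    fix i assume "i \<in> {..<n}"
    then have x: "X i \<omega> \<in> {0..1}" using X by simp
    obtain j where j: "j \<in> indices J" "X i \<omega> \<in> cell J j" using ex_cell[OF x J] .
    define u where "u = \<zeta> (cell_index J (X i \<omega>))"
    have "\<bar>u\<bar> \<le> B" using prior_boundedD(4)[OF prior j(1)] by (simp add: u_def cell_index_eq[OF j(1) J j(2)])
    then have "u\<^sup>2 \<le> B\<^sup>2" by (metis abs_ge_zero power2_abs power_mono)
    moreover have "(y + z - u)\<^sup>2 \<le> 3 * u\<^sup>2 + 3 * z\<^sup>2 + 3 * y\<^sup>2" for y z :: real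
    proof -
      have "0 \<le> (y - z)\<^sup>2 + (y + u)\<^sup>2 + (z + u)\<^sup>2" by simp
      then show ?thesis by (simp add: power2_eq_square algebra_simps)
    qed
    ultimately show "(f (X i \<omega>) + eps i \<omega> - \<zeta> (cell_index J (X i \<omega>)))\<^sup>2 \<le> 3 * B\<^sup>2 + 3 * (eps i \<omega>)\<^sup>2 + 3 * (f (X i \<omega>))\<^sup>2"
      unfolding u_def[symmetric] by (meson add_right_mono mult_left_mono order_trans zero_le_numeral)
  qed simp
  also have "\<dots> = 3 * B\<^sup>2 + 3 * mean_sq_noise n \<omega> + 3 * real n * ((\<Sum>i<n. (f (X i \<omega>))\<^sup>2) / (real n)\<^sup>2)"
    using n by (simp add: sum.distrib mean_sq_noise_def add_divide_distrib sum_distrib_left[symmetric] power2_eq_square)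
  finally show ?thesis .
qed

end

section \<open>Consistency\<close>

context random_design
begin

text \<open>Bias of the posterior mean when \<open>f\<close> is unbounded. It is random, but its
  expectation is at most the L1 error of the step approximation; empty cells contribute 0.\<close>

definition cell_dev :: "nat \<Rightarrow> (real ^ 'd \<Rightarrow> real) \<Rightarrow> (('d \<Rightarrow> nat) \<Rightarrow> real) \<Rightarrow> nat \<Rightarrow> 'w \<Rightarrow> real" where
  "cell_dev J f \<theta> n \<omega> = (\<Sum>j\<in>indices J. cell_prob J j *
     ((\<Sum>i<n. indicator (cell J j) (X i \<omega>) * \<bar>f (X i \<omega>) - \<theta> j\<bar>) / (\<Sum>k<n. indicator (cell J j) (X k \<omega>))))"

lemma cell_dev_nonneg: "0 \<le> cell_dev J f \<theta> n \<omega>"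
  unfolding cell_dev_def by (intro sum_nonneg mult_nonneg_nonneg divide_nonneg_nonneg) auto

lemma expectation_cell_dev:
  assumes f: "integrable G f" and J: "0 < J"
  shows "integrable P (cell_dev J f \<theta> n)"
    and "expectation (cell_dev J f \<theta> n) \<le> (\<integral>x. \<bar>f x - step_fn J \<theta> x\<bar> \<partial>G)"
proof -
  interpret G: prob_space G by (rule prob_space_G)
  have fm [measurable]: "f \<in> borel_measurable borel" using f by (simp add: measurable_cong_sets[OF sets_G refl, symmetric])
  have int: "integrable G (\<lambda>x. \<bar>f x - \<theta> j\<bar>)" for j using f by auto
  note ca = expectation_cell_average_le[OF int abs_ge_zero cell_measurable]
  have h: "has_bochner_integral P (cell_dev J f \<theta> n) (\<Sum>j\<in>indices J. cell_prob J j * expectation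
      (\<lambda>\<omega>. (\<Sum>i<n. indicator (cell J j) (X i \<omega>) * \<bar>f (X i \<omega>) - \<theta> j\<bar>) / (\<Sum>k<n. indicator (cell J j) (X k \<omega>))))"
    unfolding cell_dev_def
    by (intro has_bochner_integral_sum has_bochner_integral_mult_right has_bochner_integral_integrable ca(1))
  show "integrable P (cell_dev J f \<theta> n)" using h by (rule integrable.intros)
  have ii: "integrable G (\<lambda>x. indicator (cell J j) x * \<bar>f x - \<theta> j\<bar>)" for j
    using integrable_real_mult_indicator[OF _ int, of "cell J j"] by (simp add: mult.commute)
  have pw: "(\<Sum>j\<in>indices J. indicator (cell J j) x * \<bar>f x - \<theta> j\<bar>) \<le> \<bar>f x - step_fn J \<theta> x\<bar>" for x
  proof (cases "\<exists>j\<in>indices J. x \<in> cell J j")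
    case True
    then obtain j where j: "j \<in> indices J" "x \<in> cell J j" by blast
    have "(\<Sum>j\<in>indices J. indicator (cell J j) x * \<bar>f x - \<theta> j\<bar>) = step_fn J (\<lambda>j. \<bar>f x - \<theta> j\<bar>) x"
      by (simp only: step_fn_def mult.commute)
    also have "\<dots> = \<bar>f x - step_fn J \<theta> x\<bar>" by (simp only: step_fn_eq[OF j(1) J j(2)])
    finally show ?thesis by simp
  next
    case False
    then have "(\<Sum>j\<in>indices J. indicator (cell J j) x * \<bar>f x - \<theta> j\<bar>) = 0" by (intro sum.neutral) auto
    then show ?thesis by simp
  qed
  have "expectation (cell_dev J f \<theta> n) \<le> (\<Sum>j\<in>indices J. \<integral>x. indicator (cell J j) x * \<bar>f x - \<theta> j\<bar> \<partial>G)"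
    unfolding has_bochner_integral_integral_eq[OF h] by (intro sum_mono ca(2))
  also have "\<dots> = (\<integral>x. (\<Sum>j\<in>indices J. indicator (cell J j) x * \<bar>f x - \<theta> j\<bar>) \<partial>G)"
    by (rule Bochner_Integration.integral_sum[symmetric]) (rule ii)
  also have "\<dots> \<le> (\<integral>x. \<bar>f x - step_fn J \<theta> x\<bar> \<partial>G)"
    using f integrable_step_fn[OF prob_space_G sets_G, of J \<theta>]
    by (intro integral_mono pw Bochner_Integration.integrable_sum ii) auto
  finally show "expectation (cell_dev J f \<theta> n) \<le> (\<integral>x. \<bar>f x - step_fn J \<theta> x\<bar> \<partial>G)" .
qed

text \<open>The separating functional is at least e - 2 * \<delta>, hence 7e/8, at
  \<open>\<theta>\<close> and at most r \<le> e/8 on the neighbourhood, while the posterior mean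
  deviates from \<open>\<theta>\<close> by at most 3e/8. A draw in the neighbourhood thus moves the
  functional by at least 3e/8, more than the e/4 used in Chebyshev's bound. The resulting variance
  is split in two, and each part gets half of the allowance for \<open>\<gamma>\<close>.\<close>

lemma posterior_near_monotone_less:
  assumes S: "valid_treatment S" and prior: "prior_bounded B a b J \<zeta> lam" and J: "0 < J" and n: "4 \<le> n"
    and C: "0 < C" "\<And>n s. 4 \<le> n \<Longrightarrow> 0 \<le> s \<Longrightarrow> post_var S n s \<le> C * (1 + s)"
    and X: "\<And>i. i < n \<Longrightarrow> X i \<omega> \<in> {0..1}"
    and e: "0 < e" and \<delta>: "0 < \<delta>" "16 * \<delta> \<le> e" and r: "r \<le> e / 8"
    and far: "\<And>c. c \<in> monotone_coefs J \<Longrightarrow> e - \<delta> \<le> (\<Sum>j\<in>indices J. cell_prob J j * \<bar>\<theta> j - c j\<bar>)"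
    and \<theta>: "\<And>j. \<bar>\<theta> j\<bar> \<le> \<beta>"
    and 1: "cell_dev J f \<theta> n \<omega> < e / 8" and 2: "noise_L1 J lam n \<omega> < e / 8"
    and 3: "(B + \<beta>) / a * V1 J lam n (Xs \<omega>) < e / 8"
    and 4: "(C * (1 + 3 * B\<^sup>2) + 3 * C * mean_sq_noise n \<omega>) * V2 J lam n (Xs \<omega>) < \<gamma> * (e / 4)\<^sup>2 / 2"
    and 5: "real n * V2 J lam n (Xs \<omega>) < \<kappa>" and 6: "(\<Sum>i<n. (f (X i \<omega>))\<^sup>2) / (real n)\<^sup>2 < \<tau>"
    and \<kappa>\<tau>: "0 < \<kappa>" "0 < \<tau>" "3 * C * \<kappa> * \<tau> \<le> \<gamma> * (e / 4)\<^sup>2 / 2"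
  shows "posterior S J \<zeta> lam n (Xs \<omega>) (Ys f \<omega>) {h. L1_setdist G h (monotone_step_fns J) \<le> r} < \<gamma>"
proof -
  interpret G: prob_space G by (rule prob_space_G)
  let ?X = "Xs \<omega>" and ?Y = "Ys f \<omega>"
  let ?m = "post_mean J \<zeta> lam n ?X ?Y"
  let ?p = "cell_prob J"
  let ?s = "sigma2_hat J \<zeta> lam n ?X ?Y"
  let ?V = "V2 J lam n ?X"
  let ?Q = "(\<Sum>i<n. (f (X i \<omega>))\<^sup>2) / (real n)\<^sup>2"
  let ?A = "{h. L1_setdist G h (monotone_step_fns J) \<le> r}"
  obtain w where w: "\<And>j. \<bar>w j\<bar> \<le> 1" "\<And>c. c \<in> monotone_coefs J \<Longrightarrow> (\<Sum>j\<in>indices J. ?p j * w j * c j) \<le> 0"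
    "e - \<delta> - \<delta> \<le> (\<Sum>j\<in>indices J. ?p j * w j * \<theta> j)"
  proof (rule separating_weights[where I = "indices J" and p = ?p and R = "(\<le>)" and e = "e - \<delta>" and \<theta> = \<theta> and \<delta> = \<delta>])
    show "e - \<delta> \<le> (\<Sum>j\<in>indices J. ?p j * \<bar>\<theta> j - c j\<bar>)"
      if "c \<in> {c. \<forall>i\<in>indices J. \<forall>j\<in>indices J. i \<le> j \<longrightarrow> c i \<le> c j}" for c
      using that by (intro far) (simp add: monotone_coefs_def)
    fix w :: "('d \<Rightarrow> nat) \<Rightarrow> real"
    assume "\<And>i. \<bar>w i\<bar> \<le> 1"
      and "\<And>c. c \<in> {c. \<forall>i\<in>indices J. \<forall>j\<in>indices J. i \<le> j \<longrightarrow> c i \<le> c j} \<Longrightarrow> (\<Sum>j\<in>indices J. ?p j * w j * c j) \<le> 0"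
      and "e - \<delta> - \<delta> \<le> (\<Sum>j\<in>indices J. ?p j * w j * \<theta> j)"
    then show thesis by (intro that[of w]) (simp_all add: monotone_coefs_def)
  qed (use \<delta>(1) sum_cell_prob_le[OF J] in auto)
  have bias: "(\<Sum>i<n. indicator (cell J j) (X i \<omega>) * \<bar>f (X i \<omega>) - \<theta> j\<bar>) / post_prec J lam n ?X j
      \<le> (\<Sum>i<n. indicator (cell J j) (X i \<omega>) * \<bar>f (X i \<omega>) - \<theta> j\<bar>) / (\<Sum>k<n. indicator (cell J j) (X k \<omega>))"
    if j: "j \<in> indices J" for j
  proof (cases "cell_count J n ?X j = 0")
    case True
    then have "indicator (cell J j) (X i \<omega>) = (0::real)" if "i < n" for i
      using that unfolding cell_count_eq by (subst (asm) sum_nonneg_eq_0_iff) auto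
    then show ?thesis by simp
  next
    case False
    then have N: "0 < cell_count J n ?X j" using cell_count_nonneg[of J n ?X j] by linarith
    then show ?thesis unfolding cell_count_eq[symmetric]
      by (intro divide_left_mono sum_nonneg mult_nonneg_nonneg mult_pos_pos) (auto simp: post_prec_def intro!: add_pos_nonneg)
  qed
  have "(\<Sum>j\<in>indices J. ?p j * \<bar>?m j - \<theta> j\<bar>)
      \<le> (\<Sum>j\<in>indices J. ?p j * ((\<Sum>i<n. indicator (cell J j) (X i \<omega>) * \<bar>f (X i \<omega>) - \<theta> j\<bar>) / post_prec J lam n ?X j))
        + noise_L1 J lam n \<omega> + (B + \<beta>) / a * V1 J lam n ?X"
    using \<theta> by (intro post_mean_L1_deviation[OF prior]) auto
  also have "(\<Sum>j\<in>indices J. ?p j * ((\<Sum>i<n. indicator (cell J j) (X i \<omega>) * \<bar>f (X i \<omega>) - \<theta> j\<bar>) / post_prec J lam n ?X j))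
      \<le> cell_dev J f \<theta> n \<omega>"
    unfolding cell_dev_def by (intro sum_mono mult_left_mono bias) auto
  finally have dev: "(\<Sum>j\<in>indices J. ?p j * \<bar>?m j - \<theta> j\<bar>) \<le> 3 * e / 8" using 1 2 3 by linarith
  have wle: "(\<Sum>j\<in>indices J. ?p j * w j * x j) \<le> (\<Sum>j\<in>indices J. ?p j * \<bar>x j\<bar>)" for x
  proof (rule sum_mono)
    fix j
    have "w j * x j \<le> 1 * \<bar>x j\<bar>" using w(1)[of j] by (metis abs_ge_self abs_ge_zero abs_mult mult_right_mono order_trans)
    then show "?p j * w j * x j \<le> ?p j * \<bar>x j\<bar>" by (simp add: mult.assoc mult_left_mono)
  qed
  have lin: "e / 4 \<le> \<bar>\<Sum>j\<in>indices J. ?p j * w j * (\<theta>' j - ?m j)\<bar>" if A: "step_fn J \<theta>' \<in> ?A" for \<theta>'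
  proof -
    have "(\<Sum>j\<in>indices J. ?p j * w j * \<theta>' j) \<le> r + u" if u: "0 < u" for u
    proof -
      have "L1_setdist G (step_fn J \<theta>') (monotone_step_fns J) < r + u" using A u by simp
      moreover have "monotone_step_fns J \<noteq> ({} :: (real ^ 'd \<Rightarrow> real) set)"
        using monotone_coefs_nonempty by (auto simp: monotone_step_fns_eq[OF J])
      ultimately obtain h where h: "h \<in> monotone_step_fns J" "L1_dist G (step_fn J \<theta>') h < r + u"
        by (rule L1_setdist_nearD)
      then obtain c where c: "c \<in> monotone_coefs J" "h = step_fn J c" by (auto simp: monotone_step_fns_eq[OF J])
      \<comment> \<open>The functional is nonpositive at the monotone vector c, so its value at
        \<open>\<theta>'\<close> is at most the L1 distance from c.\<close>
      have "(\<Sum>j\<in>indices J. ?p j * w j * \<theta>' j) = (\<Sum>j\<in>indices J. ?p j * w j * c j) + (\<Sum>j\<in>indices J. ?p j * w j * (\<theta>' j - c j))"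
        by (simp add: sum.distrib[symmetric] algebra_simps)
      also have "\<dots> \<le> 0 + (\<Sum>j\<in>indices J. ?p j * \<bar>\<theta>' j - c j\<bar>)" by (intro add_mono w(2) c wle)
      also have "\<dots> = L1_dist G (step_fn J \<theta>') h"
        unfolding c(2) by (simp add: L1_dist_step_fn[OF G.finite_measure_axioms sets_G J])
      finally show ?thesis using h(2) by simp
    qed
    then have "(\<Sum>j\<in>indices J. ?p j * w j * \<theta>' j) \<le> r" by (rule field_le_epsilon)
    moreover have "(\<Sum>j\<in>indices J. ?p j * w j * (\<theta> j - ?m j)) \<le> 3 * e / 8"
      using wle[of "\<lambda>j. \<theta> j - ?m j"] dev by (simp add: abs_minus_commute)
    moreover have "(\<Sum>j\<in>indices J. ?p j * w j * (\<theta>' j - ?m j)) = (\<Sum>j\<in>indices J. ?p j * w j * \<theta>' j)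
        - (\<Sum>j\<in>indices J. ?p j * w j * \<theta> j) + (\<Sum>j\<in>indices J. ?p j * w j * (\<theta> j - ?m j))"
      by (simp add: sum.distrib[symmetric] sum_subtractf[symmetric] algebra_simps)
    ultimately show ?thesis using w(3) \<delta> r e by linarith
  qed
  have V0: "0 \<le> ?V" by (rule V2_nonneg)
  have "posterior S J \<zeta> lam n ?X ?Y ?A \<le> post_var S n ?s * (?V / (e / 4)\<^sup>2)"
  proof (rule posterior_le[OF S J n])
    show "0 \<le> ?V / (e / 4)\<^sup>2" using V0 by simp
    show "posterior_given J \<zeta> lam n ?X ?Y v ?A \<le> v * (?V / (e / 4)\<^sup>2)" if "0 \<le> v" for v
      unfolding V2_def
      by (rule posterior_given_le_linear[OF J that _ w(1) lin]) (use e in auto)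
  qed
  moreover have "post_var S n ?s * ?V / (e / 4)\<^sup>2 < \<gamma>"
  proof -
  have "post_var S n ?s * ?V < \<gamma> * (e / 4)\<^sup>2"
  proof -
    have s0: "0 \<le> ?s" by (rule sigma2_hat_bounds(1)[OF J])
    have n0: "0 < n" using n by simp
    have "post_var S n ?s \<le> C * (1 + ?s)" by (rule C(2)[OF n s0])
    also have "\<dots> \<le> C * (1 + (3 * B\<^sup>2 + 3 * mean_sq_noise n \<omega> + 3 * real n * ?Q))"
      using C(1) by (intro mult_left_mono add_left_mono sigma2_hat_le_squares[OF prior J n0 X]) auto
    also have "\<dots> = (C * (1 + 3 * B\<^sup>2) + 3 * C * mean_sq_noise n \<omega>) + 3 * C * (real n * ?Q)"
      by (simp add: algebra_simps)
    finally have "post_var S n ?s * ?V \<le> ((C * (1 + 3 * B\<^sup>2) + 3 * C * mean_sq_noise n \<omega>) + 3 * C * (real n * ?Q)) * ?V"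
      using V0 by (rule mult_right_mono)
    also have "\<dots> = (C * (1 + 3 * B\<^sup>2) + 3 * C * mean_sq_noise n \<omega>) * ?V + 3 * C * ((real n * ?V) * ?Q)"
    proof -
      have "(x + 3 * C * (y * z)) * v = x * v + 3 * C * ((y * v) * z)" for x y z v :: real
        by (simp add: algebra_simps)
      then show ?thesis .
    qed
    also have "3 * C * ((real n * ?V) * ?Q) \<le> 3 * C * (\<kappa> * \<tau>)"
      using C(1) 5 6 V0 \<kappa>\<tau> by (intro mult_left_mono mult_mono) (auto intro!: divide_nonneg_nonneg sum_nonneg)
    finally have le: "post_var S n ?s * ?V
        \<le> (C * (1 + 3 * B\<^sup>2) + 3 * C * mean_sq_noise n \<omega>) * ?V + 3 * C * (\<kappa> * \<tau>)"
      by simp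
    define u where "u = \<gamma> * (e / 4)\<^sup>2 / 2"
    have "3 * C * (\<kappa> * \<tau>) \<le> u" using \<kappa>\<tau>(3) by (simp only: mult.assoc u_def)
    then have "post_var S n ?s * ?V < u + u" using le 4 unfolding u_def[symmetric] by linarith
    then show ?thesis by (simp add: u_def)
  qed
  then show ?thesis using e by (subst pos_divide_less_eq) auto
  qed
  ultimately show ?thesis by simp
qed

end

context monotonicity_setting
begin

lemma J_tendsto: "filterlim J at_top sequentially"
proof -
  obtain K' where K': "0 < K'" "eventually (\<lambda>n. real (J n) ^ CARD('d) / real n \<le> K' * (rate n)\<^sup>2) sequentially"
    "eventually (\<lambda>n. 1 / real (J n) \<le> K' * rate n) sequentially" by (rule rates)
  show ?thesis unfolding filterlim_at_top
  proof
    fix Z :: nat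
    have "(\<lambda>n. K' * rate n) \<longlonglongrightarrow> K' * 0" by (intro tendsto_intros rate_tendsto)
    then have "eventually (\<lambda>n. K' * rate n < 1 / real (Suc Z)) sequentially" by (intro order_tendstoD) auto
    with K'(3) show "eventually (\<lambda>n. Z \<le> J n) sequentially"
    proof eventually_elim
      fix n assume "1 / real (J n) \<le> K' * rate n" "K' * rate n < 1 / real (Suc Z)"
      then have "1 / real (J n) < 1 / real (Suc Z)" by linarith
      then have "real (Suc Z) < real (J n)" using J(1)[of n] by (simp add: field_simps)
      then show "Z \<le> J n" by simp
    qed
  qed
qed

lemma cells_over_n_tendsto: "(\<lambda>n. real (J n) ^ CARD('d) / real n) \<longlonglongrightarrow> 0"
proof -
  obtain K' where K': "0 < K'" "eventually (\<lambda>n. real (J n) ^ CARD('d) / real n \<le> K' * (rate n)\<^sup>2) sequentially"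
    "eventually (\<lambda>n. 1 / real (J n) \<le> K' * rate n) sequentially" by (rule rates)
  have "(\<lambda>n. K' * (rate n)\<^sup>2) \<longlonglongrightarrow> K' * 0\<^sup>2" by (intro tendsto_intros rate_tendsto)
  then have "(\<lambda>n. K' * (rate n)\<^sup>2) \<longlonglongrightarrow> 0" by simp
  from nonneg_tendsto_0[OF _ K'(2) this] show ?thesis by simp
qed

text \<open>One event is excluded for each condition of \<open>posterior_near_monotone_less\<close>.
  The terms 8 * \<delta> / e and b / \<kappa> do not vanish with n; they are kept apart because they
  are made small through the choice of \<delta> and \<kappa>. The Borel function \<open>f\<close>
  stands in for \<open>f0\<close>, with which it agrees at all design points almost surely.\<close>

lemma acceptance_probability_le:
  fixes f f0 :: "real ^ 'd \<Rightarrow> real"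
  assumes n: "4 \<le> n" and f: "integrable G f" and f0: "AE x in G. f0 x = f x"
    and C: "0 < C" "\<And>n s. 4 \<le> n \<Longrightarrow> 0 \<le> s \<Longrightarrow> post_var S n s \<le> C * (1 + s)"
    and e: "0 < e" and \<delta>: "0 < \<delta>" "16 * \<delta> \<le> e" and r: "M n * rate n \<le> e / 8"
    and gap: "\<And>h. h \<in> monotone_step_fns (J n) \<Longrightarrow> e \<le> (\<integral>x. \<bar>f x - h x\<bar> \<partial>G)"
    and \<theta>: "\<And>j. \<bar>\<theta> j\<bar> \<le> \<beta>" "(\<integral>x. \<bar>f x - step_fn (J n) \<theta> x\<bar> \<partial>G) \<le> \<delta>" and \<beta>: "0 \<le> \<beta>"
    and \<kappa>\<tau>: "0 < \<kappa>" "0 < \<tau>" "3 * C * \<kappa> * \<tau> \<le> \<gamma> * (e / 4)\<^sup>2 / 2"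
  defines "q \<equiv> real (J n) ^ CARD('d) / real n"
  shows "acceptance n f0
    \<le> 8 * \<delta> / e + b / \<kappa> + (\<sigma>0\<^sup>2 * b / (e / 8)\<^sup>2 * q + (B + \<beta>) / a * b / (e / 8) * q
      + (C * (1 + 3 * B\<^sup>2) + 3 * C * \<sigma>0\<^sup>2) * b / (\<gamma> * (e / 4)\<^sup>2 / 2) * (1 / real n)
      + prob {\<omega> \<in> space P. \<tau> \<le> (\<Sum>i<n. (f (X i \<omega>))\<^sup>2) / (real n)\<^sup>2})"
proof -
  have fm [measurable]: "f \<in> borel_measurable borel" using f by (simp add: measurable_cong_sets[OF sets_G refl, symmetric])
  let ?J = "J n" and ?lam = "lam n"
  have n0: "0 < n" using n by simp
  note st = integrable_step_fn[OF prob_space_G sets_G]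
  have far: "e - \<delta> \<le> (\<Sum>j\<in>indices ?J. cell_prob ?J j * \<bar>\<theta> j - c j\<bar>)" if c: "c \<in> monotone_coefs ?J" for c
  proof -
    have "e \<le> (\<integral>x. \<bar>f x - step_fn ?J c x\<bar> \<partial>G)"
      using c by (intro gap) (auto simp: monotone_step_fns_eq[OF J(1)])
    also have "\<dots> \<le> (\<integral>x. \<bar>f x - step_fn ?J \<theta> x\<bar> + \<bar>step_fn ?J \<theta> x - step_fn ?J c x\<bar> \<partial>G)"
      using f st[of ?J \<theta>] st[of ?J c] by (intro integral_mono) auto
    also have "\<dots> = (\<integral>x. \<bar>f x - step_fn ?J \<theta> x\<bar> \<partial>G) + (\<integral>x. \<bar>step_fn ?J \<theta> x - step_fn ?J c x\<bar> \<partial>G)"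
      using f st[of ?J \<theta>] st[of ?J c] by (intro Bochner_Integration.integral_add) auto
    also have "(\<integral>x. \<bar>step_fn ?J \<theta> x - step_fn ?J c x\<bar> \<partial>G) = L1_dist G (step_fn ?J \<theta>) (step_fn ?J c)"
      unfolding L1_dist_def by (rule integral_completion[symmetric]) measurable
    finally show ?thesis using \<theta>(2) by (simp add: cell_prob_L1_dist)
  qed
  have [measurable]: "(\<lambda>\<omega>. V1 ?J ?lam n (Xs \<omega>)) \<in> borel_measurable P" "(\<lambda>\<omega>. V2 ?J ?lam n (Xs \<omega>)) \<in> borel_measurable P"
    by (rule measurable_compose[OF X_process_measurable V1_measurable], rule measurable_compose[OF X_process_measurable V2_measurable])
  have b0: "0 \<le> b" "0 \<le> (B + \<beta>) / a" using ab \<beta> by auto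
  define c1 where "c1 = C * (1 + 3 * B\<^sup>2)"
  define c2 where "c2 = 3 * C"
  have c: "0 \<le> c1" "0 \<le> c2" using C(1) by (auto simp: c1_def c2_def)
  have g: "0 < \<gamma> * (e / 4)\<^sup>2 / 2" using \<gamma>(1) e by simp
  note e4 = expectation_affine_noise[OF V2_measurable expectation_V2[OF prior[of n] n0 J(1)[of n]] n0 c]
  note cd = expectation_cell_dev[OF f J(1), of n \<theta> n]
  have cdm [measurable]: "cell_dev ?J f \<theta> n \<in> borel_measurable P" using cd(1) by (rule borel_measurable_integrable)
  define E1 where "E1 = {\<omega> \<in> space P. e / 8 \<le> cell_dev ?J f \<theta> n \<omega>}"
  define E2 where "E2 = {\<omega> \<in> space P. e / 8 \<le> noise_L1 ?J ?lam n \<omega>}"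
  define E3 where "E3 = {\<omega> \<in> space P. e / 8 \<le> (B + \<beta>) / a * V1 ?J ?lam n (Xs \<omega>)}"
  define E4 where "E4 = {\<omega> \<in> space P. \<gamma> * (e / 4)\<^sup>2 / 2 \<le> (c1 + c2 * mean_sq_noise n \<omega>) * V2 ?J ?lam n (Xs \<omega>)}"
  define E5 where "E5 = {\<omega> \<in> space P. \<kappa> \<le> real n * V2 ?J ?lam n (Xs \<omega>)}"
  define E6 where "E6 = {\<omega> \<in> space P. \<tau> \<le> (\<Sum>i<n. (f (X i \<omega>))\<^sup>2) / (real n)\<^sup>2}"
  have Em: "E1 \<in> events" "E2 \<in> events" "E3 \<in> events" "E4 \<in> events" "E5 \<in> events" "E6 \<in> events"
    unfolding E1_def E2_def E3_def E4_def E5_def E6_def by measurable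
  have "prob E1 \<le> \<delta> / (e / 8)"
    unfolding E1_def by (rule Markov_le[OF cd(1) cell_dev_nonneg _ order_trans[OF cd(2) \<theta>(2)]]) (use e in simp)
  then have P1: "prob E1 \<le> 8 * \<delta> / e" by (simp add: field_simps)
  have "prob E2 \<le> \<sigma>0\<^sup>2 * b * q / (e / 8)\<^sup>2"
    unfolding E2_def q_def using e by (intro noise_L1_tail[OF prior[of n] n0 J(1)]) auto
  then have P2: "prob E2 \<le> \<sigma>0\<^sup>2 * b / (e / 8)\<^sup>2 * q" by simp
  have "prob E3 \<le> ((B + \<beta>) / a * (b * q)) / (e / 8)"
    unfolding E3_def q_def
  proof (rule Markov_le)
    show "integrable P (\<lambda>\<omega>. (B + \<beta>) / a * V1 ?J ?lam n (Xs \<omega>))"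
      by (intro integrable_mult_right expectation_V1(1)[OF prior[of n] n0])
    show "expectation (\<lambda>\<omega>. (B + \<beta>) / a * V1 ?J ?lam n (Xs \<omega>)) \<le> (B + \<beta>) / a * (b * (real ?J ^ CARD('d) / real n))"
      unfolding integral_mult_right_zero using b0(2) by (intro mult_left_mono expectation_V1(2)[OF prior[of n] n0]) auto
    show "0 \<le> (B + \<beta>) / a * V1 ?J ?lam n (Xs \<omega>)" for \<omega> using b0(2) V1_nonneg by (rule mult_nonneg_nonneg)
  qed (use e in simp)
  then have P3: "prob E3 \<le> (B + \<beta>) / a * b / (e / 8) * q" by (simp add: ac_simps)
  have "prob E4 \<le> ((c1 + c2 * \<sigma>0\<^sup>2) * (b / real n)) / (\<gamma> * (e / 4)\<^sup>2 / 2)"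
    unfolding E4_def
    by (rule Markov_le[OF e4(1) _ g e4(2)]) (intro mult_nonneg_nonneg add_nonneg_nonneg c mean_sq_noise_nonneg V2_nonneg)
  then have P4: "prob E4 \<le> (c1 + c2 * \<sigma>0\<^sup>2) * b / (\<gamma> * (e / 4)\<^sup>2 / 2) * (1 / real n)" by (simp add: ac_simps)
  have P5: "prob E5 \<le> b / \<kappa>"
    unfolding E5_def
  proof (rule Markov_le)
    show "integrable P (\<lambda>\<omega>. real n * V2 ?J ?lam n (Xs \<omega>))"
      by (intro integrable_mult_right expectation_V2(1)[OF prior[of n] n0 J(1)])
    show "expectation (\<lambda>\<omega>. real n * V2 ?J ?lam n (Xs \<omega>)) \<le> b"
      using mult_left_mono[OF expectation_V2(2)[OF prior[of n] n0 J(1)], of "real n"] n0 by simp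
  qed (use \<kappa>\<tau> V2_nonneg in auto)
  define E where "E = E1 \<union> E2 \<union> E3 \<union> E4 \<union> E5 \<union> E6"
  have E: "E \<in> events" unfolding E_def using Em by auto
  have "prob E \<le> prob E1 + prob E2 + prob E3 + prob E4 + prob E5 + prob E6"
    unfolding E_def using Em by (intro order_trans[OF measure_Un_le] add_right_mono order_refl) auto
  then have PE: "prob E \<le> 8 * \<delta> / e + b / \<kappa> + (\<sigma>0\<^sup>2 * b / (e / 8)\<^sup>2 * q + (B + \<beta>) / a * b / (e / 8) * q
      + (c1 + c2 * \<sigma>0\<^sup>2) * b / (\<gamma> * (e / 4)\<^sup>2 / 2) * (1 / real n) + prob E6)"
    using P1 P2 P3 P4 P5 by linarith
  have "acceptance n f0 \<le> prob E"
    unfolding true_expectation_def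
  proof (rule test_expectation_le[OF E])
    have "AE \<omega> in P. \<forall>i. X i \<omega> \<in> {0..1}" unfolding AE_all_countable using AE_X[OF cube] by blast
    moreover have "AE \<omega> in P. \<forall>i. f0 (X i \<omega>) = f (X i \<omega>)" unfolding AE_all_countable using AE_X[OF f0] by blast
    ultimately show "AE \<omega> in P. 1 - test n (Xs \<omega>) (Ys f0 \<omega>) \<le> indicator E \<omega>"
      using AE_space
    proof eventually_elim
      fix \<omega> assume X: "\<forall>i. X i \<omega> \<in> {0..1}" and f0: "\<forall>i. f0 (X i \<omega>) = f (X i \<omega>)" and sp: "\<omega> \<in> space P"
      have Y: "(Ys f0 \<omega>) = (Ys f \<omega>)" using f0 by simp
      show "1 - test n (Xs \<omega>) (Ys f0 \<omega>) \<le> indicator E \<omega>"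
      proof (cases "\<omega> \<in> E")
        case False
        have "posterior S ?J (\<zeta> n) ?lam n (Xs \<omega>) (Ys f \<omega>) (nbhd n) < \<gamma>"
        proof (rule posterior_near_monotone_less[OF S prior J(1) n C _ e \<delta> r far \<theta>(1)])
          show "X i \<omega> \<in> {0..1}" for i using X by blast
          show "cell_dev ?J f \<theta> n \<omega> < e / 8" using False sp by (auto simp: E_def E1_def)
          show "noise_L1 ?J ?lam n \<omega> < e / 8" using False sp by (auto simp: E_def E2_def)
          show "(B + \<beta>) / a * V1 ?J ?lam n (Xs \<omega>) < e / 8" using False sp by (auto simp: E_def E3_def)
          show "(C * (1 + 3 * B\<^sup>2) + 3 * C * mean_sq_noise n \<omega>) * V2 ?J ?lam n (Xs \<omega>) < \<gamma> * (e / 4)\<^sup>2 / 2"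
            using False sp unfolding c1_def[symmetric] c2_def[symmetric] by (auto simp: E_def E4_def)
          show "real n * V2 ?J ?lam n (Xs \<omega>) < \<kappa>" using False sp by (auto simp: E_def E5_def)
          show "(\<Sum>i<n. (f (X i \<omega>))\<^sup>2) / (real n)\<^sup>2 < \<tau>" using False sp by (auto simp: E_def E6_def)
        qed (use \<kappa>\<tau> in auto)
        then show ?thesis by (simp add: monotonicity_test_def Y)
      qed (simp add: test_bounds)
    qed
  qed
  then show ?thesis using PE unfolding c1_def c2_def E6_def by linarith
qed

text \<open>Being outside the closure gives a fixed gap e to the cone, and the shrinking radius
  eventually falls below e/8. A Borel version of \<open>f0\<close> is used since \<open>f0\<close>
  is measurable for the completion only.\<close>

theorem test_consistent:
  assumes f0: "integrable (completion G) f0" "f0 \<notin> L1_closure G monotone_fns"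
    and rad: "(\<lambda>n. M n * rate n) \<longlonglongrightarrow> 0"
  shows "(\<lambda>n. acceptance n f0) \<longlonglongrightarrow> 0"
proof -
  obtain f where fm: "f \<in> borel_measurable G" and AE: "AE x in G. f0 x = f x"
    using completion_ex_borel_measurable_real[of f0 G] borel_measurable_integrable[OF f0(1)] by blast
  have AEc: "AE x in completion G. f0 x = f x" using AE by (rule AE_completion)
  have fc: "f \<in> borel_measurable (completion G)" using fm by (rule measurable_completion)
  have f: "integrable G f"
    using f0(1) fm integrable_cong_AE[OF borel_measurable_integrable[OF f0(1)] fc AEc] by (simp add: integrable_completion)
  obtain e where e: "0 < e" "\<And>h. h \<in> monotone_fns \<Longrightarrow> e \<le> L1_dist G f0 h"
    using f0 by (force simp: L1_closure_def not_less)
  have gap: "e \<le> (\<integral>x. \<bar>f x - h x\<bar> \<partial>G)" if h: "h \<in> monotone_step_fns (J n)" for n h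
  proof -
    have hm: "h \<in> borel_measurable G"
      using h unfolding monotone_step_fns_eq[OF J(1)] by (auto simp: measurable_cong_sets[OF sets_G refl])
    have "e \<le> L1_dist G f0 h" using h by (intro e) (simp add: monotone_step_fns_def)
    also have "\<dots> = (\<integral>x. \<bar>f x - h x\<bar> \<partial>completion G)"
      unfolding L1_dist_def using borel_measurable_integrable[OF f0(1)] fc measurable_completion[OF hm] AEc
      by (intro integral_cong_AE) auto
    also have "\<dots> = (\<integral>x. \<bar>f x - h x\<bar> \<partial>G)" by (intro integral_completion borel_measurable_abs borel_measurable_diff fm hm)
    finally show ?thesis .
  qed
  obtain C where C: "0 < C" "\<And>n s. 4 \<le> n \<Longrightarrow> 0 \<le> s \<Longrightarrow> post_var S n s \<le> C * (1 + s)"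
    using post_var_le[OF S] by metis
  have "eventually (\<lambda>n. acceptance n f0 < \<eta>) sequentially" if \<eta>: "0 < \<eta>" for \<eta>
  proof -
    \<comment> \<open>All constants are fixed in terms of \<eta> before n: \<delta> and \<kappa>
      make the two non-vanishing terms at most \<eta>/4 each, \<tau> is then adapted to \<kappa>,
      and the remaining terms tend to 0 and eventually take less than a third quarter.\<close>
    define \<delta> where "\<delta> = min (e / 16) (\<eta> * e / 32)"
    have \<delta>: "0 < \<delta>" "16 * \<delta> \<le> e" "8 * \<delta> / e \<le> \<eta> / 4" using e(1) \<eta> by (auto simp: \<delta>_def field_simps min_def)
    define \<kappa> where "\<kappa> = 4 * b / \<eta>"
    have \<kappa>: "0 < \<kappa>" "b / \<kappa> = \<eta> / 4" using ab \<eta> by (auto simp: \<kappa>_def)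
    define u where "u = \<gamma> * (e / 4)\<^sup>2 / 2"
    have u: "0 < u" using \<gamma>(1) e(1) by (simp add: u_def)
    define \<tau> where "\<tau> = min 1 (u / (3 * C * \<kappa>))"
    have \<tau>: "0 < \<tau>" "\<tau> \<le> 1" using u C(1) \<kappa> by (auto simp: \<tau>_def)
    have "3 * C * \<kappa> * \<tau> \<le> 3 * C * \<kappa> * (u / (3 * C * \<kappa>))" using C(1) \<kappa> by (intro mult_left_mono) (auto simp: \<tau>_def)
    then have \<kappa>\<tau>: "3 * C * \<kappa> * \<tau> \<le> \<gamma> * (e / 4)\<^sup>2 / 2" using C(1) \<kappa> by (simp add: u_def)
    \<comment> \<open>The bound \<open>\<beta>\<close> depends on \<delta> but not on n, so the
      coefficient (B + \<beta>) / a of the prior pull stays constant in the limit.\<close>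
    obtain \<beta> K where \<beta>: "0 \<le> \<beta>" and K: "\<And>J. K \<le> J \<Longrightarrow> 0 < J \<Longrightarrow>
        \<exists>\<theta>. (\<forall>j. \<bar>\<theta> j\<bar> \<le> \<beta>) \<and> (\<integral>x. \<bar>f x - step_fn J \<theta> x\<bar> \<partial>G) \<le> \<delta>"
      using integrable_step_approximable[OF prob_space_G sets_G cube f, unfolded step_approximable_def, rule_format, OF \<delta>(1)] by blast
    let ?R = "\<lambda>n. \<sigma>0\<^sup>2 * b / (e / 8)\<^sup>2 * (real (J n) ^ CARD('d) / real n) + (B + \<beta>) / a * b / (e / 8) * (real (J n) ^ CARD('d) / real n)
      + (C * (1 + 3 * B\<^sup>2) + 3 * C * \<sigma>0\<^sup>2) * b / (\<gamma> * (e / 4)\<^sup>2 / 2) * (1 / real n)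
      + prob {\<omega> \<in> space P. \<tau> \<le> (\<Sum>i<n. (f (X i \<omega>))\<^sup>2) / (real n)\<^sup>2}"
    have "?R \<longlonglongrightarrow> \<sigma>0\<^sup>2 * b / (e / 8)\<^sup>2 * 0 + (B + \<beta>) / a * b / (e / 8) * 0
      + (C * (1 + 3 * B\<^sup>2) + 3 * C * \<sigma>0\<^sup>2) * b / (\<gamma> * (e / 4)\<^sup>2 / 2) * 0 + 0"
      by (intro tendsto_add tendsto_mult tendsto_const cells_over_n_tendsto lim_1_over_n square_sum_tail_tendsto_0[OF f \<tau>])
    then have R: "eventually (\<lambda>n. ?R n < \<eta> / 4) sequentially" using \<eta> by (intro order_tendstoD) auto
    have r: "eventually (\<lambda>n. M n * rate n < e / 8) sequentially" using rad e(1) by (intro order_tendstoD) auto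
    have JK: "eventually (\<lambda>n. K \<le> J n) sequentially" using J_tendsto by (simp add: filterlim_at_top)
    show ?thesis
      using R r JK eventually_ge_at_top[of 4]
    proof eventually_elim
      fix n assume Rn: "?R n < \<eta> / 4" and rn: "M n * rate n < e / 8" and Jn: "K \<le> J n" and n: "4 \<le> n"
      obtain \<theta> where \<theta>: "\<And>j. \<bar>\<theta> j\<bar> \<le> \<beta>" "(\<integral>x. \<bar>f x - step_fn (J n) \<theta> x\<bar> \<partial>G) \<le> \<delta>" using K[OF Jn J(1)] by blast
      have "acceptance n f0 \<le> 8 * \<delta> / e + b / \<kappa> + ?R n"
        by (rule acceptance_probability_le[OF n f AE C e(1) \<delta>(1,2) less_imp_le[OF rn] gap \<theta> \<beta> \<kappa>(1) \<tau>(1) \<kappa>\<tau>])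
      also have "\<dots> < \<eta>" using Rn \<delta>(3) \<kappa>(2) \<eta> by linarith
      finally show "acceptance n f0 < \<eta>" .
    qed
  qed
  moreover have "c < acceptance n f0" if "c < 0" for c n
    using that true_expectation_nonneg(2)[of f0 n] by linarith
  ultimately show ?thesis by (intro order_tendstoI) (auto intro!: always_eventually)
qed

end

text \<open>The premises on \<open>M\<close> express that the neighbourhood must be smaller than the
  separation to be detected. A fixed function outside the closure has a constant positive distance
  from the cone, so the radius has to tend to 0. For \<alpha> < 1 the radius must be at most of the
  order of the separation, so that a constant \<open>C\<close> can dominate it. In the Lipschitz
  case the separation contains \<open>M\<close> itself. An empty alternative has supremum 0 in
  \<open>ennreal\<close>.\<close>

theorem theorem3p3:
  fixes G :: "(real ^ 'd) measure" and g :: "real ^ 'd \<Rightarrow> real"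
    and P :: "'w measure" and X :: "nat \<Rightarrow> 'w \<Rightarrow> real ^ 'd" and eps :: "nat \<Rightarrow> 'w \<Rightarrow> real"
    and Q :: "real measure" and \<sigma>0 :: real
    and J :: "nat \<Rightarrow> nat" and \<zeta> lam :: "nat \<Rightarrow> ('d \<Rightarrow> nat) \<Rightarrow> real"
    and M :: "nat \<Rightarrow> real" and \<gamma> :: real and S :: sigma_treatment
    and d :: real and \<phi> :: "nat \<Rightarrow> (nat \<Rightarrow> real ^ 'd) \<Rightarrow> (nat \<Rightarrow> real) \<Rightarrow> real"
  defines "d \<equiv> real CARD('d)"
  defines "\<phi> \<equiv> \<lambda>n. monotonicity_test G S \<gamma> (M n * real n powr (- 1 / (d + 2))) (J n) (\<zeta> n) (lam n) n"
  assumes G_density: "g \<in> borel_measurable borel" "\<And>x. 0 \<le> g x" "\<exists>B. \<forall>x. g x \<le> B"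
      "G = density lborel (\<lambda>x. ennreal (g x))"
    and G_cube: "AE x in G. x \<in> {0..1}"
    and P: "prob_space P"
    and X_iid: "prob_space.indep_vars P (\<lambda>_. borel) X UNIV" "\<And>i. distr P borel (X i) = G"
    and eps_iid: "prob_space.indep_vars P (\<lambda>_. borel) eps UNIV" "\<And>i. distr P borel (eps i) = Q"
    and X_eps_indep: "prob_space.indep_set P
      (sets (vimage_algebra (space P) (\<lambda>\<omega> i. X i \<omega>) (\<Pi>\<^sub>M i\<in>UNIV. borel)))
      (sets (vimage_algebra (space P) (\<lambda>\<omega> i. eps i \<omega>) (\<Pi>\<^sub>M i\<in>UNIV. borel)))"
    and eps_mean: "\<And>i. integrable P (eps i)" "\<And>i. prob_space.expectation P (eps i) = 0"
    and eps_var: "\<And>i. integrable P (\<lambda>\<omega>. (eps i \<omega>)\<^sup>2)" "\<And>i. prob_space.variance P (eps i) = \<sigma>0\<^sup>2"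
    and \<zeta>_bounded: "\<exists>B. \<forall>n. \<forall>j\<in>indices (J n). \<bar>\<zeta> n j\<bar> \<le> B"
    and lam_bounded: "\<exists>a>0. \<exists>b. \<forall>n. \<forall>j\<in>indices (J n). a \<le> (lam n j)\<^sup>2 \<and> (lam n j)\<^sup>2 \<le> b"
    and S: "S \<in> {Known \<sigma>0, Marginal_MLE} \<union> {Inverse_Gamma \<beta>1 \<beta>2 | \<beta>1 \<beta>2. \<beta>1 > 0 \<and> \<beta>2 > 0}"
    and \<gamma>: "\<gamma> \<in> {0<..<1}"
    and M: "filterlim M at_top sequentially"
    and J: "\<And>n. 0 < J n" "(\<lambda>n. real (J n)) \<in> \<Theta>(\<lambda>n. real n powr (1 / (2 + d)))"
  shows
    "(\<forall>f0\<in>monotone_fns. (\<lambda>n. true_expectation P X eps f0 (\<phi> n)) \<longlonglongrightarrow> 0)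
   \<and> ((\<lambda>n. M n * real n powr (- 1 / (d + 2))) \<longlonglongrightarrow> 0 \<longrightarrow>
       (\<forall>f0. integrable (completion G) f0 \<and> f0 \<notin> L1_closure G monotone_fns \<longrightarrow>
          (\<lambda>n. true_expectation P X eps f0 (\<lambda>xs ys. 1 - \<phi> n xs ys)) \<longlonglongrightarrow> 0))
   \<and> (\<forall>\<alpha>\<in>{0<..<1}. \<forall>L>0.
       (\<lambda>n. M n * real n powr (- 1 / (d + 2))) \<in> O(\<lambda>n. real n powr (- \<alpha> / (2 + d))) \<longrightarrow>
       (\<exists>C>0. (\<lambda>n. SUP f0\<in>{f0 \<in> holder_class \<alpha> L.
                     L1_setdist G f0 monotone_fns > C * real n powr (- \<alpha> / (2 + d))}.
                   ennreal (true_expectation P X eps f0 (\<lambda>xs ys. 1 - \<phi> n xs ys))) \<longlonglongrightarrow> 0))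
   \<and> (\<forall>L>0. \<forall>C>1. (\<lambda>n. SUP f0\<in>{f0 \<in> holder_class 1 L.
                     L1_setdist G f0 monotone_fns > C * M n * real n powr (- 1 / (2 + d))}.
                   ennreal (true_expectation P X eps f0 (\<lambda>xs ys. 1 - \<phi> n xs ys))) \<longlonglongrightarrow> 0)"
proof -
  obtain Bg where Bg: "\<And>x. g x \<le> Bg" using G_density(3) by blast
  then have Bg0: "0 \<le> Bg" using G_density(2) by (meson order_trans)
  obtain B where B: "\<And>n j. j \<in> indices (J n) \<Longrightarrow> \<bar>\<zeta> n j\<bar> \<le> B" using \<zeta>_bounded by blast
  obtain a b where a: "0 < a"
    and ab: "\<And>n j. j \<in> indices (J n) \<Longrightarrow> a \<le> (lam n j)\<^sup>2 \<and> (lam n j)\<^sup>2 \<le> b"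
    using lam_bounded by blast
  \<comment> \<open>The maxima enforce the normalisations 0 \<le> B and 1 \<le> b of
    \<open>prior_bounded\<close>; the given bounds may violate them.\<close>
  have prior: "prior_bounded (max 0 B) a (max 1 b) (J n) (\<zeta> n) (lam n)" for n
    using a B ab by (auto simp: prior_bounded_def le_max_iff_disj)
  have S': "valid_treatment S" using S by auto
  have "random_design P G X eps \<sigma>0"
    by (intro random_design.intro random_design_axioms.intro P X_iid X_eps_indep eps_iid(1) eps_mean eps_var)
  then interpret monotonicity_setting P G X eps \<sigma>0 g J \<zeta> lam M \<gamma> S "max 0 B" a "max 1 b" Bg
    using G_density G_cube Bg Bg0 a prior S' \<gamma> M J
    by (intro monotonicity_setting.intro monotonicity_setting_axioms.intro) (auto simp: d_def)
  have rate: "rate = (\<lambda>n. real n powr (- 1 / (d + 2)))" "rate = (\<lambda>n. real n powr (- 1 / (2 + d)))"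
    by (simp_all add: rate_def d_def add.commute fun_eq_iff)
  have \<phi>: "\<phi> = test" by (simp add: \<phi>_def rate(1))
  have d': "2 + real CARD('d) = 2 + d" by (simp add: d_def)
  show ?thesis
    unfolding \<phi>
  proof (intro conjI impI ballI allI)
    show "(\<lambda>n. true_expectation P X eps f0 (test n)) \<longlonglongrightarrow> 0" if "f0 \<in> monotone_fns" for f0
      using that by (rule test_level)
    show "(\<lambda>n. true_expectation P X eps f0 (\<lambda>xs ys. 1 - test n xs ys)) \<longlonglongrightarrow> 0"
      if "(\<lambda>n. M n * real n powr (- 1 / (d + 2))) \<longlonglongrightarrow> 0"
        "integrable (completion G) f0 \<and> f0 \<notin> L1_closure G monotone_fns" for f0
      using that by (intro test_consistent) (auto simp: rate(1))
    show "\<exists>C>0. (\<lambda>n. SUP f0\<in>{f0 \<in> holder_class \<alpha> L. L1_setdist G f0 monotone_fns > C * real n powr (- \<alpha> / (2 + d))}.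
        ennreal (true_expectation P X eps f0 (\<lambda>xs ys. 1 - test n xs ys))) \<longlonglongrightarrow> 0"
      if "\<alpha> \<in> {0<..<1}" "0 < L"
        "(\<lambda>n. M n * real n powr (- 1 / (d + 2))) \<in> O(\<lambda>n. real n powr (- \<alpha> / (2 + d)))" for \<alpha> L
      using test_power_holder[of \<alpha> L, unfolded d'] that by (simp add: rate(1))
    show "(\<lambda>n. SUP f0\<in>{f0 \<in> holder_class 1 L. L1_setdist G f0 monotone_fns > C * M n * real n powr (- 1 / (2 + d))}.
        ennreal (true_expectation P X eps f0 (\<lambda>xs ys. 1 - test n xs ys))) \<longlonglongrightarrow> 0"
      if "0 < L" "1 < C" for L C
      using test_power_lipschitz[OF that] unfolding rate(2) .
  qed
qed

end
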